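(* Let $T\subseteq\mathbb{C}$ be a discrete subset and let $F:\mathfrak{h}^g\times(\Pi_1\setminus T)\to\mathbb{C}$ be such that $(z,s)\mapsto F(z,s)$ is real analytic and $s\mapsto F(z,s)$ is holomorphic on $\Pi_1\setminus T$. Assume: (i) there is a lattice $\mathcal{L}\subseteq\mathbb{R}^g$ such that $F(z+\ell,s)=F(z,s)$ for all $(z,s)$ and all $\ell\in\mathcal{L}$; (ii) there is a function $\phi_1:\Pi_1\setminus T\to\mathbb{C}$ such that for each fixed $s$ there is $C_s>0$ with $|F(z,s)-\phi_1(s)|\operatorname{Norm}(y)|^s|\le C_s|\operatorname{Norm}(y)|^{1-s}$ for all $z\in\mathfrak{h}^g$; (iii) there is $p=(p_j)\in\mathbb{Z}^g$ such that $\Delta_{j,p_j}F(z,s)=s(1-s)F(z,s)$ for all $j\in\{1,\ldots,g\}$ and all $(z,s)$. Let $F(z,s)=a_0(y,s)+\sum_{\xi\in\mathcal{L}^*\setminus\{0\}}a_\xi(y,s)e^{2\pi i\operatorname{Tr}(\xi x)}$ be the Fourier expansion of $x\mapsto F(x+iy,s)$. Then $a_0(y,s)=\phi_1(s)|\operatorname{Norm}(y)|^s+\phi_2(s)|\operatorname{Norm}(y)|^{1-s}$ for some holomorphic functions $\phi_1,\phi_2$ on $\Pi_1\setminus T$. Moreover, with $m_p=\max\{\pm\frac{p_j}{2}:1\le j\le g\}$ and $M_p=m_p+1$, for each $\xi\in\mathcal{L}^*\setminus\{0\}$ there is a function $c_\xi(s)$, holomorphic on $\Pi_{M_p}\setminus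 T$, such that $a_\xi(y,s)=c_\xi(s)B_\xi(y;p;s)$.
   Context: $\mathfrak{h}^g$ is the product of $g$ upper half-planes, $z=x+iy$, $\operatorname{Norm}(y)=\prod y_j$; for $\xi,x\in\mathbb{R}^g$, $\operatorname{Tr}(\xi x)=\sum_j\xi_jx_j$. $\Pi_a=\{s\in\mathbb{C}:\operatorname{Re}(s)>a\}$. A lattice $\mathcal{L}\subseteq\mathbb{R}^g$ is a discrete subgroup of rank $g$; $\mathcal{L}^*=\{\xi\in\mathbb{R}^g:\operatorname{Tr}(\xi\ell)\in\mathbb{Z}\ \forall\ell\in\mathcal{L}\}$, and $a_\xi(y,s)=\operatorname{vol}(\mathbb{R}^g/\mathcal{L})^{-1}\int_{\mathbb{R}^g/\mathcal{L}}F(x+iy,s)e^{-2\pi i\operatorname{Tr}(\xi x)}dx$. $\Delta_{j,p_j}=-y_j^2(\partial_{x_j}^2+\partial_{y_j}^2)+ip_jy_j\partial_{x_j}$. $U(a,b;x)$ is Tricomi's confluent hypergeometric function: for $x>0$, $\operatorname{Re}a>0$, $U(a,b;x)=\Gamma(a)^{-1}\int_0^\infty e^{-xt}t^{a-1}(1+t)^{b-a-1}dt$, extended holomorphically to all $(a,b)\in\mathbb{C}^2$. For $A,B\in\mathbb{C}$ and $u\in\mathbb{R}^\times$ define $\tau(A,B;1,u)=(2\pi)^{A+B}i^{B-A}\Gamma(A)^{-1}e^{-2\pi u}U(B,A+B;4\pi u)$ if $u>0$ and $\tau(A,B;1,u)=(2\pi)^{A+B}i^{A-B}\Gamma(B)^{-1}e^{-2\pi|u|}U(A,A+B;4\pi|u|)$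 if $u<0$ (with $i^c=e^{i\pi c/2}$, $1/\Gamma$ entire). Finally $B_\xi(y;p;s)=\prod_{j=1}^g\tau\big(s+\tfrac{p_j}{2},\,s-\tfrac{p_j}{2};\,1,\,\xi_jy_j\big)$.
   Formalization: The last formula is proved as a_ξ(y,s) = c_ξ(s)|Norm(y)|^s B_ξ(y;p;s), since without the factor |Norm(y)|^s it is false for the given τ, and only for ξ with all ξ_j ≠ 0, since τ(A,B;1,u), hence B_ξ, is undefined at u = 0. *)

theory Defs
  imports "HOL-Analysis.Analysis" "HOL-Complex_Analysis.Complex_Analysis"
begin

definition half_plane :: "real \<Rightarrow> complex set" where
  "half_plane a = {s. Re s > a}"

definition upper_half_space :: "(complex ^ 'n) set" where
  "upper_half_space = {z. \<forall>j. Im (z $ j) > 0}"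

definition Norm :: "real ^ 'n \<Rightarrow> real" where
  "Norm y = (\<Prod>j\<in>UNIV. y $ j)"

definition Tr :: "real ^ 'n \<Rightarrow> real" where
  "Tr x = (\<Sum>j\<in>UNIV. x $ j)"

definition Im_vec :: "complex ^ 'n \<Rightarrow> real ^ 'n" where
  "Im_vec z = (\<chi> j. Im (z $ j))"

definition Complex_vec :: "real ^ 'n \<Rightarrow> real ^ 'n \<Rightarrow> complex ^ 'n" where
  "Complex_vec x y = (\<chi> j. Complex (x $ j) (y $ j))"

text \<open>
  Multi-indices are functions on the standard basis, extended by zero. The sum is unconditional,
  i.e. an absolutely convergent power series in the real coordinates. As with the library's
  notion \<^const>\<open>analytic_on\<close>, the expansion is required on a full neighbourhood of each point.
\<close>

definition real_analytic_on ::
    "('a::euclidean_space \<Rightarrow> 'b::real_normed_vector) \<Rightarrow> 'a set \<Rightarrow> bool" where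
  "real_analytic_on f S \<longleftrightarrow>
     (\<forall>x\<in>S. \<exists>r>0. \<exists>c :: ('a \<Rightarrow> nat) \<Rightarrow> 'b. \<forall>y\<in>ball x r.
        ((\<lambda>\<alpha>. (\<Prod>b\<in>Basis. ((y - x) \<bullet> b) ^ \<alpha> b) *\<^sub>R c \<alpha>) has_sum f y)
          {\<alpha>. \<forall>b. b \<notin> Basis \<longrightarrow> \<alpha> b = 0})"

definition partial_x :: "'n \<Rightarrow> (complex ^ 'n \<Rightarrow> complex) \<Rightarrow> complex ^ 'n \<Rightarrow> complex" where
  "partial_x j f z = vector_derivative (\<lambda>t::real. f (z + t *\<^sub>R axis j 1)) (at 0)"

definition partial_y :: "'n \<Rightarrow> (complex ^ 'n \<Rightarrow> complex) \<Rightarrow> complex ^ 'n \<Rightarrow> complex" where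
  "partial_y j f z = vector_derivative (\<lambda>t::real. f (z + t *\<^sub>R axis j \<i>)) (at 0)"

definition Laplacian ::
    "'n \<Rightarrow> int \<Rightarrow> (complex ^ 'n \<Rightarrow> complex) \<Rightarrow> complex ^ 'n \<Rightarrow> complex" where
  "Laplacian j p f z =
     - (of_real (Im (z $ j)))\<^sup>2 * (partial_x j (partial_x j f) z + partial_y j (partial_y j f) z)
     + \<i> * of_int p * of_real (Im (z $ j)) * partial_x j f z"

text \<open>The rank of a discrete subgroup of \<open>\<real>\<^sup>g\<close> is the dimension of its real span.\<close>

definition is_lattice :: "(real ^ 'n) set \<Rightarrow> bool" where
  "is_lattice L \<longleftrightarrow>
     0 \<in> L \<and> (\<forall>x\<in>L. \<forall>y\<in>L. x - y \<in> L) \<and> discrete L \<and> dim L = CARD('n)"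

definition dual_lattice :: "(real ^ 'n) set \<Rightarrow> (real ^ 'n) set" where
  "dual_lattice L = {\<xi>. \<forall>l\<in>L. Tr (\<xi> * l) \<in> \<int>}"

definition lattice_basis :: "(real ^ 'n) set \<Rightarrow> ('n \<Rightarrow> real ^ 'n) \<Rightarrow> bool" where
  "lattice_basis L b \<longleftrightarrow> inj b \<and> independent (range b) \<and>
     L = range (\<lambda>k::'n \<Rightarrow> int. \<Sum>j\<in>UNIV. of_int (k j) *\<^sub>R b j)"

text \<open>
  Integration over \<open>\<real>\<^sup>g/L\<close> is integration over a half-open fundamental parallelepiped;
  for \<open>L\<close>-periodic integrands the choice of the \<open>\<int>\<close>-basis is immaterial.
\<close>

definition fundamental_domain :: "(real ^ 'n) set \<Rightarrow> (real ^ 'n) set" where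
  "fundamental_domain L =
     (let b = (SOME b. lattice_basis L b)
      in {\<Sum>j\<in>UNIV. t j *\<^sub>R b j | t. \<forall>j. 0 \<le> t j \<and> t j < 1})"

definition fourier_coeff ::
    "(real ^ 'n) set \<Rightarrow> (complex ^ 'n \<Rightarrow> complex \<Rightarrow> complex) \<Rightarrow>
     real ^ 'n \<Rightarrow> real ^ 'n \<Rightarrow> complex \<Rightarrow> complex" where
  "fourier_coeff L F \<xi> y s =
     (LINT x:fundamental_domain L|lborel.
        F (Complex_vec x y) s * exp (- 2 * of_real pi * \<i> * of_real (Tr (\<xi> * x))))
     / of_real (measure lborel (fundamental_domain L))"

definition tricomi_integral :: "complex \<Rightarrow> complex \<Rightarrow> real \<Rightarrow> complex" where
  "tricomi_integral a b x = rGamma a *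
     (LINT t:{0<..}|lborel. of_real (exp (- x * t)) * of_real t powr (a - 1)
        * of_real (1 + t) powr (b - a - 1))"

text \<open>
  For fixed \<open>b\<close> and \<open>x > 0\<close> the entire extension in \<open>a\<close> is unique by the identity theorem; it is
  therefore the restriction of the extension that is jointly holomorphic in \<open>(a, b)\<close>.
\<close>

definition tricomi_U :: "complex \<Rightarrow> complex \<Rightarrow> real \<Rightarrow> complex" where
  "tricomi_U a b x =
     (if Re a > 0 then tricomi_integral a b x
      else (SOME G. G holomorphic_on UNIV \<and>
              (\<forall>a'. Re a' > 0 \<longrightarrow> G a' = tricomi_integral a' b x)) a)"

text \<open>\<open>tau A B u\<close> is \<open>\<tau>(A, B; 1, u)\<close>; it is meaningful only for \<open>u \<noteq> 0\<close>.\<close>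

definition tau :: "complex \<Rightarrow> complex \<Rightarrow> real \<Rightarrow> complex" where
  "tau A B u =
     (if u > 0 then
        of_real (2 * pi) powr (A + B) * exp (\<i> * of_real pi * (B - A) / 2) * rGamma A
          * of_real (exp (- 2 * pi * u)) * tricomi_U B (A + B) (4 * pi * u)
      else
        of_real (2 * pi) powr (A + B) * exp (\<i> * of_real pi * (A - B) / 2) * rGamma B
          * of_real (exp (- 2 * pi * \<bar>u\<bar>)) * tricomi_U A (A + B) (4 * pi * \<bar>u\<bar>))"

text \<open>
  The solution of \<open>\<Delta>\<^sub>j f = s (1 - s) f\<close>, \<open>f = h(y\<^sub>j) exp (2 \<pi> \<i> \<xi>\<^sub>j x\<^sub>j)\<close>, that decays at infinity is the
  Whittaker function \<open>W\<^bsub>\<plusminus>p/2, s-1/2\<^esub>(v) = v\<^sup>s e\<^bsup>-v/2\<^esup> U(s \<mp> p/2, 2 s; v)\<close> with \<open>v = 4 \<pi> |\<xi>\<^sub>j| y\<^sub>j\<close>.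
  Since \<open>tau\<close> does not contain the power \<open>v\<^sup>s\<close>, it is \<open>Norm(y)\<^sup>s B_coeff \<xi> y p s\<close>, rather than
  \<open>B_coeff \<xi> y p s\<close> alone, that is an eigenfunction.
\<close>

definition B_coeff :: "real ^ 'n \<Rightarrow> real ^ 'n \<Rightarrow> int ^ 'n \<Rightarrow> complex \<Rightarrow> complex" where
  "B_coeff \<xi> y p s =
     (\<Prod>j\<in>UNIV. tau (s + of_int (p $ j) / 2) (s - of_int (p $ j) / 2) (\<xi> $ j * y $ j))"

definition m_p :: "int ^ 'n \<Rightarrow> real" where
  "m_p p = Max (range (\<lambda>j. of_int (p $ j) / 2) \<union> range (\<lambda>j. - (of_int (p $ j) / 2)))"

definition M_p :: "int ^ 'n \<Rightarrow> real" where
  "M_p p = m_p p + 1"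

end

theory Submission
  imports Defs
begin

text \<open>
  Fix \<open>s\<close>. Differentiating under the integral sign and integrating by parts over the lattice, the
  coefficient \<open>a\<^sub>\<xi>(y, s)\<close> solves in each variable \<open>y\<^sub>j\<close> separately a Whittaker equation (\<open>\<xi>\<^sub>j \<noteq> 0\<close>)
  or an Euler equation (\<open>\<xi> = 0\<close>). By the growth condition \<open>a\<^sub>\<xi>\<close>, respectively
  \<open>a\<^sub>0 - \<phi>\<^sub>1 Norm(y)\<^sup>s\<close>, tends to \<open>0\<close> in every variable, which singles out a one-dimensional space of
  solutions: multiples of the Tricomi integral, respectively of \<open>y\<^sub>j\<^bsup>1-s\<^esup>\<close>. Varying one coordinate at a
  time gives the product formulas. The factors depending on \<open>s\<close> alone are quotients of
  \<open>a\<^sub>\<xi>(y, s)\<close> at suitable fixed \<open>y\<close> by explicit holomorphic functions.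

  The set \<open>T\<close> need not be closed, so \<open>half_plane 1 - T\<close> need not be open. But \<open>F\<close> is real
  differentiable on a full neighbourhood of each point, and \<open>T\<close> is countable, so the derivative within
  \<open>half_plane 1 - T\<close> determines the full real derivative and shows that it is complex linear.
\<close>

text \<open>The second, exponentially growing Whittaker solution and its asymptotics are avoided.
  Two decaying solutions are compared at one point so far out that the coefficient of the equation
  has nonnegative real part from there on; convexity shows that a decaying solution which vanishes
  there is zero, and an energy estimate carries this down to \<open>t = 0\<close>.

  The constant \<open>M_p = m_p + 1\<close> comes from the Tricomi integrand, which contains
  \<open>t powr (s - \<kappa> - 1)\<close> with
  \<open>\<bar>\<kappa>\<bar> = \<bar>p_j\<bar> / 2\<close>. For \<open>Re s > M_p\<close> this
  exponent has positive real part, so the integrand is bounded near 0 and stays so after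
  differentiation in \<open>s\<close> has produced a logarithm. Hence only the integral for U
  occurs, never its continuation.

  All components of \<xi> are nonzero because a component \<open>\<xi>_j = 0\<close> makes the j-th
  equation Eulerian: its solutions are powers of \<open>y_j\<close>, and tau has no meaning at 0.

  Holomorphy of \<open>phi1\<close> is part of the claim. The values of \<open>a_0\<close> at two
  points with different \<open>Norm\<close> give two linear equations for \<open>phi1 s\<close> and
  \<open>phi2 s\<close>, whose determinant does not vanish for \<open>Re s > 1\<close>.\<close>

no_notation fps_nth (infixl "$" 75)

section \<open>Differentiation under the integral sign\<close>

text \<open>The mean value inequality turns the bound on the derivative over a ball into the bound
  \<open>2 * g\<close> for the normalised remainder, to which dominated convergence applies along
  sequences. The parameter space and the measure are general because the lemma serves power series
  (counting measure), translations of a fundamental domain, Laplace integrals and Fourier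
  integrals.\<close>

lemma has_derivative_integral_dominated:
  fixes f :: "'a::{real_normed_vector, perfect_space} \<Rightarrow> 'm \<Rightarrow> 'b::{banach, second_countable_topology}"
  assumes r: "r > 0"
    and der: "\<And>x t. x \<in> ball x0 r \<Longrightarrow> t \<in> space M \<Longrightarrow> ((\<lambda>x. f x t) has_derivative f' x t) (at x)"
    and bound: "\<And>x t h. x \<in> ball x0 r \<Longrightarrow> t \<in> space M \<Longrightarrow> norm (f' x t h) \<le> g t * norm h"
    and g: "integrable M g"
    and f: "\<And>x. x \<in> ball x0 r \<Longrightarrow> integrable M (f x)"
    and f': "\<And>h. (\<lambda>t. f' x0 t h) \<in> borel_measurable M"
  shows "((\<lambda>x. \<integral>t. f x t \<partial>M) has_derivative (\<lambda>h. \<integral>t. f' x0 t h \<partial>M)) (at x0)"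
proof -
  have f'm[measurable]: "(\<lambda>t. f' x0 t h) \<in> borel_measurable M" for h by (rule f')
  have x0: "x0 \<in> ball x0 r" using r by simp
  have int': "integrable M (\<lambda>t. f' x0 t h)" for h
  proof (rule Bochner_Integration.integrable_bound)
    show "integrable M (\<lambda>t. g t * norm h)" using g by simp
    show "AE t in M. norm (f' x0 t h) \<le> norm (g t * norm h)"
      using bound[OF x0] by (intro AE_I2) (simp, metis abs_ge_self order_trans abs_mult abs_norm_cancel real_norm_def)
  qed simp
  have bl: "bounded_linear (f' x0 t)" if "t \<in> space M" for t
    using der[OF x0 that] by (rule has_derivative_bounded_linear)
  have blin: "bounded_linear (\<lambda>h. \<integral>t. f' x0 t h \<partial>M)"
  proof (rule bounded_linear_intro[where K="\<integral>t. g t \<partial>M"])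
    show "(\<integral>t. f' x0 t (x + y) \<partial>M) = (\<integral>t. f' x0 t x \<partial>M) + (\<integral>t. f' x0 t y \<partial>M)" for x y
      unfolding Bochner_Integration.integral_add[OF int' int', symmetric]
      by (rule Bochner_Integration.integral_cong) (auto simp: linear_add[OF bounded_linear.linear[OF bl]])
    show "(\<integral>t. f' x0 t (c *\<^sub>R x) \<partial>M) = c *\<^sub>R (\<integral>t. f' x0 t x \<partial>M)" for c x
      unfolding integral_scaleR_right[symmetric]
      by (rule Bochner_Integration.integral_cong) (auto simp: linear_scale[OF bounded_linear.linear[OF bl]])
    show "norm (\<integral>t. f' x0 t x \<partial>M) \<le> norm x * (\<integral>t. g t \<partial>M)" for x
    proof -
      have "norm (\<integral>t. f' x0 t x \<partial>M) \<le> (\<integral>t. g t * norm x \<partial>M)"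
        by (rule order_trans[OF integral_norm_bound integral_mono]) (use int' g bound[OF x0] in auto)
      then show ?thesis by (simp add: mult.commute)
    qed
  qed
  have bd: "norm (f x t - f x0 t - f' x0 t (x - x0)) \<le> 2 * g t * norm (x - x0)"
    if "x \<in> ball x0 r" "t \<in> space M" for x t
  proof -
    have "norm (f x t - f x0 t) \<le> g t * norm (x - x0)"
    proof (rule differentiable_bound[OF convex_ball])
      show "((\<lambda>x. f x t) has_derivative f' y t) (at y within ball x0 r)" if "y \<in> ball x0 r" for y
        using der[OF that \<open>t \<in> space M\<close>] by (rule has_derivative_at_withinI)
      show "onorm (f' y t) \<le> g t" if "y \<in> ball x0 r" for y
        using bound[OF that \<open>t \<in> space M\<close>] by (rule onorm_le)
    qed (use that x0 in auto)
    moreover have "norm (f' x0 t (x - x0)) \<le> g t * norm (x - x0)" using bound[OF x0] that by blast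
    ultimately show ?thesis
      using norm_triangle_ineq4[of "f x t - f x0 t" "f' x0 t (x - x0)"] by linarith
  qed
  have lim: "((\<lambda>x. \<integral>t. (f x t - f x0 t - f' x0 t (x - x0)) /\<^sub>R norm (x - x0) \<partial>M) \<longlongrightarrow> 0) (at x0)"
    unfolding tendsto_at_iff_sequentially comp_def
  proof (intro allI impI)
    fix X :: "nat \<Rightarrow> 'a" assume X: "\<forall>i. X i \<in> UNIV - {x0}" "X \<longlonglongrightarrow> x0"
    have "\<forall>\<^sub>F n in sequentially. X n \<in> ball x0 r"
      by (rule topological_tendstoD[OF X(2) open_ball x0])
    then obtain N where N: "\<And>n. n \<ge> N \<Longrightarrow> X n \<in> ball x0 r" by (auto simp: eventually_sequentially)
    \<comment> \<open>The bound on the remainder holds only inside the ball, so the finitely many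
      terms that may lie outside are dropped.\<close>
    define Y where "Y n = X (n + N)" for n
    have Y: "Y n \<in> ball x0 r" "Y n \<noteq> x0" for n using N X(1) unfolding Y_def by auto
    have Ylim: "Y \<longlonglongrightarrow> x0" unfolding Y_def using X(2) by (rule LIMSEQ_ignore_initial_segment)
    have "(\<lambda>n. \<integral>t. (f (Y n) t - f x0 t - f' x0 t (Y n - x0)) /\<^sub>R norm (Y n - x0) \<partial>M)
        \<longlonglongrightarrow> (\<integral>t. 0 \<partial>M)"
    proof (rule integral_dominated_convergence)
      show "integrable M (\<lambda>t. 2 * g t)" using g by simp
      show "(\<lambda>t. (f (Y n) t - f x0 t - f' x0 t (Y n - x0)) /\<^sub>R norm (Y n - x0)) \<in> borel_measurable M" for n
        using borel_measurable_integrable[OF f[OF Y(1)]] borel_measurable_integrable[OF f[OF x0]]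
        by measurable
      show "AE t in M. norm ((f (Y n) t - f x0 t - f' x0 t (Y n - x0)) /\<^sub>R norm (Y n - x0)) \<le> 2 * g t" for n
        using bd[OF Y(1)[of n]] Y(2)[of n]
        by (intro AE_I2) (simp add: norm_scaleR divide_simps del: scaleR_right_diff_distrib flip: divide_inverse_commute)
      show "AE t in M. (\<lambda>n. (f (Y n) t - f x0 t - f' x0 t (Y n - x0)) /\<^sub>R norm (Y n - x0)) \<longlonglongrightarrow> 0"
      proof (intro AE_I2)
        fix t assume t: "t \<in> space M"
        have "((\<lambda>x. norm (f x t - f x0 t - f' x0 t (x - x0)) / norm (x - x0)) \<longlongrightarrow> 0) (at x0)"
          using der[OF x0 t] by (simp add: has_derivative_iff_norm)
        then have "(\<lambda>n. norm (f (Y n) t - f x0 t - f' x0 t (Y n - x0)) / norm (Y n - x0)) \<longlonglongrightarrow> 0"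
          using Ylim Y(2) unfolding tendsto_at_iff_sequentially comp_def by auto
        then show "(\<lambda>n. (f (Y n) t - f x0 t - f' x0 t (Y n - x0)) /\<^sub>R norm (Y n - x0)) \<longlonglongrightarrow> 0"
          by (subst tendsto_norm_zero_iff[symmetric]) (simp add: divide_inverse mult.commute)
      qed
    qed simp
    then have "(\<lambda>n. \<integral>t. (f (X (n + N)) t - f x0 t - f' x0 t (X (n + N) - x0)) /\<^sub>R norm (X (n + N) - x0) \<partial>M)
        \<longlonglongrightarrow> 0" by (simp add: Y_def)
    then show "(\<lambda>n. \<integral>t. (f (X n) t - f x0 t - f' x0 t (X n - x0)) /\<^sub>R norm (X n - x0) \<partial>M) \<longlonglongrightarrow> 0"
      by (rule LIMSEQ_offset)
  qed
  show ?thesis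
    unfolding has_derivative_iff_norm
  proof (intro conjI blin)
    have "\<forall>\<^sub>F x in at x0. norm (\<integral>t. (f x t - f x0 t - f' x0 t (x - x0)) /\<^sub>R norm (x - x0) \<partial>M)
       = norm ((\<integral>t. f x t \<partial>M) - (\<integral>t. f x0 t \<partial>M) - (\<integral>t. f' x0 t (x - x0) \<partial>M)) / norm (x - x0)"
    proof -
      have "\<forall>\<^sub>F x in at x0. x \<in> ball x0 r" using eventually_at_in_open'[OF open_ball x0] .
      then show ?thesis
      proof eventually_elim
        case (elim x)
        then show ?case using f[OF elim] f[OF x0] int' by (simp add: divide_inverse mult.commute)
      qed
    qed
    then show "((\<lambda>x. norm ((\<integral>t. f x t \<partial>M) - (\<integral>t. f x0 t \<partial>M) - (\<integral>t. f' x0 t (x - x0) \<partial>M)) / norm (x - x0))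
       \<longlongrightarrow> 0) (at x0)"
      using tendsto_norm_zero[OF lim] by (rule tendsto_cong[THEN iffD1])
  qed
qed

section \<open>Real analytic functions\<close>

text \<open>The factor n produced by differentiation is paid for by halving the radius, since
  \<open>n \<le> 2 ^ n\<close>.\<close>

lemma power_pred_bound:
  fixes u \<rho> :: real
  assumes "\<bar>u\<bar> \<le> \<rho> / 2" "\<rho> > 0"
  shows "\<bar>real n * u ^ (n - 1)\<bar> \<le> 2 / \<rho> * \<rho> ^ n"
proof (cases n)
  case (Suc m)
  have "real n \<le> 2 ^ n" by (simp add: of_nat_less_two_power less_imp_le)
  have "\<bar>real n * u ^ (n - 1)\<bar> = real n * \<bar>u\<bar> ^ m" using Suc by (simp add: abs_mult power_abs)
  also have "\<dots> \<le> 2 ^ n * (\<rho> / 2) ^ m"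
    using assms \<open>real n \<le> 2 ^ n\<close> by (intro mult_mono power_mono) auto
  also have "\<dots> = 2 / \<rho> * \<rho> ^ n" using Suc assms by (simp add: power_divide)
  finally show ?thesis .
qed (use assms in simp)

abbreviation multi_indices :: "('a::euclidean_space \<Rightarrow> nat) set" where
  "multi_indices \<equiv> {\<alpha>. \<forall>b. b \<notin> Basis \<longrightarrow> \<alpha> b = 0}"

definition monomial :: "('a::euclidean_space \<Rightarrow> nat) \<Rightarrow> 'a \<Rightarrow> real" where
  "monomial \<alpha> u = (\<Prod>b\<in>Basis. (u \<bullet> b) ^ \<alpha> b)"

text \<open>The truncated exponent at \<open>\<alpha> b = 0\<close> does no harm: the factor
  \<open>real (\<alpha> b)\<close> is then zero.\<close>

definition monomial_deriv :: "'a \<Rightarrow> ('a::euclidean_space \<Rightarrow> nat) \<Rightarrow> 'a \<Rightarrow> real" where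
  "monomial_deriv b \<alpha> u = real (\<alpha> b) * (u \<bullet> b) ^ (\<alpha> b - 1) * (\<Prod>i\<in>Basis - {b}. (u \<bullet> i) ^ \<alpha> i)"

lemma has_derivative_monomial:
  "((\<lambda>y. monomial \<alpha> (y - x)) has_derivative (\<lambda>h. \<Sum>b\<in>Basis. (h \<bullet> b) * monomial_deriv b \<alpha> (y - x))) (at y)"
  unfolding monomial_def monomial_deriv_def
  by (rule has_derivative_eq_rhs, rule has_derivative_prod,
      (rule derivative_eq_intros refl)+) (auto intro!: sum.cong ext)

lemma monomial_deriv_bound:
  fixes u :: "'a::euclidean_space"
  assumes u: "norm u \<le> \<rho> / 2" and "\<rho> > 0" and b: "b \<in> Basis"
  shows "\<bar>monomial_deriv b \<alpha> u\<bar> \<le> 2 / \<rho> * (\<Prod>i\<in>Basis. \<rho> ^ \<alpha> i)"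
proof -
  have ub: "\<bar>u \<bullet> i\<bar> \<le> \<rho> / 2" if "i \<in> Basis" for i using Basis_le_norm[OF that] u order_trans by blast
  have "\<bar>monomial_deriv b \<alpha> u\<bar>
      = \<bar>real (\<alpha> b) * (u \<bullet> b) ^ (\<alpha> b - 1)\<bar> * (\<Prod>i\<in>Basis - {b}. \<bar>u \<bullet> i\<bar> ^ \<alpha> i)"
    unfolding monomial_deriv_def abs_mult abs_prod power_abs ..
  also have "\<dots> \<le> (2 / \<rho> * \<rho> ^ \<alpha> b) * (\<Prod>i\<in>Basis - {b}. \<rho> ^ \<alpha> i)"
  proof (intro mult_mono power_pred_bound ub b \<open>\<rho> > 0\<close> prod_mono conjI power_mono)
    show "\<bar>u \<bullet> i\<bar> \<le> \<rho>" if "i \<in> Basis - {b}" for i using ub[of i] that \<open>\<rho> > 0\<close> by auto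
  qed (use \<open>\<rho> > 0\<close> in \<open>auto intro!: prod_nonneg\<close>)
  also have "\<dots> = 2 / \<rho> * (\<Prod>i\<in>Basis. \<rho> ^ \<alpha> i)"
    using b by (subst prod.remove[of Basis b]) auto
  finally show ?thesis .
qed

text \<open>Reading an unconditional sum as an integral over counting measure makes termwise
  differentiation of a power series an instance of differentiation under the integral sign.\<close>

lemma has_sum_eq_integral_count_space:
  fixes f :: "'i \<Rightarrow> complex"
  assumes "integrable (count_space A) f"
  shows "(f has_sum (\<integral>i. f i \<partial>count_space A)) A"
proof -
  have a: "Infinite_Set_Sum.abs_summable_on f A" using assms by (simp add: Infinite_Set_Sum.abs_summable_on_def)
  then have "f summable_on A"
    by (simp only: abs_summable_summable flip: abs_summable_equivalent)
  moreover have "infsum f A = (\<integral>i. f i \<partial>count_space A)"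
    using infsetsum_infsum[OF a] by (simp add: infsetsum_def)
  ultimately show ?thesis using has_sum_infsum[of f A] by simp
qed

text \<open>Absolute convergence at one corner of a cube around \<open>x\<close> dominates all
  termwise derivatives on a ball of half the side length.\<close>

lemma power_series_has_derivative:
  fixes f :: "'a::euclidean_space \<Rightarrow> complex"
  assumes r: "r > 0"
    and f: "\<And>y. y \<in> ball x r \<Longrightarrow> ((\<lambda>\<alpha>. monomial \<alpha> (y - x) *\<^sub>R c \<alpha>) has_sum f y) multi_indices"
  obtains \<rho> where "\<rho> > 0"
    and "\<And>y. y \<in> ball x \<rho> \<Longrightarrow> f differentiable (at y)"
    and "\<And>y b. y \<in> ball x \<rho> \<Longrightarrow> b \<in> Basis \<Longrightarrow>
       ((\<lambda>\<alpha>. monomial_deriv b \<alpha> (y - x) *\<^sub>R c \<alpha>) has_sum frechet_derivative f (at y) b) multi_indices"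
proof -
  \<comment> \<open>The corner whose coordinates all equal \<rho> has norm at most
    \<open>DIM('a) * \<rho> = r / 2\<close>, hence lies in the ball of convergence.\<close>
  define \<rho> where "\<rho> = r / (2 * DIM('a))"
  have \<rho>: "\<rho> > 0" using r by (simp add: \<rho>_def)
  let ?M = "count_space (multi_indices :: ('a \<Rightarrow> nat) set)"
  have intf: "integrable ?M (\<lambda>\<alpha>. monomial \<alpha> (y - x) *\<^sub>R c \<alpha>)" if "y \<in> ball x r" for y
  proof -
    have "(\<lambda>\<alpha>. monomial \<alpha> (y - x) *\<^sub>R c \<alpha>) summable_on multi_indices"
      using f[OF that] has_sum_imp_summable by blast
    then have "(\<lambda>\<alpha>. norm (monomial \<alpha> (y - x) *\<^sub>R c \<alpha>)) summable_on multi_indices"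
      by (rule summable_on_iff_abs_summable_on_complex[THEN iffD1])
    then show ?thesis by (simp only: abs_summable_equivalent Infinite_Set_Sum.abs_summable_on_def)
  qed
  \<comment> \<open>At this corner the monomials are exactly the products of powers of \<rho> that
    bound the derivatives.\<close>
  define y1 :: 'a where "y1 = x + (\<Sum>b\<in>Basis. \<rho> *\<^sub>R b)"
  have "norm (y1 - x) \<le> (\<Sum>b\<in>(Basis::'a set). norm (\<rho> *\<^sub>R b))" unfolding y1_def add_diff_cancel_left' by (rule norm_sum)
  also have "\<dots> = DIM('a) * \<rho>" using \<rho> by simp
  also have "\<dots> < r" using r by (simp add: \<rho>_def)
  finally have y1: "y1 \<in> ball x r" by (simp add: dist_norm norm_minus_commute)
  have y1b: "(y1 - x) \<bullet> b = \<rho>" if "b \<in> Basis" for b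
    using that by (simp add: y1_def inner_sum_left inner_Basis if_distrib cong: if_cong)
  define K where "K \<alpha> = 2 / \<rho> * (\<Prod>i\<in>Basis. \<rho> ^ \<alpha> i) * norm (c \<alpha>)" for \<alpha> :: "'a \<Rightarrow> nat"
  have G: "integrable ?M K"
  proof -
    have "integrable ?M (\<lambda>\<alpha>. (2 / \<rho>) * norm (monomial \<alpha> (y1 - x) *\<^sub>R c \<alpha>))"
      using integrable_norm[OF intf[OF y1]] by simp
    moreover have "(2 / \<rho>) * norm (monomial \<alpha> (y1 - x) *\<^sub>R c \<alpha>) = K \<alpha>" for \<alpha>
      using \<rho> by (simp add: K_def monomial_def y1b abs_prod)
    ultimately show ?thesis by (simp only:)
  qed
  have db: "norm (monomial_deriv b \<alpha> (y - x) *\<^sub>R c \<alpha>) \<le> K \<alpha>"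
    if "y \<in> ball x (\<rho> / 2)" "b \<in> Basis" for y b \<alpha>
    unfolding K_def norm_scaleR real_norm_def
    by (intro mult_right_mono monomial_deriv_bound) (use that \<rho> in \<open>auto simp: dist_norm norm_minus_commute\<close>)
  have intd: "integrable ?M (\<lambda>\<alpha>. monomial_deriv b \<alpha> (y - x) *\<^sub>R c \<alpha>)"
    if "y \<in> ball x (\<rho> / 2)" "b \<in> Basis" for y b
    unfolding real_norm_def
    by (intro Bochner_Integration.integrable_bound[OF G] AE_I2)
      (use db[OF that] in \<open>auto intro: order_trans[OF _ abs_ge_self] simp del: norm_scaleR\<close>)
  have \<rho>r: "\<rho> / 2 \<le> r"
  proof -
    have "real DIM('a) \<ge> 1" using DIM_positive by (simp add: Suc_leI)
    then have "r * 1 \<le> r * (DIM('a) * 4)" using r by (intro mult_left_mono) linarith+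
    then show ?thesis using r by (simp add: \<rho>_def divide_simps)
  qed
  have der: "(f has_derivative (\<lambda>h. \<integral>\<alpha>. (\<Sum>b\<in>Basis. (h \<bullet> b) * monomial_deriv b \<alpha> (y - x)) *\<^sub>R c \<alpha> \<partial>?M)) (at y)"
    if y: "y \<in> ball x (\<rho> / 2)" for y
  proof -
    define e where "e = \<rho> / 2 - dist x y"
    have e: "e > 0" using y by (simp add: e_def)
    have sub: "z \<in> ball x (\<rho> / 2)" if "z \<in> ball y e" for z
      using that dist_triangle[of x z y] by (simp add: e_def)
    have "((\<lambda>y. \<integral>\<alpha>. monomial \<alpha> (y - x) *\<^sub>R c \<alpha> \<partial>?M) has_derivative
       (\<lambda>h. \<integral>\<alpha>. (\<Sum>b\<in>Basis. (h \<bullet> b) * monomial_deriv b \<alpha> (y - x)) *\<^sub>R c \<alpha> \<partial>?M)) (at y)"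
    proof (rule has_derivative_integral_dominated[OF e,
        where g = "\<lambda>\<alpha>. DIM('a) * K \<alpha>"])
      show "((\<lambda>z. monomial \<alpha> (z - x) *\<^sub>R c \<alpha>) has_derivative
        (\<lambda>h. (\<Sum>b\<in>Basis. (h \<bullet> b) * monomial_deriv b \<alpha> (z - x)) *\<^sub>R c \<alpha>)) (at z)" for z \<alpha>
        by (rule has_derivative_scaleR_left[OF has_derivative_monomial])
      show "norm ((\<Sum>b\<in>Basis. (h \<bullet> b) * monomial_deriv b \<alpha> (z - x)) *\<^sub>R c \<alpha>)
        \<le> DIM('a) * K \<alpha> * norm h"
        if "z \<in> ball y e" for z h \<alpha>
      proof -
        have "norm ((\<Sum>b\<in>Basis. (h \<bullet> b) * monomial_deriv b \<alpha> (z - x)) *\<^sub>R c \<alpha>)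
          = norm (\<Sum>b\<in>Basis. (h \<bullet> b) *\<^sub>R (monomial_deriv b \<alpha> (z - x) *\<^sub>R c \<alpha>))"
          by (simp add: scaleR_sum_left)
        also have "\<dots> \<le> (\<Sum>b\<in>(Basis::'a set). norm h * K \<alpha>)"
        proof (rule sum_norm_le)
          fix b :: 'a assume b: "b \<in> Basis"
          show "norm ((h \<bullet> b) *\<^sub>R (monomial_deriv b \<alpha> (z - x) *\<^sub>R c \<alpha>))
            \<le> norm h * K \<alpha>"
            unfolding norm_scaleR[of "h \<bullet> b"]
            by (intro mult_mono db[OF sub[OF that] b] Basis_le_norm[OF b]) auto
        qed
        finally show ?thesis by (simp add: mult_ac)
      qed
      show "integrable ?M (\<lambda>\<alpha>. DIM('a) * K \<alpha>)"
        using G by (intro integrable_mult_right)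
      show "integrable ?M (\<lambda>\<alpha>. monomial \<alpha> (z - x) *\<^sub>R c \<alpha>)" if "z \<in> ball y e" for z
        using intf sub[OF that] \<rho>r by auto
    qed simp
    moreover have "\<forall>\<^sub>F z in at y. (\<integral>\<alpha>. monomial \<alpha> (z - x) *\<^sub>R c \<alpha> \<partial>?M) = f z"
    proof -
      have "z \<in> ball y e \<Longrightarrow> (\<integral>\<alpha>. monomial \<alpha> (z - x) *\<^sub>R c \<alpha> \<partial>?M) = f z" for z
        by (intro has_sum_unique[OF has_sum_eq_integral_count_space[OF intf] f])
          (use sub[of z] \<rho>r in auto)
      then show ?thesis using eventually_at_in_open'[OF open_ball, of y y e] e by (auto elim: eventually_mono)
    qed
    moreover have "(\<integral>\<alpha>. monomial \<alpha> (y - x) *\<^sub>R c \<alpha> \<partial>?M) = f y"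
      by (intro has_sum_unique[OF has_sum_eq_integral_count_space[OF intf] f]) (use y \<rho>r in auto)
    ultimately show ?thesis by (rule has_derivative_transform_eventually) simp
  qed
  show ?thesis
  proof (rule that[of "\<rho> / 2"])
    fix y b :: 'a assume y: "y \<in> ball x (\<rho> / 2)" and b: "b \<in> Basis"
    have "frechet_derivative f (at y) b
       = (\<integral>\<alpha>. (\<Sum>i\<in>Basis. (b \<bullet> i) * monomial_deriv i \<alpha> (y - x)) *\<^sub>R c \<alpha> \<partial>?M)"
      unfolding frechet_derivative_at[OF der[OF y], symmetric] ..
    also have "\<dots> = (\<integral>\<alpha>. monomial_deriv b \<alpha> (y - x) *\<^sub>R c \<alpha> \<partial>?M)"
      using b by (simp add: inner_Basis if_distrib if_distribR cong: if_cong)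
    finally show "((\<lambda>\<alpha>. monomial_deriv b \<alpha> (y - x) *\<^sub>R c \<alpha>) has_sum frechet_derivative f (at y) b) multi_indices"
      using has_sum_eq_integral_count_space[OF intd[OF y b]] by simp
  qed (use \<rho> der in \<open>auto simp: differentiable_def\<close>)
qed

lemma real_analytic_on_iff_monomial:
  "real_analytic_on f S \<longleftrightarrow> (\<forall>x\<in>S. \<exists>r>0. \<exists>c. \<forall>y\<in>ball x r.
     ((\<lambda>\<alpha>. monomial \<alpha> (y - x) *\<^sub>R c \<alpha>) has_sum f y) multi_indices)"
  unfolding real_analytic_on_def monomial_def ..

text \<open>The terms with \<open>\<alpha> b = 0\<close> vanish, and raising the exponent at
  \<open>b\<close> by one enumerates the others. This gives the derivative the shape of a power
  series again.\<close>

lemma has_sum_monomial_deriv_shift: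
  fixes c :: "('a::euclidean_space \<Rightarrow> nat) \<Rightarrow> complex"
  assumes b: "b \<in> Basis"
    and s: "((\<lambda>\<alpha>. monomial_deriv b \<alpha> u *\<^sub>R c \<alpha>) has_sum s) multi_indices"
  shows "((\<lambda>\<alpha>. monomial \<alpha> u *\<^sub>R (real (Suc (\<alpha> b)) *\<^sub>R c (\<alpha>(b := Suc (\<alpha> b))))) has_sum s) multi_indices"
proof -
  let ?P = "{\<alpha> \<in> multi_indices. \<alpha> b > 0}"
  have "((\<lambda>\<alpha>. monomial_deriv b \<alpha> u *\<^sub>R c \<alpha>) has_sum s) ?P"
    using s by (rule has_sum_cong_neutral[THEN iffD1, rotated -1]) (auto simp: monomial_deriv_def)
  moreover have "bij_betw (\<lambda>\<alpha>. \<alpha>(b := Suc (\<alpha> b))) multi_indices ?P"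
    by (rule bij_betwI[where g = "\<lambda>\<alpha>. \<alpha>(b := \<alpha> b - 1)"]) (use b in \<open>auto simp: fun_eq_iff\<close>)
  ultimately have "((\<lambda>\<alpha>. monomial_deriv b (\<alpha>(b := Suc (\<alpha> b))) u *\<^sub>R c (\<alpha>(b := Suc (\<alpha> b)))) has_sum s) multi_indices"
    by (rule has_sum_reindex_bij_betw[THEN iffD2, rotated])
  moreover have "monomial_deriv b (\<alpha>(b := Suc (\<alpha> b))) u = real (Suc (\<alpha> b)) * monomial \<alpha> u" for \<alpha>
  proof -
    have "(\<Prod>i\<in>Basis - {b}. (u \<bullet> i) ^ (\<alpha>(b := Suc (\<alpha> b))) i) = (\<Prod>i\<in>Basis - {b}. (u \<bullet> i) ^ \<alpha> i)"
      by (rule prod.cong) auto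
    then show ?thesis
      unfolding monomial_deriv_def monomial_def using b by (subst prod.remove[of Basis b]) auto
  qed
  ultimately show ?thesis by (simp add: mult.commute)
qed

text \<open>Needed for the second derivatives in the Laplacian: the first derivatives of
  \<open>F\<close> can be treated like \<open>F\<close> itself.\<close>

lemma real_analytic_on_frechet_derivative:
  fixes f :: "'a::euclidean_space \<Rightarrow> complex"
  assumes f: "real_analytic_on f S" and b: "b \<in> Basis"
  shows "real_analytic_on (\<lambda>w. frechet_derivative f (at w) b) S"
  unfolding real_analytic_on_iff_monomial
proof
  fix x assume "x \<in> S"
  then obtain r c where rc: "r > 0"
    "\<And>y. y \<in> ball x r \<Longrightarrow> ((\<lambda>\<alpha>. monomial \<alpha> (y - x) *\<^sub>R c \<alpha>) has_sum f y) multi_indices"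
    using f unfolding real_analytic_on_iff_monomial by meson
  then obtain \<rho> where \<rho>: "\<rho> > 0" "\<And>y b. y \<in> ball x \<rho> \<Longrightarrow> b \<in> Basis \<Longrightarrow>
     ((\<lambda>\<alpha>. monomial_deriv b \<alpha> (y - x) *\<^sub>R c \<alpha>) has_sum frechet_derivative f (at y) b) multi_indices"
    by (rule power_series_has_derivative) blast+
  show "\<exists>r>0. \<exists>c. \<forall>y\<in>ball x r.
     ((\<lambda>\<alpha>. monomial \<alpha> (y - x) *\<^sub>R c \<alpha>) has_sum frechet_derivative f (at y) b) multi_indices"
    by (rule exI[of _ \<rho>], rule conjI[OF \<rho>(1)], rule exI, rule ballI,
        rule has_sum_monomial_deriv_shift[OF b \<rho>(2)[OF _ b]])
qed

text \<open>The expansions hold on full balls around the points of \<open>S\<close>; their union is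
  an open set even where \<open>S\<close> itself is not open.\<close>

lemma real_analytic_on_differentiable:
  fixes f :: "'a::euclidean_space \<Rightarrow> complex"
  assumes f: "real_analytic_on f S"
  shows "\<exists>\<Omega>. open \<Omega> \<and> S \<subseteq> \<Omega> \<and> (\<forall>y\<in>\<Omega>. f differentiable (at y))"
proof -
  have "\<exists>\<rho>>0. \<forall>y\<in>ball x \<rho>. f differentiable (at y)" if x: "x \<in> S" for x
  proof -
    obtain r c where rc: "r > 0"
      "\<And>y. y \<in> ball x r \<Longrightarrow> ((\<lambda>\<alpha>. monomial \<alpha> (y - x) *\<^sub>R c \<alpha>) has_sum f y) multi_indices"
      using f x unfolding real_analytic_on_iff_monomial by meson
    then show ?thesis
      by (rule power_series_has_derivative) blast+
  qed
  then obtain \<rho> where \<rho>: "\<And>x. x \<in> S \<Longrightarrow> \<rho> x > 0 \<and> (\<forall>y\<in>ball x (\<rho> x). f differentiable (at y))"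
    by metis
  then show ?thesis by (intro exI[of _ "\<Union>x\<in>S. ball x (\<rho> x)"]) force
qed

section \<open>Lattices and fundamental domains\<close>

lemma subgroup_int_combination_mem:
  fixes L :: "'a::real_vector set" and k :: "'a \<Rightarrow> int"
  assumes "0 \<in> L" and L: "\<And>x y. x \<in> L \<Longrightarrow> y \<in> L \<Longrightarrow> x - y \<in> L"
    and "finite E" "E \<subseteq> L"
  shows "(\<Sum>e\<in>E. of_int (k e) *\<^sub>R e) \<in> L"
proof -
  have neg: "- x \<in> L" if "x \<in> L" for x using L[OF \<open>0 \<in> L\<close> that] by simp
  have add: "x + y \<in> L" if "x \<in> L" "y \<in> L" for x y using L[OF that(1) neg[OF that(2)]] by simp
  have nat: "real n *\<^sub>R x \<in> L" if "x \<in> L" for n x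
    by (induction n) (use add that \<open>0 \<in> L\<close> in \<open>auto simp: algebra_simps\<close>)
  have int: "of_int m *\<^sub>R x \<in> L" if "x \<in> L" for m x
    using nat[OF that, of "nat m"] neg[OF nat[OF that, of "nat (- m)"]] by (cases "m \<ge> 0") auto
  show ?thesis using assms(3,4) by (induction E) (auto simp: \<open>0 \<in> L\<close> intro!: add int)
qed

text \<open>In a subgroup the gap around 0 is carried by translation to every point, so discreteness
  is uniform.\<close>

lemma discrete_subgroup_finite_Int_bounded:
  fixes L :: "'a::euclidean_space set"
  assumes "0 \<in> L" and L: "\<And>x y. x \<in> L \<Longrightarrow> y \<in> L \<Longrightarrow> x - y \<in> L" and "discrete L"
    and "bounded B"
  shows "finite (L \<inter> B)"
proof -
  obtain e where e: "e > 0" "\<And>y. y \<in> L \<Longrightarrow> dist 0 y < e \<Longrightarrow> y = 0"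
    using assms(1,3) unfolding discrete_def isolated_in_dist_Ex_iff by blast
  have "uniform_discrete (L \<inter> B)"
    unfolding uniform_discrete_def
  proof (intro exI[of _ e] conjI ballI impI e(1))
    fix x y assume "x \<in> L \<inter> B" "y \<in> L \<inter> B" "dist x y < e"
    then show "x = y" using e(2)[of "x - y"] L[of x y] by (simp add: dist_norm norm_minus_commute)
  qed
  then show ?thesis using assms(4) uniform_discrete_finite_iff bounded_Int by blast
qed

text \<open>
  The new basis vector is a lattice point whose coefficient along \<open>e\<close> is minimal positive; this
  minimum exists because every coefficient is attained in a bounded set.
\<close>

lemma discrete_subgroup_basis_extend:
  fixes L :: "'a::euclidean_space set"
  assumes L0: "0 \<in> L" and L: "\<And>x y. x \<in> L \<Longrightarrow> y \<in> L \<Longrightarrow> x - y \<in> L" and dis: "discrete L"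
    and fin: "finite E" and ind: "independent E" and EL: "E \<subseteq> L"
    and Z: "\<And>x. x \<in> L \<Longrightarrow> x \<in> span E \<Longrightarrow> \<exists>k::'a \<Rightarrow> int. x = (\<Sum>v\<in>E. of_int (k v) *\<^sub>R v)"
    and e: "e \<in> L" "e \<notin> span E"
  shows "\<exists>u\<in>L. u \<notin> span E \<and> span (insert u E) = span (insert e E) \<and>
    (\<forall>x\<in>L \<inter> span (insert e E). \<exists>k::'a \<Rightarrow> int. x = (\<Sum>v\<in>insert u E. of_int (k v) *\<^sub>R v))"
proof -
  have eE: "e \<notin> E" using e(2) span_base by blast
  have "independent (insert e E)" using ind e(2) eE by (simp add: independent_insert)
  \<comment> \<open>The functional reads off the coefficient along \<open>e\<close> modulo
    \<open>span E\<close>.\<close>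
  then obtain \<phi> :: "'a \<Rightarrow> real" where lin: "linear \<phi>" and \<phi>E': "\<forall>x\<in>insert e E. \<phi> x = (if x = e then 1 else 0)"
    using linear_independent_extend[of "insert e E" "\<lambda>x. if x = e then 1 else 0"] by blast
  have \<phi>e: "\<phi> e = 1" and \<phi>E: "\<And>x. x \<in> E \<Longrightarrow> \<phi> x = 0" using \<phi>E' eE by auto
  have \<phi>span: "\<phi> x = 0" if "x \<in> span E" for x
    using linear_eq_0_on_span[OF lin \<phi>E that] .
  have dec: "x - \<phi> x *\<^sub>R e \<in> span E" if x: "x \<in> span (insert e E)" for x
  proof -
    obtain k where k: "x - k *\<^sub>R e \<in> span E" using x unfolding span_breakdown_eq by blast
    then have "\<phi> (x - k *\<^sub>R e) = 0" by (rule \<phi>span)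
    then have "\<phi> x = k" by (simp add: linear_diff[OF lin] linear_scale[OF lin] \<phi>e)
    then show ?thesis using k by simp
  qed
  \<comment> \<open>Subtracting lattice vectors from \<open>span E\<close> brings the coefficients
    along \<open>E\<close> into [0, 1) without changing \<phi>. A point with
    \<open>0 < \<phi> x \<le> 1\<close> then has norm at most \<open>R\<close>.\<close>
  define R where "R = norm e + (\<Sum>v\<in>E. norm v)"
  have Rpos: "norm e \<le> R" by (simp add: R_def sum_nonneg)
  have red: "\<exists>x'\<in>L \<inter> span (insert e E). \<phi> x' = \<phi> x \<and> norm x' \<le> R"
    if x: "x \<in> L" "x \<in> span (insert e E)" "0 < \<phi> x" "\<phi> x \<le> 1" for x
  proof -
    obtain t where t: "x - \<phi> x *\<^sub>R e = (\<Sum>v\<in>E. t v *\<^sub>R v)"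
      using dec[OF x(2)] span_finite[OF fin] by auto
    define x' where "x' = x - (\<Sum>v\<in>E. of_int \<lfloor>t v\<rfloor> *\<^sub>R v)"
    have sE: "(\<Sum>v\<in>E. of_int \<lfloor>t v\<rfloor> *\<^sub>R v) \<in> span E"
      by (intro span_sum span_scale span_base)
    have "x' \<in> L" unfolding x'_def by (intro L x(1) subgroup_int_combination_mem L0 fin EL)
    moreover have "x' \<in> span (insert e E)"
      unfolding x'_def using sE span_mono[of E "insert e E"] by (intro span_diff x(2)) auto
    moreover have "\<phi> x' = \<phi> x" unfolding x'_def linear_diff[OF lin] \<phi>span[OF sE] by simp
    moreover have "norm x' \<le> R"
    proof -
      have "x' = \<phi> x *\<^sub>R e + (\<Sum>v\<in>E. frac (t v) *\<^sub>R v)"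
        unfolding x'_def frac_def scaleR_diff_left sum_subtractf t[symmetric] by simp
      also have "norm \<dots> \<le> norm (\<phi> x *\<^sub>R e) + (\<Sum>v\<in>E. norm (frac (t v) *\<^sub>R v))"
        by (intro order_trans[OF norm_triangle_ineq] add_mono order_refl norm_sum)
      also have "\<dots> \<le> norm e + (\<Sum>v\<in>E. norm v)"
        using x(3,4) by (intro add_mono sum_mono)
          (auto simp: mult_left_le_one_le frac_ge_0 less_imp_le[OF frac_lt_1])
      finally show ?thesis by (simp add: R_def)
    qed
    ultimately show ?thesis by blast
  qed
  define Q where "Q = {x \<in> L \<inter> span (insert e E). 0 < \<phi> x \<and> \<phi> x \<le> 1 \<and> norm x \<le> R}"
  have "finite (L \<inter> cball 0 R)"
    by (rule discrete_subgroup_finite_Int_bounded[OF L0 L dis]) auto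
  then have "finite Q" by (rule rev_finite_subset) (auto simp: Q_def)
  moreover have "e \<in> Q" using e \<phi>e Rpos by (auto simp: Q_def span_base)
  ultimately have "Min (\<phi> ` Q) \<in> \<phi> ` Q" "\<And>x. x \<in> Q \<Longrightarrow> Min (\<phi> ` Q) \<le> \<phi> x"
    by (auto intro!: Min_in Min_le)
  then obtain u where u: "u \<in> Q" "\<And>x. x \<in> Q \<Longrightarrow> \<phi> u \<le> \<phi> x" by auto
  have \<phi>u: "0 < \<phi> u" "\<phi> u \<le> 1" "u \<in> L" "u \<in> span (insert e E)" using u(1) by (auto simp: Q_def)
  have uE: "u \<notin> span E" using \<phi>u \<phi>span by force
  then have uE': "u \<notin> E" using span_base by blast
  show ?thesis
  proof (intro bexI[of _ u] conjI ballI)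
    have "e = (1 / \<phi> u) *\<^sub>R (u - (u - \<phi> u *\<^sub>R e))" using \<phi>u by simp
    moreover have "(1 / \<phi> u) *\<^sub>R (u - (u - \<phi> u *\<^sub>R e)) \<in> span (insert u E)"
    proof (rule span_scale, rule span_diff)
      show "u - \<phi> u *\<^sub>R e \<in> span (insert u E)"
        using dec[OF \<phi>u(4)] span_mono[of E "insert u E"] by blast
    qed (auto intro: span_base)
    ultimately have "e \<in> span (insert u E)" by simp
    then show "span (insert u E) = span (insert e E)"
      unfolding span_eq using \<phi>u(4) by (auto intro: span_base)
    fix x assume "x \<in> L \<inter> span (insert e E)"
    then have x: "x \<in> L" "x \<in> span (insert e E)" by auto
    \<comment> \<open>Division with remainder by \<open>\<phi> u\<close>: the remainder is a
      coefficient of a lattice point below the minimal positive one, hence zero.\<close>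
    define n where "n = \<lfloor>\<phi> x / \<phi> u\<rfloor>"
    define y where "y = x - of_int n *\<^sub>R u"
    have nu: "of_int n *\<^sub>R u \<in> L"
      using subgroup_int_combination_mem[OF L0 L, of "{u}" "\<lambda>_. n"] \<phi>u by simp
    have y: "y \<in> L" "y \<in> span (insert e E)"
      using L[OF x(1) nu] x \<phi>u by (auto simp: y_def intro: span_diff span_scale)
    have \<phi>y: "\<phi> y = \<phi> x - of_int n * \<phi> u" by (simp add: y_def linear_diff[OF lin] linear_scale[OF lin])
    have "of_int n \<le> \<phi> x / \<phi> u" "\<phi> x / \<phi> u < of_int n + 1" unfolding n_def by linarith+
    then have bnds: "0 \<le> \<phi> y" "\<phi> y < \<phi> u" using \<phi>u(1) by (auto simp: \<phi>y field_simps)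
    have "\<phi> y = 0"
    proof (rule ccontr)
      assume "\<phi> y \<noteq> 0"
      then have "0 < \<phi> y" "\<phi> y \<le> 1" using bnds \<phi>u by auto
      from red[OF y this] obtain x' where "x' \<in> Q" "\<phi> x' = \<phi> y"
        using \<open>0 < \<phi> y\<close> \<open>\<phi> y \<le> 1\<close> by (auto simp: Q_def)
      then show False using u(2)[of x'] bnds by simp
    qed
    then have "y \<in> span E" using dec[OF y(2)] by simp
    then obtain k :: "'a \<Rightarrow> int" where k: "y = (\<Sum>v\<in>E. of_int (k v) *\<^sub>R v)" using Z y by blast
    have "x = of_int n *\<^sub>R u + (\<Sum>v\<in>E. of_int (k v) *\<^sub>R v)" using k by (simp add: y_def algebra_simps)
    also have "(\<Sum>v\<in>E. of_int (k v) *\<^sub>R v) = (\<Sum>v\<in>E. of_int ((k(u := n)) v) *\<^sub>R v)"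
      using uE' by (intro sum.cong) auto
    finally have "x = (\<Sum>v\<in>insert u E. of_int ((k(u := n)) v) *\<^sub>R v)" using fin uE' by simp
    then show "\<exists>k::'a \<Rightarrow> int. x = (\<Sum>v\<in>insert u E. of_int (k v) *\<^sub>R v)" by blast
  qed (use \<phi>u uE in auto)
qed

text \<open>The vectors of \<open>E\<close> need not generate the subgroup over the integers, so
  each is replaced in turn. Keeping the span is what lets the induction speak about the same lattice
  points.\<close>

lemma discrete_subgroup_basis:
  fixes L :: "'a::euclidean_space set"
  assumes L0: "0 \<in> L" and L: "\<And>x y. x \<in> L \<Longrightarrow> y \<in> L \<Longrightarrow> x - y \<in> L" and dis: "discrete L"
    and "finite E" "independent E" "E \<subseteq> L"
  shows "\<exists>E'. finite E' \<and> independent E' \<and> E' \<subseteq> L \<and> card E' = card E \<and> span E' = span E \<and>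
    (\<forall>x\<in>L \<inter> span E. \<exists>k::'a \<Rightarrow> int. x = (\<Sum>v\<in>E'. of_int (k v) *\<^sub>R v))"
  using assms(4-6)
proof (induction E)
  case empty
  then show ?case by (intro exI[of _ "{}"]) auto
next
  case (insert e E)
  have e: "e \<notin> span E" "independent E" "e \<in> L" "E \<subseteq> L"
    using insert.hyps insert.prems by (auto simp: independent_insert)
  obtain E' where E': "finite E'" "independent E'" "E' \<subseteq> L" "card E' = card E" "span E' = span E"
    "\<And>x. x \<in> L \<Longrightarrow> x \<in> span E \<Longrightarrow> \<exists>k::'a \<Rightarrow> int. x = (\<Sum>v\<in>E'. of_int (k v) *\<^sub>R v)"
    using insert.IH[OF e(2,4)] by blast
  have eE': "e \<notin> span E'" using e E' by simp
  obtain u where u: "u \<in> L" "u \<notin> span E'" "span (insert u E') = span (insert e E')"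
    "\<And>x. x \<in> L \<Longrightarrow> x \<in> span (insert e E') \<Longrightarrow>
       \<exists>k::'a \<Rightarrow> int. x = (\<Sum>v\<in>insert u E'. of_int (k v) *\<^sub>R v)"
    using discrete_subgroup_basis_extend[OF L0 L dis E'(1-3) E'(6)[folded E'(5)] e(3) eE'] by blast
  have sp: "span (insert e E') = span (insert e E)" using E'(5) by (simp add: span_insert)
  have "u \<notin> E'" using u(2) span_base by blast
  show ?case
  proof (intro exI[of _ "insert u E'"] conjI ballI)
    show "independent (insert u E')" using \<open>u \<notin> E'\<close> u(2) E'(2) by (simp add: independent_insert)
    show "card (insert u E') = card (insert e E)" using E'(1,4) \<open>u \<notin> E'\<close> insert.hyps by simp
    show "\<exists>k::'a \<Rightarrow> int. x = (\<Sum>v\<in>insert u E'. of_int (k v) *\<^sub>R v)" if "x \<in> L \<inter> span (insert e E)" for x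
      using that by (intro u(4)) (simp_all add: sp)
  qed (use u(1,3) E'(1,3) sp in simp_all)
qed

text \<open>This makes the choice of a basis in \<open>fundamental_domain\<close>
  meaningful.\<close>

lemma is_lattice_basis_exists:
  fixes L :: "(real ^ 'n) set"
  assumes "is_lattice L"
  shows "\<exists>b. lattice_basis L b"
proof -
  have L: "0 \<in> L" "\<And>x y. x \<in> L \<Longrightarrow> y \<in> L \<Longrightarrow> x - y \<in> L" "discrete L" "dim L = CARD('n)"
    using assms by (auto simp: is_lattice_def)
  obtain E where E: "E \<subseteq> L" "independent E" "L \<subseteq> span E" "card E = dim L"
    using basis_exists by blast
  have "finite E" using E(2) independent_bound by blast
  from discrete_subgroup_basis[OF L(1-3) this E(2,1)]
  obtain E' where E': "finite E'" "independent E'" "E' \<subseteq> L" "card E' = CARD('n)"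
    "\<And>x. x \<in> L \<Longrightarrow> \<exists>k::_ \<Rightarrow> int. x = (\<Sum>v\<in>E'. of_int (k v) *\<^sub>R v)"
    using E L(4) by (auto simp: subset_iff)
  obtain b :: "'n \<Rightarrow> real ^ 'n" where b: "bij_betw b UNIV E'"
    using finite_same_card_bij[of "UNIV :: 'n set" E'] E' by auto
  have "L = range (\<lambda>k::'n \<Rightarrow> int. \<Sum>j\<in>UNIV. of_int (k j) *\<^sub>R b j)"
  proof (intro equalityI subsetI)
    fix x assume "x \<in> L"
    then obtain k :: "_ \<Rightarrow> int" where "x = (\<Sum>v\<in>E'. of_int (k v) *\<^sub>R v)" using E'(5) by blast
    also have "\<dots> = (\<Sum>j\<in>UNIV. of_int (k (b j)) *\<^sub>R b j)"
      using b by (rule sum.reindex_bij_betw[symmetric])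
    finally show "x \<in> range (\<lambda>k::'n \<Rightarrow> int. \<Sum>j\<in>UNIV. of_int (k j) *\<^sub>R b j)"
      by (rule range_eqI[where x = "\<lambda>j. k (b j)"])
  next
    fix x assume "x \<in> range (\<lambda>k::'n \<Rightarrow> int. \<Sum>j\<in>UNIV. of_int (k j) *\<^sub>R b j)"
    then obtain k :: "'n \<Rightarrow> int" where "x = (\<Sum>j\<in>UNIV. of_int (k j) *\<^sub>R b j)" by blast
    also have "\<dots> = (\<Sum>j\<in>UNIV. of_int (k (inv b (b j))) *\<^sub>R b j)"
      using b by (simp add: bij_betw_def inv_f_f)
    also have "\<dots> = (\<Sum>v\<in>E'. of_int (k (inv b v)) *\<^sub>R v)"
      using b by (rule sum.reindex_bij_betw)
    also have "\<dots> \<in> L"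
      using subgroup_int_combination_mem[OF L(1,2) E'(1,3), of "\<lambda>v. k (inv b v)"] by simp
    finally show "x \<in> L" .
  qed
  then have "lattice_basis L b"
    using b E'(2) by (auto simp: lattice_basis_def bij_betw_def)
  then show ?thesis by (rule exI[of _ b])
qed

text \<open>The map \<open>g\<close> sends the chosen basis to the standard one, so the
  parallelepiped becomes the preimage of the half-open unit cube. Measurability and translation are
  then questions about inequalities between coordinates.\<close>

lemma fundamental_domain_coordinates:
  fixes L :: "(real ^ 'n) set"
  assumes "is_lattice L"
  obtains b :: "'n \<Rightarrow> real ^ 'n" and g :: "real ^ 'n \<Rightarrow> real ^ 'n"
  where "linear g" "\<And>j. g (b j) = axis j 1" "\<And>j. b j \<in> L" "span (range b) = UNIV"
    "\<And>x. x = (\<Sum>j\<in>UNIV. (g x $ j) *\<^sub>R b j)"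
    "fundamental_domain L = {x. \<forall>j. 0 \<le> g x $ j \<and> g x $ j < 1}"
proof -
  define b where "b = (SOME b. lattice_basis L b)"
  have lb: "lattice_basis L b" unfolding b_def using is_lattice_basis_exists[OF assms] by (rule someI_ex)
  have inj: "inj b" and ind: "independent (range b)"
    and LR: "L = range (\<lambda>k::'n \<Rightarrow> int. \<Sum>j\<in>UNIV. of_int (k j) *\<^sub>R b j)"
    using lb by (auto simp: lattice_basis_def)
  obtain g :: "real ^ 'n \<Rightarrow> real ^ 'n" where lin: "linear g" and g': "\<forall>x\<in>range b. g x = axis (inv b x) 1"
    using linear_independent_extend[OF ind, of "\<lambda>x. axis (inv b x) 1"] by blast
  have g: "g (b j) = axis j 1" for j using g' inj by simp
  have gsum: "g (\<Sum>j\<in>UNIV. t j *\<^sub>R b j) $ i = t i" for t i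
    unfolding linear_sum[OF lin] linear_scale[OF lin] g
    by (simp add: axis_def if_distrib cong: if_cong)
  have sp: "span (range b) = UNIV"
  proof -
    have "dim (range b) = DIM(real ^ 'n)" using inj ind by (simp add: dim_eq_card_independent card_image)
    then show ?thesis by (simp only: dim_eq_full)
  qed
  have rep: "x = (\<Sum>j\<in>UNIV. (g x $ j) *\<^sub>R b j)" for x
  proof -
    have "x \<in> span (range b)" using sp by simp
    then obtain u where "x = (\<Sum>v\<in>range b. u v *\<^sub>R v)" by (auto simp: span_finite)
    then have "x = (\<Sum>j\<in>UNIV. u (b j) *\<^sub>R b j)" using sum.reindex[OF inj, of "\<lambda>v. u v *\<^sub>R v"] by simp
    then show ?thesis using gsum[of "\<lambda>j. u (b j)"] by simp
  qed
  have D: "fundamental_domain L = {x. \<forall>j. 0 \<le> g x $ j \<and> g x $ j < 1}"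
  proof (intro equalityI subsetI)
    fix x assume "x \<in> fundamental_domain L"
    then show "x \<in> {x. \<forall>j. 0 \<le> g x $ j \<and> g x $ j < 1}"
      unfolding fundamental_domain_def Let_def b_def[symmetric] using gsum by auto
  next
    fix x assume "x \<in> {x. \<forall>j. 0 \<le> g x $ j \<and> g x $ j < 1}"
    then show "x \<in> fundamental_domain L"
      unfolding fundamental_domain_def Let_def b_def[symmetric] using rep[of x] by blast
  qed
  have bL: "b j \<in> L" for j
  proof -
    have "b j = (\<Sum>i\<in>UNIV. of_int (if i = j then 1 else 0) *\<^sub>R b i)"
      by (simp add: if_distrib if_distribR cong: if_cong)
    then show ?thesis unfolding LR by (rule range_eqI[where x = "\<lambda>i. if i = j then 1 else 0"])
  qed
  show ?thesis by (rule that[OF lin g bL sp rep D])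
qed

lemma lborel_integral_translate:
  fixes f :: "'a::euclidean_space \<Rightarrow> 'b::{banach, second_countable_topology}"
  assumes [measurable]: "f \<in> borel_measurable borel"
  shows "(\<integral>x. f (c + x) \<partial>lborel) = (\<integral>x. f x \<partial>lborel)"
proof -
  have "(\<integral>x. f x \<partial>lborel) = (\<integral>x. f x \<partial>distr lborel borel ((+) c))" by (simp add: lborel_distr_plus)
  also have "\<dots> = (\<integral>x. f (c + x) \<partial>lborel)" by (rule integral_distr) auto
  finally show ?thesis ..
qed

lemma set_integrable_continuous_bounded:
  fixes f :: "'a::euclidean_space \<Rightarrow> 'b::{banach, second_countable_topology}"
  assumes "continuous_on (closure A) f" "bounded A" "A \<in> sets borel"
  shows "set_integrable lborel A f"
proof (rule set_integrable_subset)
  show "set_integrable lborel (closure A) f"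
    unfolding set_integrable_def using assms by (intro borel_integrable_compact) auto
qed (use assms closure_subset in auto)

lemma fundamental_domain_properties:
  fixes L :: "(real ^ 'n) set"
  assumes "is_lattice L"
  shows "fundamental_domain L \<in> sets borel" "bounded (fundamental_domain L)"
    "measure lborel (fundamental_domain L) > 0"
proof -
  obtain b :: "'n \<Rightarrow> real ^ 'n" and g :: "real ^ 'n \<Rightarrow> real ^ 'n"
    where lin: "linear g" and rep: "\<And>x. x = (\<Sum>j\<in>UNIV. (g x $ j) *\<^sub>R b j)"
    and gb: "\<And>j. g (b j) = axis j 1"
    and D: "fundamental_domain L = {x. \<forall>j. 0 \<le> g x $ j \<and> g x $ j < 1}"
    by (rule fundamental_domain_coordinates[OF assms]) blast
  have cont: "continuous_on UNIV (\<lambda>x. g x $ j)" for j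
    by (intro continuous_intros linear_continuous_on_compose[OF _ lin])
  note [measurable] = borel_measurable_continuous_onI[OF cont]
  show S: "fundamental_domain L \<in> sets borel" unfolding D by measurable
  show B: "bounded (fundamental_domain L)"
    unfolding bounded_iff
  proof (intro exI[of _ "\<Sum>j\<in>UNIV. norm (b j)"] ballI)
    fix x assume "x \<in> fundamental_domain L"
    then have x: "\<bar>g x $ j\<bar> \<le> 1" for j by (auto simp: D less_imp_le)
    have "norm x = norm (\<Sum>j\<in>UNIV. (g x $ j) *\<^sub>R b j)" using rep[of x] by simp
    also have "\<dots> \<le> (\<Sum>j\<in>UNIV. norm (b j))"
      by (rule sum_norm_le) (use x in \<open>auto intro: mult_left_le_one_le\<close>)
    finally show "norm x \<le> (\<Sum>j\<in>UNIV. norm (b j))" .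
  qed
  \<comment> \<open>The open parallelepiped contains its centre, and a nonempty open set is not
    negligible.\<close>
  define V where "V = {x. \<forall>j. 0 < g x $ j \<and> g x $ j < 1}"
  have "V = (\<Inter>j. {x. 0 < g x $ j} \<inter> {x. g x $ j < 1})" by (auto simp: V_def)
  then have "open V"
    by (simp, intro open_INT finite ballI open_Int open_Collect_less cont continuous_on_const)
  have "(\<Sum>j\<in>UNIV. (1 / 2) *\<^sub>R b j) \<in> V"
    unfolding V_def mem_Collect_eq linear_sum[OF lin] linear_scale[OF lin] gb
    by (simp add: axis_def if_distrib cong: if_cong)
  then have "\<not> negligible V" using open_not_negligible \<open>open V\<close> by blast
  then have nz: "emeasure lborel V \<noteq> 0"
    using \<open>open V\<close> by (metis borel_open emeasure_eq_0_AE null_setsI negligible_iff_null_sets null_sets_completionI sets_lborel)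
  have fin: "emeasure lborel (fundamental_domain L) < \<infinity>" using emeasure_bounded_finite[OF B] .
  have "emeasure lborel V \<le> emeasure lborel (fundamental_domain L)"
    using S by (intro emeasure_mono) (auto simp: V_def D less_imp_le)
  then have "emeasure lborel (fundamental_domain L) > 0" using nz by (metis not_gr_zero le_zero_eq)
  then show "measure lborel (fundamental_domain L) > 0"
    using fin by (simp add: measure_def enn2real_positive_iff)
qed

text \<open>
  Translating the parallelepiped by \<open>\<tau> b\<^sub>j\<close> moves a slab out of it; the period \<open>b\<^sub>j\<close> moves it back.
\<close>

lemma fundamental_domain_shift:
  fixes L :: "(real ^ 'n) set" and G :: "real ^ 'n \<Rightarrow> complex" and g :: "real ^ 'n \<Rightarrow> real ^ 'n"
  assumes lat: "is_lattice L" and lin: "linear g" and gb: "\<And>j. g (b j) = axis j 1" and bL: "b j \<in> L"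
    and D: "fundamental_domain L = {x. \<forall>j. 0 \<le> g x $ j \<and> g x $ j < 1}"
    and G: "continuous_on UNIV G" and per: "\<And>x l. l \<in> L \<Longrightarrow> G (x + l) = G x"
    and \<tau>: "0 \<le> \<tau>" "\<tau> \<le> 1"
  shows "(LINT x:fundamental_domain L|lborel. G (x + \<tau> *\<^sub>R b j)) = (LINT x:fundamental_domain L|lborel. G x)"
proof -
  let ?D = "fundamental_domain L"
  have cont: "continuous_on UNIV (\<lambda>x. g x $ j)" for j
    by (intro continuous_intros linear_continuous_on_compose[OF _ lin])
  note [measurable] = borel_measurable_continuous_onI[OF cont] borel_measurable_continuous_onI[OF G]
    fundamental_domain_properties(1)[OF lat]
  \<comment> \<open>\<open>A\<close> is the part of the translate that stays inside the domain,
    \<open>A3\<close> the slab that the translate vacates. The part that sticks out on the other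
    side is \<open>A3\<close> moved by the period \<open>b j\<close>.\<close>
  define A where "A = ?D \<inter> {x. \<tau> \<le> g x $ j}"
  define A3 where "A3 = ?D \<inter> {x. g x $ j < \<tau>}"
  have [measurable]: "A \<in> sets borel" "A3 \<in> sets borel" unfolding A_def A3_def by measurable
  have gm: "g (x - c *\<^sub>R b j) $ i = (if i = j then g x $ i - c else g x $ i)" for x c i
    by (simp add: linear_diff[OF lin] linear_scale[OF lin] gb axis_def)
  have split: "indicator ?D (x - \<tau> *\<^sub>R b j) = (indicator A x + indicator A3 (x - b j) :: real)" for x
  proof -
    have 1: "x - \<tau> *\<^sub>R b j \<in> ?D \<longleftrightarrow> \<tau> \<le> g x $ j \<and> g x $ j < 1 + \<tau> \<and> (\<forall>i. i \<noteq> j \<longrightarrow> 0 \<le> g x $ i \<and> g x $ i < 1)"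
      unfolding D mem_Collect_eq gm by (auto simp: algebra_simps)
    have 2: "x \<in> A \<longleftrightarrow> \<tau> \<le> g x $ j \<and> g x $ j < 1 \<and> (\<forall>i. i \<noteq> j \<longrightarrow> 0 \<le> g x $ i \<and> g x $ i < 1)"
      unfolding A_def D using \<tau> by (auto intro: order_trans)
    have 3: "x - b j \<in> A3 \<longleftrightarrow> 1 \<le> g x $ j \<and> g x $ j < 1 + \<tau> \<and> (\<forall>i. i \<noteq> j \<longrightarrow> 0 \<le> g x $ i \<and> g x $ i < 1)"
      using gm[of x 1] \<tau> unfolding A3_def D by (auto simp: algebra_simps split: if_splits)
    show ?thesis
      unfolding indicator_def 1 2 3 using \<tau> by (cases "g x $ j < 1") auto
  qed
  have fin: "set_integrable lborel B G" if "B \<subseteq> ?D" "B \<in> sets borel" for B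
    using that fundamental_domain_properties(2)[OF lat]
    by (intro set_integrable_continuous_bounded continuous_on_subset[OF G]) (auto intro: bounded_subset)
  have iA: "integrable lborel (\<lambda>x. indicator A x *\<^sub>R G x)"
    using fin[of A] unfolding set_integrable_def by (simp add: A_def)
  have iA3: "integrable lborel (\<lambda>x. indicator A3 x *\<^sub>R G x)"
    using fin[of A3] unfolding set_integrable_def by (simp add: A3_def)
  have iA3': "integrable lborel (\<lambda>x. indicator A3 (x - b j) *\<^sub>R G (x - b j))"
  proof -
    have "integrable (distr lborel borel ((+) (- b j))) (\<lambda>x. indicator A3 x *\<^sub>R G x)"
      using iA3 by (simp add: lborel_distr_plus)
    then show ?thesis by (subst (asm) integrable_distr_eq) auto
  qed
  have "(LINT x:?D|lborel. G (x + \<tau> *\<^sub>R b j)) = (\<integral>x. indicator ?D x *\<^sub>R G (x + \<tau> *\<^sub>R b j) \<partial>lborel)"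
    by (simp add: set_lebesgue_integral_def)
  also have "\<dots> = (\<integral>x. indicator ?D (- (\<tau> *\<^sub>R b j) + x) *\<^sub>R G (- (\<tau> *\<^sub>R b j) + x + \<tau> *\<^sub>R b j) \<partial>lborel)"
    by (rule lborel_integral_translate[symmetric]) measurable
  also have "\<dots> = (\<integral>x. indicator A x *\<^sub>R G x + indicator A3 (x - b j) *\<^sub>R G (x - b j) \<partial>lborel)"
  proof (intro Bochner_Integration.integral_cong refl)
    fix x
    have "G (x - b j) = G x" using per[OF bL, of "x - b j"] by simp
    then show "indicator ?D (- (\<tau> *\<^sub>R b j) + x) *\<^sub>R G (- (\<tau> *\<^sub>R b j) + x + \<tau> *\<^sub>R b j)
      = indicator A x *\<^sub>R G x + indicator A3 (x - b j) *\<^sub>R G (x - b j)"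
      using split[of x] by (simp add: scaleR_add_left)
  qed
  also have "\<dots> = (\<integral>x. indicator A x *\<^sub>R G x \<partial>lborel) + (\<integral>x. indicator A3 (- b j + x) *\<^sub>R G (- b j + x) \<partial>lborel)"
    using iA iA3' by (subst Bochner_Integration.integral_add) auto
  also have "(\<integral>x. indicator A3 (- b j + x) *\<^sub>R G (- b j + x) \<partial>lborel) = (\<integral>x. indicator A3 x *\<^sub>R G x \<partial>lborel)"
    by (rule lborel_integral_translate) measurable
  also have "(\<integral>x. indicator A x *\<^sub>R G x \<partial>lborel) + (\<integral>x. indicator A3 x *\<^sub>R G x \<partial>lborel)
      = (\<integral>x. indicator A x *\<^sub>R G x + indicator A3 x *\<^sub>R G x \<partial>lborel)"
    using iA iA3 by simp
  also have "\<dots> = (LINT x:?D|lborel. G x)"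
    unfolding set_lebesgue_integral_def
    by (intro Bochner_Integration.integral_cong refl) (auto simp: A_def A3_def indicator_def)
  finally show ?thesis .
qed

text \<open>This is integration by parts on the torus. The integral of \<open>G' x h\<close> is the
  derivative at 0, in direction \<open>h\<close>, of the integral of the translates of
  \<open>G\<close>. It vanishes along every \<open>b j\<close> by translation invariance, and the
  \<open>b j\<close> span the space.\<close>

lemma integral_fundamental_domain_derivative_eq_0:
  fixes L :: "(real ^ 'n) set" and G :: "real ^ 'n \<Rightarrow> complex"
  assumes lat: "is_lattice L" and per: "\<And>x l. l \<in> L \<Longrightarrow> G (x + l) = G x"
    and der: "\<And>x. (G has_derivative G' x) (at x)"
    and cont: "\<And>i. i \<in> Basis \<Longrightarrow> continuous_on UNIV (\<lambda>x. G' x i)"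
  shows "(LINT x:fundamental_domain L|lborel. G' x v) = 0"
proof -
  let ?D = "fundamental_domain L"
  note D = fundamental_domain_properties[OF lat]
  have G: "continuous_on UNIV G"
    using der by (intro differentiable_imp_continuous_on) (auto simp: differentiable_on_def differentiable_def intro: has_derivative_at_withinI)
  have lin': "linear (G' x)" for x using der has_derivative_linear by blast
  have G'rep: "G' x h = (\<Sum>i\<in>Basis. (h \<bullet> i) *\<^sub>R G' x i)" for x h
    by (subst euclidean_representation[of h, symmetric]) (simp add: linear_sum[OF lin'] linear_scale[OF lin'])
  have contv: "continuous_on UNIV (\<lambda>x. G' x h)" for h
    unfolding G'rep[of _ h] by (intro continuous_intros cont)
  \<comment> \<open>A compact set containing all translates of the domain by vectors of the unit
    ball gives one bound for the derivatives.\<close>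
  define K where "K = {x + w | x w. x \<in> closure ?D \<and> w \<in> cball (0::real^'n) 1}"
  have "compact K" unfolding K_def using D(2) by (intro compact_sums) auto
  then have "bounded ((\<lambda>x. G' x i) ` K)" if "i \<in> Basis" for i
    by (intro compact_imp_bounded compact_continuous_image continuous_on_subset[OF cont[OF that]]) auto
  then have "\<forall>i\<in>Basis. \<exists>C. \<forall>x\<in>K. norm (G' x i) \<le> C" by (auto simp: bounded_iff)
  then obtain C where C: "\<And>i x. i \<in> Basis \<Longrightarrow> x \<in> K \<Longrightarrow> norm (G' x i) \<le> C i" by metis
  define C' where "C' = (\<Sum>i\<in>(Basis :: (real^'n) set). C i)"
  have bnd: "norm (G' x h) \<le> C' * norm h" if "x \<in> K" for x h
  proof -
    have "norm (G' x h) \<le> (\<Sum>i\<in>(Basis :: (real^'n) set). norm h * C i)"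
      unfolding G'rep[of x h]
      by (rule sum_norm_le) (use C[OF _ that] in \<open>auto intro!: mult_mono Basis_le_norm\<close>)
    then show ?thesis by (simp add: C'_def sum_distrib_left mult.commute)
  qed
  have H: "((\<lambda>w. \<integral>x. indicator ?D x *\<^sub>R G (x + w) \<partial>lborel) has_derivative
      (\<lambda>h. \<integral>x. indicator ?D x *\<^sub>R G' (x + 0) h \<partial>lborel)) (at 0)"
  proof (rule has_derivative_integral_dominated[where r = 1 and g = "\<lambda>x. indicator ?D x * C'"])
    show "((\<lambda>w. indicator ?D x *\<^sub>R G (x + w)) has_derivative (\<lambda>h. indicator ?D x *\<^sub>R G' (x + w) h)) (at w)" for x w
    proof -
      have "((\<lambda>w. G (x + w)) has_derivative G' (x + w)) (at w)"
        by (rule has_derivative_compose[OF _ der, of "\<lambda>w. x + w" "\<lambda>h. h" w UNIV])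
          (auto intro!: derivative_eq_intros)
      then show ?thesis by (rule has_derivative_scaleR_right)
    qed
    show "norm (indicator ?D x *\<^sub>R G' (x + w) h) \<le> indicator ?D x * C' * norm h" if "w \<in> ball 0 1" for x w h
    proof (cases "x \<in> ?D")
      case True
      then have "x + w \<in> K" using that closure_subset[of ?D] unfolding K_def by fastforce
      then show ?thesis using bnd True by simp
    qed simp
    show "integrable lborel (\<lambda>x. indicator ?D x * C')"
      using D(1) emeasure_bounded_finite[OF D(2)] by (intro integrable_mult_left integrable_real_indicator) auto
    show "integrable lborel (\<lambda>x. indicator ?D x *\<^sub>R G (x + w))" for w
      unfolding set_integrable_def[symmetric]
      by (intro set_integrable_continuous_bounded continuous_on_compose2[OF G] continuous_intros D) auto
    show "(\<lambda>x. indicator ?D x *\<^sub>R G' (x + 0) h) \<in> borel_measurable lborel" for h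
      using D(1) borel_measurable_continuous_onI[OF contv[of h]] by simp
  qed simp
  obtain b :: "'n \<Rightarrow> real ^ 'n" and g :: "real ^ 'n \<Rightarrow> real ^ 'n"
    where g: "linear g" "\<And>j. g (b j) = axis j 1" and bL: "\<And>j. b j \<in> L" and sp: "span (range b) = UNIV"
    and Dg: "?D = {x. \<forall>j. 0 \<le> g x $ j \<and> g x $ j < 1}"
    by (rule fundamental_domain_coordinates[OF lat]) blast
  define I where "I h = (\<integral>x. indicator ?D x *\<^sub>R G' x h \<partial>lborel)" for h
  have HI: "((\<lambda>w. \<integral>x. indicator ?D x *\<^sub>R G (x + w) \<partial>lborel) has_derivative I) (at 0)"
    using H unfolding add_0_right I_def[symmetric] .
  have linI: "linear I" using HI by (rule has_derivative_linear)
  have "I (b j) = 0" for j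
  proof -
    \<comment> \<open>Invariance is available for \<open>0 \<le> \<tau> \<le> 1\<close>, so the
      derivative is taken from one side; it is still unique there.\<close>
    have "((\<lambda>\<tau>::real. \<integral>x. indicator ?D x *\<^sub>R G (x + \<tau> *\<^sub>R b j) \<partial>lborel) has_derivative (\<lambda>\<tau>. I (\<tau> *\<^sub>R b j))) (at 0 within {0..1})"
      by (rule has_derivative_compose[of "\<lambda>\<tau>::real. \<tau> *\<^sub>R b j" "\<lambda>\<tau>. \<tau> *\<^sub>R b j" 0 "{0..1}"])
        (simp_all add: HI bounded_linear_imp_has_derivative bounded_linear_scaleR_left)
    then have "((\<lambda>\<tau>::real. \<integral>x. indicator ?D x *\<^sub>R G (x + \<tau> *\<^sub>R b j) \<partial>lborel) has_vector_derivative I (b j)) (at 0 within {0..1})"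
      by (simp add: has_vector_derivative_def linear_scale[OF linI])
    then have "((\<lambda>\<tau>::real. \<integral>x. indicator ?D x *\<^sub>R G x \<partial>lborel) has_vector_derivative I (b j)) (at 0 within {0..1})"
      by (rule has_vector_derivative_transform[rotated 2])
        (use fundamental_domain_shift[OF lat g bL Dg G per] in \<open>auto simp: set_lebesgue_integral_def\<close>)
    moreover have "((\<lambda>\<tau>::real. \<integral>x. indicator ?D x *\<^sub>R G x \<partial>lborel) has_vector_derivative 0) (at 0 within {0..1})"
      by simp
    ultimately show ?thesis
      by (rule vector_derivative_unique_within[rotated]) (simp add: trivial_limit_within islimpt_Icc)
  qed
  then have "I v = 0" using linear_eq_0_on_span[OF linI, of "range b" v] sp by auto
  then show ?thesis by (simp add: I_def set_lebesgue_integral_def)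
qed

section \<open>Linear ordinary differential equations\<close>

lemma has_vector_derivative_powr_of_real:
  fixes a :: complex
  assumes "t > 0"
  shows "((\<lambda>t. of_real t powr a) has_vector_derivative a * of_real t powr (a - 1)) (at t)"
proof -
  have "((\<lambda>z. z powr a) has_field_derivative a * of_real t powr (a - 1)) (at (of_real t))"
    using assms by (auto intro!: derivative_eq_intros)
  then show ?thesis by (rule has_vector_derivative_real_field)
qed

lemma has_real_derivative_inner:
  fixes f g :: "real \<Rightarrow> 'a::real_inner"
  assumes "(f has_vector_derivative f') (at t)" "(g has_vector_derivative g') (at t)"
  shows "((\<lambda>t. f t \<bullet> g t) has_real_derivative (f t \<bullet> g' + f' \<bullet> g t)) (at t)"
  unfolding has_field_derivative_def
  by (rule has_derivative_eq_rhs[OF has_derivative_inner[OF assms[unfolded has_vector_derivative_def]]])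
    (simp add: fun_eq_iff algebra_simps)

lemma has_vector_derivative_zero_pos_constant:
  fixes f :: "real \<Rightarrow> 'a::real_normed_vector"
  assumes "\<And>x. x > 0 \<Longrightarrow> (f has_vector_derivative 0) (at x)"
  obtains c where "\<And>x. x > 0 \<Longrightarrow> f x = c"
proof -
  obtain c where "\<And>x. x \<in> {0<..} \<Longrightarrow> f x = c"
    by (rule has_vector_derivative_zero_constant[of "{0<..}" f])
      (auto intro: has_vector_derivative_at_within assms)
  then show ?thesis using that by auto
qed

text \<open>Gronwall's inequality run backwards. The logarithmic derivative of
  \<open>\<bar>g\<bar>\<^sup>2 + \<bar>g1\<bar>\<^sup>2\<close> is bounded below by
  \<open>- (1 + K)\<close> wherever it makes sense, so the weight
  \<open>exp ((1 + K) * \<tau>)\<close> makes the energy \<open>E\<close> nondecreasing. This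
  reaches small \<open>t\<close>, where the real part of \<open>q\<close> may be negative.\<close>

lemma linear_ode_zero_backward:
  fixes g g1 q :: "real \<Rightarrow> complex"
  assumes d1: "\<And>t. t > 0 \<Longrightarrow> (g has_vector_derivative g1 t) (at t)"
    and d2: "\<And>t. t > 0 \<Longrightarrow> (g1 has_vector_derivative q t * g t) (at t)"
    and q: "continuous_on {0<..} q"
    and t: "0 < t" "t \<le> t1" and z: "g t1 = 0" "g1 t1 = 0"
  shows "g t = 0"
proof -
  have "compact (q ` {t..t1})"
    using t by (intro compact_continuous_image continuous_on_subset[OF q]) auto
  then obtain K where "\<forall>z\<in>q ` {t..t1}. norm z \<le> K"
    using compact_imp_bounded bounded_iff by metis
  then have K: "\<And>\<tau>. \<tau> \<in> {t..t1} \<Longrightarrow> norm (q \<tau>) \<le> K" by blast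
  define E where "E \<tau> = (g \<tau> \<bullet> g \<tau> + g1 \<tau> \<bullet> g1 \<tau>) * exp ((1 + K) * \<tau>)" for \<tau>
  have "E t \<le> E t1"
  proof (rule DERIV_nonneg_imp_nondecreasing[OF t(2)])
    fix \<tau> assume \<tau>: "t \<le> \<tau>" "\<tau> \<le> t1"
    then have pos: "\<tau> > 0" using t by simp
    let ?a = "norm (g \<tau>)" and ?b = "norm (g1 \<tau>)"
    let ?d = "2 * (g \<tau> \<bullet> g1 \<tau>) + 2 * (g1 \<tau> \<bullet> (q \<tau> * g \<tau>)) + (1 + K) * (?a\<^sup>2 + ?b\<^sup>2)"
    have "(E has_real_derivative exp ((1 + K) * \<tau>) * ?d) (at \<tau>)"
      unfolding E_def
      by (rule derivative_eq_intros has_real_derivative_inner[OF d1[OF pos] d1[OF pos]]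
          has_real_derivative_inner[OF d2[OF pos] d2[OF pos]] refl)+
        (simp add: inner_commute algebra_simps power2_norm_eq_inner)
    moreover have "?d \<ge> 0"
    proof -
      have ab: "2 * (?a * ?b) \<le> ?a\<^sup>2 + ?b\<^sup>2" using sum_squares_bound[of ?a ?b] by (simp add: mult.assoc)
      have "\<bar>g \<tau> \<bullet> g1 \<tau>\<bar> \<le> ?a * ?b" by (rule Cauchy_Schwarz_ineq2)
      moreover have "\<bar>g1 \<tau> \<bullet> (q \<tau> * g \<tau>)\<bar> \<le> K * (?a * ?b)"
      proof -
        have "\<bar>g1 \<tau> \<bullet> (q \<tau> * g \<tau>)\<bar> \<le> ?b * norm (q \<tau> * g \<tau>)" by (rule Cauchy_Schwarz_ineq2)
        also have "\<dots> = norm (q \<tau>) * (?a * ?b)" by (simp add: norm_mult)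
        also have "\<dots> \<le> K * (?a * ?b)" using K[of \<tau>] \<tau> by (intro mult_right_mono) auto
        finally show ?thesis .
      qed
      moreover have "K * (2 * (?a * ?b)) \<le> K * (?a\<^sup>2 + ?b\<^sup>2)"
        using K[of \<tau>] \<tau> order_trans[OF norm_ge_zero, of "q \<tau>" K] by (intro mult_left_mono ab) auto
      ultimately show ?thesis using ab by (simp add: distrib_right)
    qed
    ultimately show "\<exists>y. (E has_real_derivative y) (at \<tau>) \<and> 0 \<le> y"
      by (intro exI[of _ "exp ((1 + K) * \<tau>) * ?d"]) simp
  qed
  then have "g t \<bullet> g t + g1 t \<bullet> g1 t \<le> 0" using z by (simp add: E_def mult_le_0_iff)
  then have "g t \<bullet> g t = 0" using inner_ge_zero[of "g t"] inner_ge_zero[of "g1 t"] by linarith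
  then show ?thesis by simp
qed

text \<open>
  Where \<open>Re q \<ge> 0\<close> the function \<open>\<bar>g\<bar>\<^sup>2\<close> is convex, so it cannot vanish, become positive and decay again.
\<close>

lemma linear_ode_zero_of_decay:
  fixes g g1 q :: "real \<Rightarrow> complex"
  assumes d1: "\<And>t. t > 0 \<Longrightarrow> (g has_vector_derivative g1 t) (at t)"
    and d2: "\<And>t. t > 0 \<Longrightarrow> (g1 has_vector_derivative q t * g t) (at t)"
    and q: "continuous_on {0<..} q" and lim: "(g \<longlongrightarrow> 0) at_top"
    and t0: "t0 > 0" "g t0 = 0" and Req: "\<And>t. t \<ge> t0 \<Longrightarrow> Re (q t) \<ge> 0"
    and t: "t > 0"
  shows "g t = 0"
proof -
  define e where "e t = g t \<bullet> g1 t" for t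
  have E: "((\<lambda>t. g t \<bullet> g t) has_real_derivative 2 * e t) (at t)" if "t > 0" for t
    using has_real_derivative_inner[OF d1[OF that] d1[OF that]] by (simp add: e_def inner_commute)
  have e': "(e has_real_derivative (norm (g1 t))\<^sup>2 + Re (q t) * (norm (g t))\<^sup>2) (at t)" if "t > 0" for t
  proof -
    have "g t \<bullet> (q t * g t) = Re (q t) * (norm (g t))\<^sup>2"
      unfolding cmod_power2 by (simp add: inner_complex_def algebra_simps power2_eq_square)
    then show ?thesis using has_real_derivative_inner[OF d1[OF that] d2[OF that]]
      by (simp add: e_def[abs_def] power2_norm_eq_inner add.commute)
  qed
  have emono: "e a \<le> e b" if "t0 \<le> a" "a \<le> b" for a b
  proof (rule DERIV_nonneg_imp_nondecreasing[OF that(2)])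
    fix x assume "a \<le> x" "x \<le> b"
    then have "x \<ge> t0" "x > 0" using that t0 by auto
    then show "\<exists>y. (e has_real_derivative y) (at x) \<and> 0 \<le> y"
      using e'[of x] Req[of x] by (intro exI[of _ "(norm (g1 x))\<^sup>2 + Re (q x) * (norm (g x))\<^sup>2"]) simp
  qed
  \<comment> \<open>Once positive, \<open>e\<close> would stay positive and
    \<open>\<bar>g\<bar>\<^sup>2\<close> could not fall to its limit 0 unless
    \<open>g a = 0\<close>; but then \<open>e a = 0\<close>.\<close>
  have eneg: "e a \<le> 0" if "t0 \<le> a" for a
  proof (rule ccontr)
    assume "\<not> e a \<le> 0"
    then have ea: "e a > 0" by simp
    have "g a \<bullet> g a \<le> g b \<bullet> g b" if "a \<le> b" for b
    proof (rule DERIV_nonneg_imp_nondecreasing[OF that])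
      fix x assume "a \<le> x" "x \<le> b"
      then show "\<exists>y. ((\<lambda>t. g t \<bullet> g t) has_real_derivative y) (at x) \<and> 0 \<le> y"
        using E[of x] emono[of a x] ea \<open>t0 \<le> a\<close> t0(1) by (intro exI[of _ "2 * e x"]) auto
    qed
    then have ev: "\<forall>\<^sub>F b in at_top. g a \<bullet> g a \<le> g b \<bullet> g b"
      using eventually_ge_at_top[of a] by (rule eventually_mono[rotated]) auto
    have "((\<lambda>b. g b \<bullet> g b) \<longlongrightarrow> 0 \<bullet> (0::complex)) at_top" by (rule tendsto_inner[OF lim lim])
    then have "g a \<bullet> g a \<le> 0" using tendsto_lowerbound[OF _ ev] by simp
    then have "g a = 0" by (metis inner_gt_zero_iff inner_zero_left not_less)
    then show False using ea by (simp add: e_def)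
  qed
  have g0: "g a = 0" if "t0 \<le> a" for a
  proof -
    have "g a \<bullet> g a \<le> g t0 \<bullet> g t0"
    proof (rule DERIV_nonpos_imp_nonincreasing[OF that])
      fix x assume "t0 \<le> x" "x \<le> a"
      then show "\<exists>y. ((\<lambda>t. g t \<bullet> g t) has_real_derivative y) (at x) \<and> y \<le> 0"
        using E[of x] eneg[of x] t0(1) by (intro exI[of _ "2 * e x"]) auto
    qed
    then show ?thesis using t0(2) by (metis inner_gt_zero_iff inner_zero_left not_less)
  qed
  \<comment> \<open>The derivative is known to vanish only in the interior of the region where
    \<open>g\<close> does. The backward argument below therefore starts at
    \<open>t0 + 1\<close>.\<close>
  have g10: "g1 a = 0" if "t0 < a" for a
  proof -
    have "((\<lambda>x. 0) has_vector_derivative g1 a) (at a)"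
      by (rule has_vector_derivative_transform_within_open[OF d1, of a "{t0<..}"])
        (use that t0(1) g0 in auto)
    then show ?thesis using vector_derivative_unique_at has_vector_derivative_const by blast
  qed
  show ?thesis
  proof (cases "t \<ge> t0")
    case False
    then show ?thesis
      using linear_ode_zero_backward[OF d1 d2 q t, of "t0 + 1"] g0[of "t0 + 1"] g10[of "t0 + 1"] by simp
  qed (rule g0)
qed

text \<open>
  Writing \<open>f = g t\<^bsup>1-s\<^esup>\<close>, the equation says that \<open>t\<^bsup>2-2s\<^esup> g'\<close> is constant; boundedness of \<open>g\<close>
  excludes the solution \<open>t\<^sup>s\<close>.
\<close>

lemma euler_ode_decaying:
  fixes f f1 :: "real \<Rightarrow> complex" and s :: complex
  assumes s: "Re s > 1"
    and d1: "\<And>t. t > 0 \<Longrightarrow> (f has_vector_derivative f1 t) (at t)"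
    and d2: "\<And>t. t > 0 \<Longrightarrow> (f1 has_vector_derivative s * (s - 1) / (of_real t)\<^sup>2 * f t) (at t)"
    and bound: "\<And>t. t > 0 \<Longrightarrow> norm (f t) \<le> C * t powr (1 - Re s)"
    and t: "t > 0"
  shows "f t = f 1 * of_real t powr (1 - s)"
proof -
  define P where "P a x = (of_real x :: complex) powr a" for a and x :: real
  have P: "(P a has_vector_derivative a * P (a - 1) x) (at x)" if "x > 0" for a x
    using has_vector_derivative_powr_of_real[OF that] by (simp add: P_def[abs_def])
  have Padd: "P a x * P b x = P (a + b) x" for a b x by (simp add: P_def powr_add)
  have Pdiv: "P (a - 1) x = P a x / of_real x" if "x > 0" for a x using that by (simp add: P_def powr_diff)
  have P0: "P 0 x = 1" if "x > 0" for x using that by (simp add: P_def)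
  define k where "k x = f1 x * P (1 - s) x + (s - 1) * (f x * P (- s) x)" for x
  have "(k has_vector_derivative 0) (at x)" if x: "x > 0" for x
  proof -
    have x0: "complex_of_real x \<noteq> 0" using x by simp
    have p: "P (- s) x = P (- s - 1) x * of_real x" "P (1 - s - 1) x = P (- s - 1) x * of_real x"
      "P (1 - s) x = P (- s - 1) x * (of_real x)\<^sup>2"
      using Pdiv[OF x, of "- s"] Pdiv[OF x, of "1 - s"] x0 by (simp_all add: power2_eq_square)
    have "f1 x * ((1 - s) * P (1 - s - 1) x) + s * (s - 1) / (of_real x)\<^sup>2 * f x * P (1 - s) x
      + (s - 1) * (f x * (- s * P (- s - 1) x) + f1 x * P (- s) x) = 0"
      unfolding p using x0 by (simp add: divide_simps) (simp add: algebra_simps)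
    then show ?thesis
      unfolding k_def
      by (intro has_vector_derivative_eq_rhs[OF has_vector_derivative_add[OF
          has_vector_derivative_mult[OF d2[OF x] P[OF x]]
          has_vector_derivative_mult_right[OF has_vector_derivative_mult[OF d1[OF x] P[OF x]]]]])
  qed
  then obtain k1 where k1: "\<And>x. x > 0 \<Longrightarrow> k x = k1"
    by (rule has_vector_derivative_zero_pos_constant) blast+
  define g where "g x = f x * P (s - 1) x" for x
  define m where "m = 2 * s - 1"
  have m: "m \<noteq> 0" "Re m > 0" using s by (auto simp: m_def complex_eq_iff)
  define h where "h x = g x - k1 * P m x / m" for x
  have "(h has_vector_derivative 0) (at x)" if x: "x > 0" for x
  proof -
    have "f1 x * P (s - 1) x + f x * ((s - 1) * P (s - 1 - 1) x) = k x * P (2 * s - 2) x"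
      unfolding k_def distrib_right mult.assoc Padd
      by (simp add: algebra_simps)
    then have "f x * ((s - 1) * P (s - 1 - 1) x) + f1 x * P (s - 1) x - k1 * (m * P (m - 1) x) / m = 0"
      using m(1) k1[OF x] by (simp add: m_def add.commute)
    then show ?thesis
      unfolding h_def g_def
      by (intro has_vector_derivative_eq_rhs[OF has_vector_derivative_diff[OF has_vector_derivative_mult[OF d1[OF x] P[OF x]]
          has_vector_derivative_divide[OF has_vector_derivative_mult_right[OF P[OF x]]]]])
  qed
  then obtain c where c: "\<And>x. x > 0 \<Longrightarrow> h x = c"
    by (rule has_vector_derivative_zero_pos_constant) blast+
  have gb: "norm (g x) \<le> C" if x: "x > 0" for x
  proof -
    have "norm (g x) \<le> C * x powr (1 - Re s) * x powr (Re s - 1)"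
      using bound[OF x] x by (simp add: g_def P_def norm_mult norm_powr_real_powr mult_right_mono)
    also have "\<dots> = C * x powr ((1 - Re s) + (Re s - 1))" unfolding powr_add by (rule mult.assoc)
    also have "\<dots> = C" using x by simp
    finally show ?thesis .
  qed
  have "k1 = 0"
  proof (rule ccontr)
    assume "k1 \<noteq> 0"
    then have pos: "norm (k1 / m) > 0" using m(1) by (simp add: norm_divide)
    have ub: "norm (k1 / m) * x powr (Re m) \<le> C + norm c" if x: "x > 0" for x
    proof -
      have eq: "g x - c = k1 / m * P m x" unfolding c[OF x, symmetric] h_def by simp
      have "norm (k1 / m) * x powr (Re m) = norm (g x - c)"
        unfolding eq norm_mult using x by (simp add: P_def norm_powr_real_powr)
      also have "\<dots> \<le> C + norm c" using gb[OF x] norm_triangle_ineq4[of "g x" c] by linarith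
      finally show ?thesis .
    qed
    have b: "x powr (Re m) \<le> (C + norm c) / norm (k1 / m)" if "x > 0" for x
      unfolding pos_le_divide_eq[OF pos] using ub[OF that] by (simp only: mult.commute)
    \<comment> \<open>Any value above the bound \<open>b\<close> will do; the point
      \<open>M powr (1 / Re m)\<close> attains it.\<close>
    define M where "M = \<bar>(C + norm c) / norm (k1 / m)\<bar> + 1"
    have "(M powr (1 / Re m)) powr (Re m) = M" using m(2) by (simp add: powr_powr M_def)
    moreover have "M > 0" unfolding M_def by linarith
    then have "M powr (1 / Re m) > 0" by simp
    ultimately show False using b[of "M powr (1 / Re m)"] unfolding M_def by linarith
  qed
  then have "g t = g 1" using c[OF t] c[of 1] by (simp add: h_def)
  moreover have "P (s - 1) t * P (1 - s) t = 1" using Padd P0[OF t] by simp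
  ultimately have "f t = g 1 * P (1 - s) t" by (metis g_def mult.assoc mult.right_neutral)
  then show ?thesis by (simp add: g_def P_def)
qed

section \<open>The Tricomi integral and Whittaker functions\<close>

text \<open>With \<open>c = b - a - 1\<close> this is the integrand of \<Gamma>(a) U(a, b; x).
  Carrying \<open>c\<close> instead of \<open>b\<close> suits differentiation in \<open>x\<close>,
  which shifts \<open>a\<close> and leaves \<open>c\<close> fixed.\<close>

definition laplace_kernel :: "complex \<Rightarrow> complex \<Rightarrow> real \<Rightarrow> real \<Rightarrow> complex" where
  "laplace_kernel a c x t = indicator {0<..} t *\<^sub>R
     (of_real (exp (- x * t)) * of_real t powr (a - 1) * of_real (1 + t) powr c)"

definition laplace_J :: "complex \<Rightarrow> complex \<Rightarrow> real \<Rightarrow> complex" where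
  "laplace_J a c x = (\<integral>t. laplace_kernel a c x t \<partial>lborel)"

text \<open>A common integrable majorant for these kernels, locally uniform in the
  parameters.\<close>

definition exp_poly :: "nat \<Rightarrow> real \<Rightarrow> real \<Rightarrow> real" where
  "exp_poly N \<delta> t = indicator {0<..} t * ((1 + t) ^ N * exp (- \<delta> * t))"

lemma tricomi_integral_eq_laplace_J: "tricomi_integral a b x = rGamma a * laplace_J a (b - a - 1) x"
  by (simp add: tricomi_integral_def laplace_J_def laplace_kernel_def set_lebesgue_integral_def)

lemma power_exp_le_exp:
  fixes t \<delta> :: real
  assumes "\<delta> > 0" "t \<ge> 0"
  shows "(1 + t) ^ N * exp (- \<delta> * t) \<le> (1 + 2 * (real N + 1) / \<delta>) ^ N * exp (- (\<delta> / 2) * t)"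
proof -
  \<comment> \<open>Each of the \<open>N\<close> factors \<open>1 + t\<close> is at most a constant
    times \<open>exp (\<epsilon> * t)\<close>, and together they may use up half of the decay rate.
    The \<open>+ 1\<close> covers \<open>N = 0\<close>.\<close>
  define \<epsilon> where "\<epsilon> = \<delta> / (2 * (real N + 1))"
  have \<epsilon>: "\<epsilon> > 0" using assms by (simp add: \<epsilon>_def)
  have "1 + t \<le> (1 + 1 / \<epsilon>) * (1 + \<epsilon> * t)" using \<epsilon> assms by (simp add: field_simps)
  also have "\<dots> \<le> (1 + 1 / \<epsilon>) * exp (\<epsilon> * t)" using \<epsilon> exp_ge_add_one_self by (intro mult_left_mono) auto
  finally have "(1 + t) ^ N \<le> ((1 + 1 / \<epsilon>) * exp (\<epsilon> * t)) ^ N" using assms by (intro power_mono) auto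
  also have "\<dots> = (1 + 1 / \<epsilon>) ^ N * exp (N * \<epsilon> * t)" by (simp add: power_mult_distrib mult.assoc flip: exp_of_nat_mult)
  also have "\<dots> \<le> (1 + 1 / \<epsilon>) ^ N * exp (\<delta> / 2 * t)"
  proof -
    have "N * \<epsilon> \<le> \<delta> / 2" using assms by (simp add: \<epsilon>_def field_simps)
    then have "N * \<epsilon> * t \<le> \<delta> / 2 * t" using assms(2) by (rule mult_right_mono)
    then show ?thesis using \<epsilon> by (intro mult_left_mono) auto
  qed
  finally have "(1 + t) ^ N * exp (- \<delta> * t) \<le> (1 + 1 / \<epsilon>) ^ N * exp (\<delta> / 2 * t) * exp (- \<delta> * t)"
    by (rule mult_right_mono) simp
  also have "\<dots> = (1 + 2 * (real N + 1) / \<delta>) ^ N * exp (- (\<delta> / 2) * t)"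
    by (simp add: \<epsilon>_def mult.assoc flip: exp_add)
  finally show ?thesis .
qed

lemma integrable_exp_poly:
  assumes "\<delta> > 0"
  shows "integrable lborel (exp_poly N \<delta>)"
proof -
  have "(\<lambda>t::real. exp (- (\<delta> / 2) * t)) absolutely_integrable_on {0..}"
    using integrable_on_exp_minus_to_infinity[of "\<delta> / 2" 0] assms
    by (intro nonnegative_absolutely_integrable_1) auto
  then have "set_integrable lborel {0..} (\<lambda>t::real. exp (- (\<delta> / 2) * t))"
    unfolding set_integrable_def by (subst (asm) integrable_completion) auto
  then have "set_integrable lborel {0<..} (\<lambda>t::real. exp (- (\<delta> / 2) * t))"
    by (rule set_integrable_subset) auto
  then have i: "integrable lborel (\<lambda>t::real. (1 + 2 * (real N + 1) / \<delta>) ^ N * (indicator {0<..} t *\<^sub>R exp (- (\<delta> / 2) * t)))"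
    unfolding set_integrable_def by (rule integrable_mult_right)
  show ?thesis
  proof (rule Bochner_Integration.integrable_bound[OF i])
    show "exp_poly N \<delta> \<in> borel_measurable lborel" unfolding exp_poly_def by measurable
    show "AE t in lborel. norm (exp_poly N \<delta> t)
        \<le> norm ((1 + 2 * (real N + 1) / \<delta>) ^ N * (indicator {0<..} t *\<^sub>R exp (- (\<delta> / 2) * t)))"
    proof (intro AE_I2)
      fix t :: real
      show "norm (exp_poly N \<delta> t)
        \<le> norm ((1 + 2 * (real N + 1) / \<delta>) ^ N * (indicator {0<..} t *\<^sub>R exp (- (\<delta> / 2) * t)))"
      proof (cases "t > 0")
        case True
        have "\<bar>(1 + t) ^ N * exp (- \<delta> * t)\<bar> \<le> \<bar>(1 + 2 * (real N + 1) / \<delta>) ^ N * exp (- (\<delta> / 2) * t)\<bar>"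
          using power_exp_le_exp[OF assms, of t N] True assms by auto
        then show ?thesis using True by (simp add: exp_poly_def)
      qed (simp add: exp_poly_def)
    qed
  qed
qed

lemma laplace_kernel_measurable [measurable]: "laplace_kernel a c x \<in> borel_measurable borel"
  unfolding laplace_kernel_def
  by (intro borel_measurable_continuous_on_indicator continuous_intros) (auto simp: complex_eq_iff)

text \<open>For \<open>Re a \<ge> 1\<close> the power \<open>t powr (a - 1)\<close> has no
  singularity at 0, so both factors are controlled by a single power of
  \<open>1 + t\<close>.\<close>

lemma norm_powr_bound:
  assumes "t > 0" "Re a \<ge> 1" "Re a - 1 + \<bar>Re c\<bar> \<le> real N"
  shows "norm (of_real t powr (a - 1) * of_real (1 + t) powr c) \<le> (1 + t) ^ N"
proof -
  have "norm (of_real t powr (a - 1) * of_real (1 + t) powr c) = t powr (Re a - 1) * (1 + t) powr Re c"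
    using assms(1) by (simp add: norm_mult norm_powr_real_powr del: of_real_add)
  also have "\<dots> \<le> (1 + t) powr (Re a - 1) * (1 + t) powr \<bar>Re c\<bar>"
    using assms by (intro mult_mono powr_mono2 powr_mono) auto
  also have "\<dots> = (1 + t) powr (Re a - 1 + \<bar>Re c\<bar>)" by (simp add: powr_add)
  also have "\<dots> \<le> (1 + t) powr (real N)" using assms by (intro powr_mono) auto
  also have "\<dots> = (1 + t) ^ N" using assms by (simp add: powr_realpow)
  finally show ?thesis .
qed

lemma laplace_kernel_bound:
  assumes "Re a \<ge> 1" "Re a - 1 + \<bar>Re c\<bar> \<le> real N" "\<delta> \<le> x"
  shows "norm (laplace_kernel a c x t) \<le> exp_poly N \<delta> t"
proof (cases "t > 0")
  case True
  have "norm (laplace_kernel a c x t)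
      = exp (- x * t) * norm (of_real t powr (a - 1) * of_real (1 + t) powr c)"
    using True by (simp add: laplace_kernel_def norm_mult)
  also have "\<dots> \<le> exp (- \<delta> * t) * (1 + t) ^ N"
    using True assms by (intro mult_mono norm_powr_bound) auto
  finally show ?thesis using True by (simp add: exp_poly_def mult.commute)
qed (simp add: laplace_kernel_def exp_poly_def)

lemma integrable_laplace_kernel:
  assumes "Re a \<ge> 1" "x > 0"
  shows "integrable lborel (laplace_kernel a c x)"
proof -
  obtain N where N: "Re a - 1 + \<bar>Re c\<bar> \<le> real N" using real_arch_simple by blast
  show ?thesis
  proof (rule Bochner_Integration.integrable_bound[OF integrable_exp_poly[OF assms(2), of N]])
    show "AE t in lborel. norm (laplace_kernel a c x t) \<le> norm (exp_poly N x t)"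
      using laplace_kernel_bound[OF assms(1) N order_refl] by (intro AE_I2) (auto intro: order_trans[OF _ abs_ge_self])
  qed simp
qed

lemma laplace_kernel_shift:
  "laplace_kernel (a + 1) c x t = of_real t * laplace_kernel a c x t"
proof (cases "t > 0")
  case True
  have "complex_of_real t powr a = of_real t powr (a - 1) * of_real t" using True by (simp add: powr_diff)
  then show ?thesis using True by (simp add: laplace_kernel_def)
qed (simp add: laplace_kernel_def)

lemma has_vector_derivative_of_real_exp:
  "((\<lambda>x. of_real (exp (u * x)) :: complex) has_vector_derivative of_real (u * exp (u * x))) (at x)"
  by (rule has_vector_derivative_of_real) (auto intro!: derivative_eq_intros)

text \<open>Differentiation brings down a factor \<open>- t\<close>, which raises \<open>a\<close>
  by one. On the ball of radius \<open>x / 2\<close> the exponential is at most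
  \<open>exp (- (x / 2) * t)\<close>.\<close>

lemma laplace_J_has_vector_derivative:
  assumes a: "Re a \<ge> 1" and x: "x > 0"
  shows "(laplace_J a c has_vector_derivative - laplace_J (a + 1) c x) (at x)"
proof -
  obtain N where N: "Re (a + 1) - 1 + \<bar>Re c\<bar> \<le> real N" using real_arch_simple by blast
  have "((\<lambda>x. \<integral>t. laplace_kernel a c x t \<partial>lborel) has_derivative
      (\<lambda>h. \<integral>t. h *\<^sub>R (- laplace_kernel (a + 1) c x t) \<partial>lborel)) (at x)"
  proof (rule has_derivative_integral_dominated[where r = "x / 2" and g = "exp_poly N (x / 2)"])
    fix y t h :: real assume "y \<in> ball x (x / 2)"
    then have y: "y \<ge> x / 2" using abs_ge_self[of "x - y"] by (simp add: dist_real_def)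
    have "((\<lambda>x. laplace_kernel a c x t) has_vector_derivative - laplace_kernel (a + 1) c y t) (at y)"
    proof -
      define k where "k = indicator {0<..} t *\<^sub>R (complex_of_real t powr (a - 1) * of_real (1 + t) powr c)"
      have k: "laplace_kernel a c x t = of_real (exp (- t * x)) * k" for x
        by (simp add: k_def laplace_kernel_def mult_ac)
      show ?thesis
        unfolding laplace_kernel_shift k
        by (rule has_vector_derivative_eq_rhs[OF has_vector_derivative_mult_left[OF has_vector_derivative_of_real_exp]])
          simp
    qed
    then show "((\<lambda>x. laplace_kernel a c x t) has_derivative (\<lambda>h. h *\<^sub>R (- laplace_kernel (a + 1) c y t))) (at y)"
      by (simp add: has_vector_derivative_def)
    show "norm (h *\<^sub>R (- laplace_kernel (a + 1) c y t)) \<le> exp_poly N (x / 2) t * norm h"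
      using laplace_kernel_bound[of "a + 1" c N "x / 2" y t] a N y
      by (simp add: mult.commute mult_left_mono)
    show "integrable lborel (laplace_kernel a c y)" using integrable_laplace_kernel[OF a] x y by simp
  qed (use x integrable_exp_poly in auto)
  then show ?thesis by (simp add: has_vector_derivative_def laplace_J_def[abs_def])
qed

lemma laplace_J_recurrence:
  assumes a: "Re a \<ge> 1" and x: "x > 0"
  shows "of_real x * laplace_J (a + 2) c x
    = (a + c + 1 - of_real x) * laplace_J (a + 1) c x + a * laplace_J a c x"
proof -
  define F where "F t = of_real (exp (- x * t)) * of_real t powr a * of_real (1 + t) powr (c + 1)" for t
  define f where "f t = of_real (exp (- x * t)) * of_real t powr (a - 1) * of_real (1 + t) powr c
     * (a + (a + c + 1 - of_real x) * of_real t - of_real x * (of_real t)\<^sup>2)" for t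
  obtain N where N: "Re (a + 1) - 1 + \<bar>Re (c + 1)\<bar> \<le> real N" using real_arch_simple by blast
  have fk: "indicator {0<..} t *\<^sub>R f t = a * laplace_kernel a c x t
     + (a + c + 1 - of_real x) * laplace_kernel (a + 1) c x t - of_real x * laplace_kernel (a + 2) c x t" for t
  proof -
    have "laplace_kernel (a + 2) c x t = of_real t * (of_real t * laplace_kernel a c x t)"
      using laplace_kernel_shift[of "a + 1"] laplace_kernel_shift[of a] by (simp add: add.assoc)
    moreover have "indicator {0<..} t *\<^sub>R f t = laplace_kernel a c x t
       * (a + (a + c + 1 - of_real x) * of_real t - of_real x * (of_real t)\<^sup>2)"
      unfolding f_def laplace_kernel_def by (rule mult_scaleR_left[symmetric])
    moreover have "k * (a + m * u - v * u\<^sup>2) = a * k + m * (u * k) - v * (u * (u * k))" for k m u v :: complex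
      by (simp add: algebra_simps power2_eq_square)
    ultimately show ?thesis unfolding laplace_kernel_shift by (simp only:)
  qed
  have ints: "integrable lborel (laplace_kernel a c x)" "integrable lborel (laplace_kernel (a + 1) c x)"
    "integrable lborel (laplace_kernel (a + 2) c x)"
    using a x by (auto intro!: integrable_laplace_kernel)
  have intf: "(\<integral>t. indicator {0<..} t *\<^sub>R f t \<partial>lborel) = a * laplace_J a c x
     + (a + c + 1 - of_real x) * laplace_J (a + 1) c x - of_real x * laplace_J (a + 2) c x"
    unfolding fk laplace_J_def using ints by simp
  have Fb: "norm (F t) \<le> (1 + t) ^ N * exp (- x * t)" if "t > 0" for t
  proof -
    have "norm (F t) = exp (- x * t) * norm (of_real t powr (a + 1 - 1) * of_real (1 + t) powr (c + 1))"
      by (simp add: F_def norm_mult)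
    also have "\<dots> \<le> exp (- x * t) * (1 + t) ^ N"
      using a N that by (intro mult_left_mono norm_powr_bound) auto
    finally show ?thesis by (simp add: mult.commute)
  qed
  have "(LBINT t=0..\<infinity>. f t) = 0 - 0"
  proof (rule interval_integral_FTC_integrable)
    show "(F has_vector_derivative f t) (at t)" if "0 < ereal t" "ereal t < \<infinity>" for t
    proof -
      have t: "t > 0" using that by simp
      have p: "of_real t powr a = of_real t powr (a - 1) * complex_of_real t"
        "of_real (1 + t) powr (c + 1) = of_real (1 + t) powr c * complex_of_real (1 + t)"
        using t by (auto simp: powr_diff powr_add simp del: of_real_add)
      have q: "((\<lambda>t. of_real (1 + t) powr (c + 1)) has_vector_derivative (c + 1) * complex_of_real (1 + t) powr c) (at t)"
      proof -
        have "((\<lambda>z. (1 + z) powr (c + 1)) has_field_derivative (c + 1) * complex_of_real (1 + t) powr c) (at (of_real t))"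
          using t by (auto intro!: derivative_eq_intros simp: complex_nonpos_Reals_iff)
        from has_vector_derivative_real_field[OF this] show ?thesis by simp
      qed
      show ?thesis
        unfolding F_def
        by (rule has_vector_derivative_eq_rhs[OF has_vector_derivative_mult[OF
              has_vector_derivative_mult[OF has_vector_derivative_of_real_exp has_vector_derivative_powr_of_real[OF t]] q]])
          (unfold f_def p, simp add: algebra_simps power2_eq_square)
    qed
    show "isCont f t" if "0 < ereal t" "ereal t < \<infinity>" for t
    proof -
      have "continuous_on {0<..} f"
        unfolding f_def
        by (intro continuous_intros) (auto simp: complex_eq_iff complex_nonpos_Reals_iff)
      then show ?thesis using that by (simp add: continuous_on_eq_continuous_at)
    qed
    show "set_integrable lborel (einterval 0 \<infinity>) f"
    proof -
      have "integrable lborel (\<lambda>t. indicator {0<..} t *\<^sub>R f t)" unfolding fk using ints by simp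
      moreover have "einterval 0 \<infinity> = {0<..}" by (auto simp: einterval_def)
      ultimately show ?thesis by (simp add: set_integrable_def)
    qed
    show "((F \<circ> real_of_ereal) \<longlongrightarrow> 0) (at_right 0)"
    proof -
      have "(F \<longlongrightarrow> 0) (at_right 0)"
      proof (rule Lim_null_comparison)
        \<comment> \<open>For \<open>t < 1\<close> and \<open>Re a \<ge> 1\<close> the power of
          \<open>t\<close> is at most \<open>t\<close>, and \<open>1 + t\<close> lies between 1 and
          2.\<close>
        show "\<forall>\<^sub>F t in at_right 0. norm (F t) \<le> t * 2 powr \<bar>Re (c + 1)\<bar>"
          using eventually_at_right_real[of 0 1]
        proof (rule eventually_mono)
          fix t :: real assume "t \<in> {0<..<1}"
          then have t: "0 < t" "t < 1" by auto
          have "norm (F t) = exp (- x * t) * (t powr Re a * (1 + t) powr Re (c + 1))"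
            using t by (simp add: F_def norm_mult norm_powr_real_powr del: of_real_add)
          also have "\<dots> \<le> 1 * (t powr 1 * 2 powr \<bar>Re (c + 1)\<bar>)"
          proof (intro mult_mono)
            have "(1 + t) powr Re (c + 1) \<le> (1 + t) powr \<bar>Re (c + 1)\<bar>" using t by (intro powr_mono) auto
            also have "\<dots> \<le> 2 powr \<bar>Re (c + 1)\<bar>" using t by (intro powr_mono2) auto
            finally show "(1 + t) powr Re (c + 1) \<le> 2 powr \<bar>Re (c + 1)\<bar>" .
            show "t powr Re a \<le> t powr 1" using t a by (intro powr_mono') auto
          qed (use t x in auto)
          finally show "norm (F t) \<le> t * 2 powr \<bar>Re (c + 1)\<bar>" using t by simp
        qed simp
        show "((\<lambda>t. t * 2 powr \<bar>Re (c + 1)\<bar>) \<longlongrightarrow> 0) (at_right 0)"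
          by (rule tendsto_mult_left_zero[OF tendsto_ident_at])
      qed
      then show ?thesis by (simp add: ereal_tendsto_simps zero_ereal_def)
    qed
    show "((F \<circ> real_of_ereal) \<longlongrightarrow> 0) (at_left \<infinity>)"
    proof -
      have "(F \<longlongrightarrow> 0) at_top"
      proof (rule Lim_null_comparison)
        show "\<forall>\<^sub>F t in at_top. norm (F t) \<le> (1 + 2 * (real N + 1) / x) ^ N * exp (- (x / 2) * t)"
          using eventually_gt_at_top[of 0]
        proof eventually_elim
          case (elim t)
          then show ?case using Fb[OF elim] power_exp_le_exp[OF x, of t N] by linarith
        qed
        have "filterlim (\<lambda>t. - (x / 2) * t) at_bot at_top"
          using x by (intro filterlim_tendsto_neg_mult_at_bot[OF tendsto_const] filterlim_ident) auto
        then show "((\<lambda>t. (1 + 2 * (real N + 1) / x) ^ N * exp (- (x / 2) * t)) \<longlongrightarrow> 0) at_top"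
          by (intro tendsto_mult_right_zero filterlim_compose[OF exp_at_bot])
      qed
      then show ?thesis by (simp add: ereal_tendsto_simps)
    qed
  qed simp
  moreover have "(LBINT t=0..\<infinity>. f t) = (\<integral>t. indicator {0<..} t *\<^sub>R f t \<partial>lborel)"
  proof -
    have "einterval 0 \<infinity> = {0<..}" by (auto simp: einterval_def)
    then show ?thesis by (simp add: interval_lebesgue_integral_def set_lebesgue_integral_def)
  qed
  ultimately show ?thesis using intf by (simp add: algebra_simps)
qed

text \<open>For \<open>t \<ge> 1\<close> the logarithm costs one power of \<open>t\<close>. For
  \<open>t < 1\<close> the inequality \<open>ln u \<le> u\<close> at
  \<open>u = t powr (- \<epsilon>)\<close> trades it for an arbitrarily small power.\<close>

lemma powr_mult_ln_bound:
  fixes t \<epsilon> \<alpha> :: real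
  assumes t: "t > 0" and \<epsilon>: "\<epsilon> > 0" "\<epsilon> \<le> \<alpha>"
  shows "t powr \<alpha> * \<bar>ln t\<bar> \<le> (1 + 1 / \<epsilon>) * (1 + t) powr (\<alpha> + 1)"
proof (cases "t \<ge> 1")
  case True
  have "\<bar>ln t\<bar> \<le> t" using True ln_bound[of t] by auto
  then have "t powr \<alpha> * \<bar>ln t\<bar> \<le> t powr \<alpha> * t" by (intro mult_left_mono) auto
  also have "\<dots> = t powr (\<alpha> + 1)" using t by (simp add: powr_add)
  also have "\<dots> \<le> 1 * (1 + t) powr (\<alpha> + 1)" using t \<epsilon> by (simp add: powr_mono2)
  also have "\<dots> \<le> (1 + 1 / \<epsilon>) * (1 + t) powr (\<alpha> + 1)" using \<epsilon> by (intro mult_right_mono) auto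
  finally show ?thesis .
next
  case False
  have "\<epsilon> * \<bar>ln t\<bar> = ln (t powr (- \<epsilon>))" using t False by (simp add: ln_powr)
  also have "\<dots> \<le> t powr (- \<epsilon>)" using t by (intro ln_bound) auto
  finally have "\<bar>ln t\<bar> \<le> t powr (- \<epsilon>) / \<epsilon>" using \<epsilon> by (simp add: field_simps)
  then have "t powr \<alpha> * \<bar>ln t\<bar> \<le> t powr \<alpha> * (t powr (- \<epsilon>) / \<epsilon>)" by (intro mult_left_mono) auto
  also have "\<dots> = t powr (\<alpha> - \<epsilon>) / \<epsilon>" by (simp add: powr_diff powr_minus divide_simps)
  also have "\<dots> \<le> 1 / \<epsilon>" using t False \<epsilon> by (intro divide_right_mono powr_le1) auto
  also have "\<dots> \<le> (1 + 1 / \<epsilon>) * 1" using \<epsilon> by simp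
  also have "\<dots> \<le> (1 + 1 / \<epsilon>) * (1 + t) powr (\<alpha> + 1)"
    using t \<epsilon> by (intro mult_left_mono ge_one_powr_ge_zero) auto
  finally show ?thesis .
qed

text \<open>The lower bound on the exponent absorbs the logarithm that differentiation produces at \<open>t = 0\<close>.\<close>

lemma laplace_J_holomorphic:
  fixes s0 \<kappa> \<mu> :: complex
  assumes s0: "Re (s0 + \<kappa>) > 1" and x: "x > 0"
  shows "(\<lambda>s. laplace_J (s + \<kappa>) (s + \<mu>) x) field_differentiable (at s0)"
proof -
  \<comment> \<open>Half of the available gap: on a ball of radius at most \<epsilon> the exponent
    \<open>Re (s + \<kappa>) - 1\<close> stays above \<epsilon>.\<close>
  define \<epsilon> where "\<epsilon> = (Re (s0 + \<kappa>) - 1) / 2"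
  have \<epsilon>: "\<epsilon> > 0" using s0 by (simp add: \<epsilon>_def)
  define r where "r = min \<epsilon> 1"
  have r: "r > 0" "r \<le> \<epsilon>" "r \<le> 1" using \<epsilon> by (auto simp: r_def)
  obtain N where N: "Re (s0 + \<kappa>) + 2 + \<bar>Re (s0 + \<mu>)\<bar> + 1 \<le> real N" using real_arch_simple by blast
  define D where "D s t = laplace_kernel (s + \<kappa>) (s + \<mu>) x t * of_real (ln t + ln (1 + t))" for s t
  define C where "C = 2 + 1 / \<epsilon>"
  have bnd: "norm (D s t) \<le> C * exp_poly N x t" if s: "s \<in> ball s0 r" for s t
  proof (cases "t > 0")
    case True
    have "\<bar>Re s - Re s0\<bar> < r"
      using s abs_Re_le_cmod[of "s - s0"] by (simp add: dist_norm norm_minus_commute)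
    then have rs: "Re (s + \<kappa>) - 1 \<ge> \<epsilon>" "Re (s + \<kappa>) \<le> Re (s0 + \<kappa>) + 1" "\<bar>Re (s + \<mu>)\<bar> \<le> \<bar>Re (s0 + \<mu>)\<bar> + 1"
      using r by (auto simp: \<epsilon>_def)
    define \<alpha> where "\<alpha> = Re (s + \<kappa>) - 1"
    define \<beta> where "\<beta> = Re (s + \<mu>)"
    have t1: "1 + t > 0" using True by simp
    have nk: "norm (laplace_kernel (s + \<kappa>) (s + \<mu>) x t) = exp (- x * t) * (t powr \<alpha> * (1 + t) powr \<beta>)"
      using True by (simp add: laplace_kernel_def norm_mult norm_powr_real_powr \<alpha>_def \<beta>_def del: of_real_add)
    have "t powr \<alpha> * \<bar>ln t + ln (1 + t)\<bar> \<le> t powr \<alpha> * \<bar>ln t\<bar> + t powr \<alpha> * (1 + t)"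
    proof -
      have "\<bar>ln (1 + t)\<bar> \<le> 1 + t" using True ln_bound[of "1 + t"] by simp
      then have "\<bar>ln t + ln (1 + t)\<bar> \<le> \<bar>ln t\<bar> + (1 + t)" by linarith
      from mult_left_mono[OF this, of "t powr \<alpha>"] show ?thesis by (simp add: distrib_left)
    qed
    also have "\<dots> \<le> (1 + 1 / \<epsilon>) * (1 + t) powr (\<alpha> + 1) + (1 + t) powr \<alpha> * (1 + t)"
      using True rs \<epsilon> by (intro add_mono powr_mult_ln_bound mult_right_mono powr_mono2) (auto simp: \<alpha>_def)
    also have "\<dots> = C * (1 + t) powr (\<alpha> + 1)" using t1 by (simp add: C_def powr_add algebra_simps)
    finally have "t powr \<alpha> * \<bar>ln t + ln (1 + t)\<bar> \<le> C * (1 + t) powr (\<alpha> + 1)" .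
    then have "exp (- x * t) * (t powr \<alpha> * \<bar>ln t + ln (1 + t)\<bar>) * (1 + t) powr \<beta>
      \<le> exp (- x * t) * (C * (1 + t) powr (\<alpha> + 1)) * (1 + t) powr \<beta>"
      by (intro mult_right_mono mult_left_mono) auto
    also have "\<dots> = C * exp (- x * t) * (1 + t) powr (\<alpha> + 1 + \<beta>)" by (simp add: powr_add)
    also have "\<dots> \<le> C * exp (- x * t) * (1 + t) powr (real N)"
      using True N rs \<epsilon> by (intro mult_left_mono powr_mono) (auto simp: C_def \<alpha>_def \<beta>_def)
    also have "\<dots> = C * exp_poly N x t" using True by (simp add: exp_poly_def powr_realpow mult_ac)
    finally show ?thesis
      unfolding D_def norm_mult nk norm_of_real by (simp add: mult_ac)
  qed (simp add: D_def laplace_kernel_def exp_poly_def)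
  have "((\<lambda>s. \<integral>t. laplace_kernel (s + \<kappa>) (s + \<mu>) x t \<partial>lborel) has_derivative
      (\<lambda>h. \<integral>t. h * D s0 t \<partial>lborel)) (at s0)"
  proof (rule has_derivative_integral_dominated[OF r(1), where g = "\<lambda>t. C * exp_poly N x t"])
    fix s h t assume s: "s \<in> ball s0 r"
    show "((\<lambda>s. laplace_kernel (s + \<kappa>) (s + \<mu>) x t) has_derivative (\<lambda>h. h * D s t)) (at s)"
    proof (cases "t > 0")
      case True
      have ln: "Ln (complex_of_real t) = of_real (ln t)" "Ln (complex_of_real (1 + t)) = of_real (ln (1 + t))"
        using True by (simp_all add: Ln_of_real del: of_real_add)
      have t1: "complex_of_real t \<noteq> 0" "complex_of_real (1 + t) \<noteq> 0" using True by (auto simp del: of_real_add)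
      have k: "laplace_kernel (s + \<kappa>) (s + \<mu>) x t = of_real (exp (- x * t))
          * exp ((s + \<kappa> - 1) * of_real (ln t)) * exp ((s + \<mu>) * of_real (ln (1 + t)))" for s
        using True t1 ln by (simp add: laplace_kernel_def powr_def del: of_real_add)
      have "((\<lambda>s. laplace_kernel (s + \<kappa>) (s + \<mu>) x t) has_field_derivative D s t) (at s)"
        unfolding D_def k by (auto intro!: derivative_eq_intros simp: algebra_simps)
      then show ?thesis by (simp add: has_field_derivative_def mult_commute_abs)
    qed (simp add: laplace_kernel_def D_def)
    show "norm (h * D s t) \<le> C * exp_poly N x t * norm h"
      using mult_left_mono[OF bnd[OF s, of t], of "norm h"] by (simp add: norm_mult mult_ac)
    show "integrable lborel (laplace_kernel (s + \<kappa>) (s + \<mu>) x)"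
    proof (rule integrable_laplace_kernel[OF _ x])
      have "\<bar>Re s - Re s0\<bar> < r"
        using s abs_Re_le_cmod[of "s - s0"] by (simp add: dist_norm norm_minus_commute)
      then show "Re (s + \<kappa>) \<ge> 1" using r \<epsilon> by (simp add: \<epsilon>_def)
    qed
  next
    show "(\<lambda>t. h * D s0 t) \<in> borel_measurable lborel" for h unfolding D_def by measurable
  qed (use integrable_exp_poly[OF x] in auto)
  then have "((\<lambda>s. \<integral>t. laplace_kernel (s + \<kappa>) (s + \<mu>) x t \<partial>lborel) has_field_derivative (\<integral>t. D s0 t \<partial>lborel)) (at s0)"
    by (simp add: has_field_derivative_def mult_commute_abs)
  then show ?thesis unfolding field_differentiable_def laplace_J_def by blast
qed

text \<open>Substituting \<open>t = u / n\<close>, dominated convergence gives \<open>n\<^sup>a J(n) \<longlonglongrightarrow> \<Gamma>(a)\<close>.\<close>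

lemma laplace_J_not_identically_zero:
  assumes a: "Re a \<ge> 1"
  shows "\<exists>x>0. laplace_J a c x \<noteq> 0"
proof (rule ccontr)
  assume "\<not> (\<exists>x>0. laplace_J a c x \<noteq> 0)"
  then have J0: "laplace_J a c x = 0" if "x > 0" for x using that by blast
  \<comment> \<open>The kernel at \<open>x = Suc n\<close> after the substitution
    \<open>t = u / Suc n\<close>, rescaled by the power \<open>a - 1\<close> of \<open>Suc n\<close>
    so that a limit exists.\<close>
  define H where "H n u = indicator {0<..} u *\<^sub>R
    (of_real (exp (- u)) * of_real u powr (a - 1) * of_real (1 + u / real (Suc n)) powr c)" for n u
  have Hm: "H n \<in> borel_measurable lborel" for n
  proof -
    have "H n \<in> borel_measurable borel"
      unfolding H_def
      by (intro borel_measurable_continuous_on_indicator continuous_intros)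
        (auto simp: complex_eq_iff complex_nonpos_Reals_iff add_pos_pos divide_simps)
    then show ?thesis by simp
  qed
  have H0: "(\<integral>u. H n u \<partial>lborel) = 0" for n
  proof -
    let ?n = "real (Suc n)"
    have "0 = laplace_J a c ?n" using J0 by simp
    also have "\<dots> = \<bar>1 / ?n\<bar> *\<^sub>R (\<integral>u. laplace_kernel a c ?n (0 + 1 / ?n * u) \<partial>lborel)"
      unfolding laplace_J_def by (rule lborel_integral_real_affine) simp
    finally have "(\<integral>u. laplace_kernel a c ?n (1 / ?n * u) \<partial>lborel) = 0" by simp
    moreover have "H n u = of_real ?n powr (a - 1) * laplace_kernel a c ?n (1 / ?n * u)" for u
    proof (cases "u > 0")
      case True
      define v where "v = 1 / ?n * u"
      have v: "v > 0" "- ?n * v = - u" "u / ?n = v" using True by (auto simp: v_def field_simps)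
      have "complex_of_real u = of_real ?n * of_real v" using v(2) by (metis minus_mult_left neg_equal_iff_equal of_real_mult)
      then have "of_real u powr (a - 1) = of_real ?n powr (a - 1) * complex_of_real v powr (a - 1)"
        using v(1) by (simp add: powr_times_real del: of_real_of_nat_eq)
      then show ?thesis
        unfolding v_def[symmetric] using True v(1)
        by (simp only: H_def laplace_kernel_def v(2,3)) (simp add: mult_ac)
    next
      case False
      then have "\<not> 1 / ?n * u > 0" by (simp add: divide_simps)
      then show ?thesis using False by (simp add: H_def laplace_kernel_def)
    qed
    ultimately show ?thesis by simp
  qed
  \<comment> \<open>The majorant uses the exponent \<open>\<bar>Re c\<bar>\<close> in place of
    \<open>c\<close>, because the modulus of the last factor is at most
    \<open>(1 + u) powr \<bar>Re c\<bar>\<close> for every n.\<close>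
  obtain N where N: "Re a - 1 + \<bar>Re (of_real \<bar>Re c\<bar>)\<bar> \<le> real N" using real_arch_simple by blast
  have "(\<lambda>n. \<integral>u. H n u \<partial>lborel) \<longlonglongrightarrow> (\<integral>u. laplace_kernel a 0 1 u \<partial>lborel)"
  proof (rule integral_dominated_convergence)
    show "integrable lborel (exp_poly N 1)" by (rule integrable_exp_poly) simp
    show "AE u in lborel. norm (H n u) \<le> exp_poly N 1 u" for n
    proof (intro AE_I2)
      fix u
      show "norm (H n u) \<le> exp_poly N 1 u"
      proof (cases "u > 0")
        case True
        let ?v = "1 + u / real (Suc n)"
        have v: "1 \<le> ?v" "?v \<le> 1 + u" using True by (auto simp: field_simps)
        have "?v powr Re c \<le> ?v powr \<bar>Re c\<bar>" using v by (intro powr_mono) auto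
        also have "\<dots> \<le> (1 + u) powr \<bar>Re c\<bar>" using v by (intro powr_mono2) auto
        finally have "norm (H n u) \<le> norm (laplace_kernel a (of_real \<bar>Re c\<bar>) 1 u)"
          using True v
          by (simp add: H_def laplace_kernel_def norm_mult norm_powr_real_powr mult_left_mono del: of_real_add of_real_divide)
        also have "\<dots> \<le> exp_poly N 1 u" using a N by (intro laplace_kernel_bound) auto
        finally show ?thesis .
      qed (simp add: H_def exp_poly_def)
    qed
    show "AE u in lborel. (\<lambda>n. H n u) \<longlonglongrightarrow> laplace_kernel a 0 1 u"
    proof (intro AE_I2)
      fix u
      show "(\<lambda>n. H n u) \<longlonglongrightarrow> laplace_kernel a 0 1 u"
      proof (cases "u > 0")
        case True
        have "(\<lambda>n. u / real (Suc n)) \<longlonglongrightarrow> 0" by (rule LIMSEQ_Suc[OF lim_const_over_n])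
        then have "(\<lambda>n. of_real (1 + u / real (Suc n)) powr c) \<longlonglongrightarrow> complex_of_real (1 + 0) powr c"
          by (intro tendsto_intros) auto
        then have "(\<lambda>n. H n u) \<longlonglongrightarrow> indicator {0<..} u *\<^sub>R (of_real (exp (- u)) * of_real u powr (a - 1) * (complex_of_real (1 + 0) powr c))"
          unfolding H_def by (intro tendsto_scaleR tendsto_mult tendsto_const)
        moreover have "1 + complex_of_real u \<noteq> 0" using True by (auto simp: complex_eq_iff)
        ultimately show ?thesis using True by (simp add: laplace_kernel_def)
      qed (simp add: H_def laplace_kernel_def)
    qed
  qed (use Hm in auto)
  then have "(\<integral>u. laplace_kernel a 0 1 u \<partial>lborel) = 0" unfolding H0 using LIMSEQ_unique tendsto_const by metis
  moreover have "(\<integral>u. laplace_kernel a 0 1 u \<partial>lborel) = Gamma a"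
  proof -
    let ?f = "\<lambda>t. of_real t powr (a - 1) / complex_of_real (exp t)"
    have k: "laplace_kernel a 0 1 u = indicator {0<..} u *\<^sub>R ?f u" for u
    proof (cases "u > 0")
      case True
      then have "1 + complex_of_real u \<noteq> 0" by (auto simp: complex_eq_iff)
      then show ?thesis by (simp add: laplace_kernel_def exp_minus field_simps)
    qed (simp add: laplace_kernel_def)
    have "set_integrable lborel {0<..} ?f"
      using integrable_laplace_kernel[of a 1 0] a unfolding set_integrable_def k by simp
    from set_borel_integral_eq_integral(2)[OF this]
    have "(LINT u:{0<..}|lborel. ?f u) = integral {0<..} ?f" .
    also have "\<dots> = Gamma a" using a by (intro integral_unique Gamma_integral_complex') auto
    finally show ?thesis by (simp add: k set_lebesgue_integral_def)
  qed
  moreover have "Gamma a \<noteq> 0"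
    using a by (auto simp: Gamma_eq_zero_iff elim!: nonpos_Ints_cases)
  ultimately show False by simp
qed

text \<open>Up to the factor \<open>(2 * \<theta>) powr (- s) * Gamma (s - \<kappa>)\<close>, which
  does not depend on \<open>t\<close>, this is the Whittaker function with parameters \<kappa> and
  \<open>s - 1/2\<close> at \<open>2 * \<theta> * t\<close>.\<close>

definition whittaker_fun :: "complex \<Rightarrow> real \<Rightarrow> complex \<Rightarrow> real \<Rightarrow> complex" where
  "whittaker_fun \<kappa> \<theta> s t =
     of_real t powr s * of_real (exp (- \<theta> * t)) * laplace_J (s - \<kappa>) (s + \<kappa> - 1) (2 * \<theta> * t)"

text \<open>The coefficient of Whittaker's equation in the variable
  \<open>t = v / (2 * \<theta>)\<close>. At \<open>\<theta> = 0\<close> it is the coefficient of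
  Euler's equation, so the constant term fits the same scheme.\<close>

definition whittaker_coeff :: "complex \<Rightarrow> real \<Rightarrow> complex \<Rightarrow> real \<Rightarrow> complex" where
  "whittaker_coeff \<kappa> \<theta> s t = (of_real \<theta>)\<^sup>2 - 2 * of_real \<theta> * \<kappa> / of_real t + s * (s - 1) / (of_real t)\<^sup>2"

definition whittaker_fun' :: "complex \<Rightarrow> real \<Rightarrow> complex \<Rightarrow> real \<Rightarrow> complex" where
  "whittaker_fun' \<kappa> \<theta> s t = of_real t powr s * of_real (exp (- \<theta> * t)) *
     ((s / of_real t - of_real \<theta>) * laplace_J (s - \<kappa>) (s + \<kappa> - 1) (2 * \<theta> * t)
      - 2 * of_real \<theta> * laplace_J (s - \<kappa> + 1) (s + \<kappa> - 1) (2 * \<theta> * t))"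

context
  fixes \<kappa> s :: complex and \<theta> :: real
  assumes a: "Re (s - \<kappa>) \<ge> 1" and \<theta>: "\<theta> > 0"
begin

lemma powr_exp_has_vector_derivative:
  assumes "t > 0"
  shows "((\<lambda>t. of_real t powr s * of_real (exp (- \<theta> * t))) has_vector_derivative
    of_real t powr s * of_real (exp (- \<theta> * t)) * (s / of_real t - of_real \<theta>)) (at t)"
  by (rule has_vector_derivative_eq_rhs[OF has_vector_derivative_mult[OF
        has_vector_derivative_powr_of_real[OF assms] has_vector_derivative_of_real_exp]])
    (use assms in \<open>simp add: powr_diff algebra_simps\<close>)

lemma laplace_J_scaled_has_vector_derivative:
  assumes "t > 0" "Re a' \<ge> 1"
  shows "((\<lambda>t. laplace_J a' c (2 * \<theta> * t)) has_vector_derivative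
    - (2 * of_real \<theta>) * laplace_J (a' + 1) c (2 * \<theta> * t)) (at t)"
proof -
  have "((\<lambda>t. 2 * \<theta> * t) has_vector_derivative 2 * \<theta>) (at t)"
    by (auto intro!: derivative_eq_intros)
  from vector_diff_chain_at[OF this, of "laplace_J a' c", OF laplace_J_has_vector_derivative[OF assms(2)]]
  show ?thesis using assms \<theta> by (simp add: o_def scaleR_conv_of_real)
qed

lemma whittaker_fun_has_vector_derivative:
  assumes t: "t > 0"
  shows "(whittaker_fun \<kappa> \<theta> s has_vector_derivative whittaker_fun' \<kappa> \<theta> s t) (at t)"
  unfolding whittaker_fun_def whittaker_fun'_def
  by (rule has_vector_derivative_eq_rhs[OF has_vector_derivative_mult[OF
        powr_exp_has_vector_derivative[OF t] laplace_J_scaled_has_vector_derivative[OF t a]]])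
    (simp add: algebra_simps)

text \<open>The product rule leaves the integrals with first parameter raised by 0, 1 and 2.
  Kummer's equation eliminates the last, and the terms with the middle one cancel.\<close>

lemma whittaker_fun'_has_vector_derivative:
  assumes t: "t > 0"
  shows "(whittaker_fun' \<kappa> \<theta> s has_vector_derivative
    whittaker_coeff \<kappa> \<theta> s t * whittaker_fun \<kappa> \<theta> s t) (at t)"
proof -
  define E where "E = of_real t powr s * complex_of_real (exp (- \<theta> * t))"
  define u where "u = s / of_real t - complex_of_real \<theta>"
  define J0 J1 J2 where "J0 = laplace_J (s - \<kappa>) (s + \<kappa> - 1) (2 * \<theta> * t)"
    and "J1 = laplace_J (s - \<kappa> + 1) (s + \<kappa> - 1) (2 * \<theta> * t)"
    and "J2 = laplace_J (s - \<kappa> + 1 + 1) (s + \<kappa> - 1) (2 * \<theta> * t)"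
  define z where "z = complex_of_real t"
  define w where "w = complex_of_real \<theta>"
  have z: "z \<noteq> 0" using t by (simp add: z_def)
  have a1: "Re (s - \<kappa> + 1) \<ge> 1" using a by simp
  have rec: "2 * w * z * J2 = (2 * s - 2 * w * z) * J1 + (s - \<kappa>) * J0"
    using laplace_J_recurrence[OF a, of "2 * \<theta> * t" "s + \<kappa> - 1"] \<theta> t
    by (simp add: J0_def J1_def J2_def w_def z_def add.assoc)
  have d: "((\<lambda>t. s / of_real t - complex_of_real \<theta>) has_vector_derivative - s / z\<^sup>2) (at t)"
  proof -
    have "((\<lambda>v. s / v - complex_of_real \<theta>) has_field_derivative - s / z\<^sup>2) (at (of_real t))"
      using z by (auto intro!: derivative_eq_intros simp: z_def power2_eq_square)
    then show ?thesis by (rule has_vector_derivative_real_field)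
  qed
  have "E * (- s / z\<^sup>2 * J0 + u * (- (2 * w) * J1) - 2 * w * (- (2 * w) * J2)) + E * u * (u * J0 - 2 * w * J1)
      = E * (((u\<^sup>2 - s / z\<^sup>2) * J0 - 4 * w * u * J1) + 4 * w\<^sup>2 * J2)"
    by (simp add: algebra_simps power2_eq_square)
  also have "4 * w\<^sup>2 * J2 = 2 * w / z * (2 * w * z * J2)" using z by (simp add: power2_eq_square)
  also have "\<dots> = 2 * w / z * ((2 * s - 2 * w * z) * J1 + (s - \<kappa>) * J0)" unfolding rec ..
  also have "E * (((u\<^sup>2 - s / z\<^sup>2) * J0 - 4 * w * u * J1) + 2 * w / z * ((2 * s - 2 * w * z) * J1 + (s - \<kappa>) * J0))
      = (w\<^sup>2 - 2 * w * \<kappa> / z + s * (s - 1) / z\<^sup>2) * (E * J0)"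
    unfolding u_def z_def[symmetric] w_def[symmetric] using z
    by (simp add: divide_simps) (simp add: algebra_simps power2_eq_square)
  finally have eq: "E * (- s / z\<^sup>2 * J0 + u * (- (2 * w) * J1) - 2 * w * (- (2 * w) * J2)) + E * u * (u * J0 - 2 * w * J1)
      = (w\<^sup>2 - 2 * w * \<kappa> / z + s * (s - 1) / z\<^sup>2) * (E * J0)" .
  have "((\<lambda>t. (s / of_real t - of_real \<theta>) * laplace_J (s - \<kappa>) (s + \<kappa> - 1) (2 * \<theta> * t)
      - 2 * of_real \<theta> * laplace_J (s - \<kappa> + 1) (s + \<kappa> - 1) (2 * \<theta> * t)) has_vector_derivative
      (- s / z\<^sup>2 * J0 + u * (- (2 * w) * J1) - 2 * w * (- (2 * w) * J2))) (at t)"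
    by (rule has_vector_derivative_eq_rhs[OF has_vector_derivative_diff[OF
          has_vector_derivative_mult[OF d laplace_J_scaled_has_vector_derivative[OF t a]]
          has_vector_derivative_mult_right[OF laplace_J_scaled_has_vector_derivative[OF t a1]]]])
      (simp add: J0_def J1_def J2_def u_def w_def)
  from has_vector_derivative_mult[OF powr_exp_has_vector_derivative[OF t] this]
  have "(whittaker_fun' \<kappa> \<theta> s has_vector_derivative
    E * (- s / z\<^sup>2 * J0 + u * (- (2 * w) * J1) - 2 * w * (- (2 * w) * J2)) + E * u * (u * J0 - 2 * w * J1)) (at t)"
    unfolding whittaker_fun'_def[abs_def] by (simp add: E_def u_def J0_def J1_def w_def)
  then show ?thesis
    unfolding eq by (simp add: whittaker_coeff_def whittaker_fun_def E_def J0_def w_def z_def)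
qed

lemma whittaker_fun_tendsto_0: "(whittaker_fun \<kappa> \<theta> s \<longlongrightarrow> 0) at_top"
proof -
  obtain N where N: "Re (s - \<kappa>) - 1 + \<bar>Re (s + \<kappa> - 1)\<bar> \<le> real N" using real_arch_simple by blast
  obtain M where M: "Re s \<le> real M" using real_arch_simple by blast
  define C where "C = (\<integral>t. exp_poly N (2 * \<theta>) t \<partial>lborel)"
  have Jb: "norm (laplace_J (s - \<kappa>) (s + \<kappa> - 1) x) \<le> C" if "x \<ge> 2 * \<theta>" for x
    unfolding laplace_J_def C_def
    using that \<theta> a N
    by (intro order_trans[OF integral_norm_bound integral_mono] integrable_norm
        integrable_laplace_kernel integrable_exp_poly laplace_kernel_bound) auto
  have C: "C \<ge> 0" using Jb[of "2 * \<theta>"] norm_ge_zero order_trans by blast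
  have ev: "\<forall>\<^sub>F t in at_top. norm (whittaker_fun \<kappa> \<theta> s t)
      \<le> (1 + 2 * (real M + 1) / \<theta>) ^ M * C * exp (- (\<theta> / 2) * t)"
    using eventually_ge_at_top[of 1]
  proof eventually_elim
    case (elim t)
    have x2: "2 * \<theta> \<le> 2 * \<theta> * t" using elim \<theta> by simp
    have "norm (whittaker_fun \<kappa> \<theta> s t)
      = t powr Re s * exp (- \<theta> * t) * norm (laplace_J (s - \<kappa>) (s + \<kappa> - 1) (2 * \<theta> * t))"
      using elim by (simp add: whittaker_fun_def norm_mult norm_powr_real_powr)
    also have "\<dots> \<le> (1 + t) ^ M * exp (- \<theta> * t) * C"
    proof (intro mult_mono Jb[OF x2])
      have "t powr Re s \<le> t powr (real M)" using elim M by (intro powr_mono) auto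
      also have "\<dots> \<le> (1 + t) powr (real M)" using elim by (intro powr_mono2) auto
      also have "\<dots> = (1 + t) ^ M" using elim by (simp add: powr_realpow)
      finally show "t powr Re s \<le> (1 + t) ^ M" .
    qed (use elim \<theta> in auto)
    also have "\<dots> \<le> (1 + 2 * (real M + 1) / \<theta>) ^ M * exp (- (\<theta> / 2) * t) * C"
      using elim C by (intro mult_right_mono power_exp_le_exp \<theta>) auto
    finally show ?case by (simp add: mult_ac)
  qed
  have "filterlim (\<lambda>t. - (\<theta> / 2) * t) at_bot at_top"
    using \<theta> by (intro filterlim_tendsto_neg_mult_at_bot[OF tendsto_const] filterlim_ident) auto
  then have "((\<lambda>t. (1 + 2 * (real M + 1) / \<theta>) ^ M * C * exp (- (\<theta> / 2) * t)) \<longlongrightarrow> 0) at_top"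
    by (intro tendsto_mult_right_zero filterlim_compose[OF exp_at_bot])
  with ev show ?thesis by (rule Lim_null_comparison)
qed

lemma whittaker_fun_nonzero: "\<exists>t>0. whittaker_fun \<kappa> \<theta> s t \<noteq> 0"
proof -
  obtain x where x: "x > 0" "laplace_J (s - \<kappa>) (s + \<kappa> - 1) x \<noteq> 0"
    using laplace_J_not_identically_zero[OF a] by blast
  then show ?thesis using \<theta>
    by (intro exI[of _ "x / (2 * \<theta>)"]) (auto simp: whittaker_fun_def)
qed

lemma whittaker_coeff_continuous: "continuous_on {0<..} (whittaker_coeff \<kappa> \<theta> s)"
  unfolding whittaker_coeff_def by (intro continuous_intros) auto

lemma whittaker_coeff_Re_nonneg: "\<exists>t0>0. \<forall>t\<ge>t0. Re (whittaker_coeff \<kappa> \<theta> s t) \<ge> 0"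
proof -
  define A where "A = norm (2 * of_real \<theta> * \<kappa>) + norm (s * (s - 1))"
  have A: "A \<ge> 0" by (simp add: A_def)
  \<comment> \<open>Beyond 1 both variable terms are at most a multiple of \<open>1 / t\<close>,
    with total \<open>A / t\<close>; beyond \<open>A / \<theta>\<^sup>2\<close> this is below the
    constant term \<open>\<theta>\<^sup>2\<close>.\<close>
  define t0 where "t0 = 1 + A / \<theta>\<^sup>2"
  have t0: "t0 \<ge> 1" using A by (simp add: t0_def)
  have "Re (whittaker_coeff \<kappa> \<theta> s t) \<ge> 0" if t: "t \<ge> t0" for t
  proof -
    have t1: "t \<ge> 1" using t t0 by simp
    have "norm (2 * of_real \<theta> * \<kappa> / of_real t - s * (s - 1) / (of_real t)\<^sup>2)
        \<le> norm (2 * of_real \<theta> * \<kappa>) / t + norm (s * (s - 1)) / t\<^sup>2"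
      using t1 by (intro order_trans[OF norm_triangle_ineq4]) (simp add: norm_divide norm_power)
    also have "\<dots> \<le> norm (2 * of_real \<theta> * \<kappa>) / t + norm (s * (s - 1)) / t"
      using t1 by (intro add_left_mono divide_left_mono) (auto simp: power2_eq_square)
    also have "\<dots> = A / t" by (simp add: A_def add_divide_distrib)
    also have "\<dots> \<le> \<theta>\<^sup>2"
    proof -
      have "A / \<theta>\<^sup>2 \<le> t" using t by (simp add: t0_def)
      then show ?thesis using t1 \<theta> by (simp add: field_simps)
    qed
    finally have "Re (2 * of_real \<theta> * \<kappa> / of_real t - s * (s - 1) / (of_real t)\<^sup>2) \<le> \<theta>\<^sup>2"
      using complex_Re_le_cmod order_trans by blast
    moreover have "whittaker_coeff \<kappa> \<theta> s t
        = of_real (\<theta>\<^sup>2) - (2 * of_real \<theta> * \<kappa> / of_real t - s * (s - 1) / (of_real t)\<^sup>2)"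
      by (simp add: whittaker_coeff_def)
    ultimately show ?thesis by (simp only: minus_complex.sel Re_complex_of_real)
  qed
  then show ?thesis using t0 by (intro exI[of _ t0]) auto
qed

text \<open>Matching the values at the single point \<open>t0\<close> suffices: the difference
  decays and vanishes at \<open>t0\<close>, hence is zero. The Whittaker function can be matched
  there because, if it vanished at \<open>t0\<close>, it would itself be identically zero.\<close>

lemma whittaker_fun_unique:
  assumes d1: "\<And>t. t > 0 \<Longrightarrow> (h has_vector_derivative h1 t) (at t)"
    and d2: "\<And>t. t > 0 \<Longrightarrow> (h1 has_vector_derivative whittaker_coeff \<kappa> \<theta> s t * h t) (at t)"
    and lim: "(h \<longlongrightarrow> 0) at_top"
  shows "\<exists>c. \<forall>t>0. h t = c * whittaker_fun \<kappa> \<theta> s t"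
proof -
  let ?W = "whittaker_fun \<kappa> \<theta> s" and ?W' = "whittaker_fun' \<kappa> \<theta> s" and ?q = "whittaker_coeff \<kappa> \<theta> s"
  obtain t0 where t0: "t0 > 0" "\<And>t. t \<ge> t0 \<Longrightarrow> Re (?q t) \<ge> 0"
    using whittaker_coeff_Re_nonneg by blast
  have W0: "?W t0 \<noteq> 0"
  proof
    assume "?W t0 = 0"
    then have "?W t = 0" if "t > 0" for t
      using linear_ode_zero_of_decay[OF whittaker_fun_has_vector_derivative whittaker_fun'_has_vector_derivative
          whittaker_coeff_continuous whittaker_fun_tendsto_0 t0(1) _ t0(2) that] by blast
    then show False using whittaker_fun_nonzero by blast
  qed
  define c where "c = h t0 / ?W t0"
  define G where "G t = h t - c * ?W t" for t
  define G1 where "G1 t = h1 t - c * ?W' t" for t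
  have G0: "G t = 0" if "t > 0" for t
  proof (rule linear_ode_zero_of_decay[of G G1 ?q t0])
    fix t :: real assume t: "t > 0"
    show "(G has_vector_derivative G1 t) (at t)"
      unfolding G_def G1_def
      by (intro has_vector_derivative_diff has_vector_derivative_mult_right d1 t whittaker_fun_has_vector_derivative)
    show "(G1 has_vector_derivative ?q t * G t) (at t)"
      unfolding G_def G1_def
      by (rule has_vector_derivative_eq_rhs[OF has_vector_derivative_diff[OF d2[OF t]
            has_vector_derivative_mult_right[OF whittaker_fun'_has_vector_derivative[OF t]]]])
        (simp add: algebra_simps)
  next
    show "(G \<longlongrightarrow> 0) at_top"
      unfolding G_def using tendsto_diff[OF lim tendsto_mult_left[OF whittaker_fun_tendsto_0, of c]] by simp
  qed (use W0 t0 that whittaker_coeff_continuous in \<open>auto simp: c_def G_def\<close>)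
  show ?thesis using G0 by (intro exI[of _ c]) (simp add: G_def)
qed

end

text \<open>The part of tau that does not depend on \<open>y\<close>. One reciprocal Gamma factor
  comes from tau, the other from the normalisation of U.\<close>

definition tau_factor :: "complex \<Rightarrow> complex \<Rightarrow> complex" where
  "tau_factor \<kappa> s = of_real (2 * pi) powr (2 * s) * exp (- (\<i> * of_real pi * \<kappa>)) * rGamma (s + \<kappa>) * rGamma (s - \<kappa>)"

text \<open>The sign of \<xi> exchanges the roles of \<open>s + p / 2\<close> and
  \<open>s - p / 2\<close>; absorbing it into \<kappa> gives both branches of tau one form. The
  bound on \<open>Re s\<close> keeps \<open>tricomi_U\<close> in the branch given by the
  integral.\<close>

lemma tau_eq_whittaker_fun:
  fixes p :: int and \<xi> y :: real and s :: complex
  defines "\<kappa> \<equiv> of_real (sgn \<xi>) * of_int p / 2"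
  assumes "\<xi> \<noteq> 0" "y > 0" "Re s > \<bar>of_int p / 2\<bar>"
  shows "of_real y powr s * tau (s + of_int p / 2) (s - of_int p / 2) (\<xi> * y)
    = tau_factor \<kappa> s * whittaker_fun \<kappa> (2 * pi * \<bar>\<xi>\<bar>) s y"
proof -
  have R: "Re (s - of_int p / 2) > 0" "Re (s + of_int p / 2) > 0" using assms(4) by auto
  have *: "s + of_int p / 2 + (s - of_int p / 2) = 2 * s" by simp
  show ?thesis
  proof (cases "\<xi> > 0")
    case True
    then have "\<xi> * y > 0" using assms by simp
    then show ?thesis
      using True R unfolding tau_def * \<kappa>_def tricomi_U_def tricomi_integral_eq_laplace_J
      by (simp add: tau_factor_def whittaker_fun_def mult_ac algebra_simps)
  next
    case False
    then have neg: "\<xi> < 0" "\<not> \<xi> * y > 0" using assms by (auto simp: zero_less_mult_iff)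
    show ?thesis
      using neg R assms(3) unfolding tau_def * \<kappa>_def tricomi_U_def tricomi_integral_eq_laplace_J
      by (simp add: tau_factor_def whittaker_fun_def abs_mult mult_ac algebra_simps)
  qed
qed

lemma tau_factor_nonzero:
  assumes "Re (s - \<kappa>) > 0" "Re (s + \<kappa>) > 0"
  shows "tau_factor \<kappa> s \<noteq> 0"
proof -
  have "rGamma z \<noteq> 0" if "Re z > 0" for z :: complex
    using that by (auto simp: rGamma_eq_zero_iff elim!: nonpos_Ints_cases)
  then show ?thesis using assms by (simp add: tau_factor_def)
qed

lemma tau_factor_field_differentiable: "tau_factor \<kappa> field_differentiable (at s)"
  unfolding tau_factor_def
  by (intro field_differentiable_mult field_differentiable_const)
    (auto intro!: holomorphic_on_imp_differentiable_at[of _ UNIV] holomorphic_intros)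

lemma whittaker_fun_field_differentiable:
  assumes "Re (s0 - \<kappa>) > 1" "\<theta> > 0" "t > 0"
  shows "(\<lambda>s. whittaker_fun \<kappa> \<theta> s t) field_differentiable (at s0)"
proof -
  have "(\<lambda>s. laplace_J (s - \<kappa>) (s + \<kappa> - 1) (2 * \<theta> * t)) field_differentiable (at s0)"
    using laplace_J_holomorphic[of s0 "- \<kappa>" "2 * \<theta> * t" "\<kappa> - 1"] assms by (simp add: algebra_simps)
  then show ?thesis
    unfolding whittaker_fun_def
    by (intro field_differentiable_mult field_differentiable_const)
      (use assms(3) in \<open>auto intro!: holomorphic_on_imp_differentiable_at[of _ UNIV] holomorphic_intros\<close>)
qed

section \<open>Partial derivatives of analytic functions and complex linearity off a countable
  set\<close>

lemma has_derivative_partial_fst: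
  fixes f :: "'a::euclidean_space \<times> 'b::euclidean_space \<Rightarrow> complex"
  assumes f: "real_analytic_on f (U \<times> S)" and z: "z \<in> U" and s: "s \<in> S"
  shows "((\<lambda>z. f (z, s)) has_derivative (\<lambda>h. frechet_derivative f (at (z, s)) (h, 0))) (at z)"
proof -
  have "f differentiable (at (z, s))" using real_analytic_on_differentiable[OF f] z s by blast
  then have "(f has_derivative frechet_derivative f (at (z, s))) (at (z, s))"
    by (simp add: frechet_derivative_works)
  then show ?thesis
    by (rule has_derivative_compose[rotated]) (auto intro!: derivative_eq_intros)
qed

lemma frechet_derivative_Basis_sum:
  fixes f :: "'a::euclidean_space \<Rightarrow> 'b::real_normed_vector"
  assumes "f differentiable (at w)"
  shows "frechet_derivative f (at w) h = (\<Sum>b\<in>Basis. (h \<bullet> b) *\<^sub>R frechet_derivative f (at w) b)"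
proof -
  note lin = linear_frechet_derivative[OF assms]
  show ?thesis
    by (subst euclidean_representation[of h, symmetric]) (simp add: linear_sum[OF lin] linear_scale[OF lin])
qed

lemma real_analytic_C1:
  fixes f :: "'a::euclidean_space \<Rightarrow> complex"
  assumes f: "real_analytic_on f X"
  obtains \<Omega> where "open \<Omega>" "X \<subseteq> \<Omega>" "\<And>w. w \<in> \<Omega> \<Longrightarrow> f differentiable (at w)"
    "\<And>h. continuous_on \<Omega> (\<lambda>w. frechet_derivative f (at w) h)"
proof -
  obtain \<Omega>1 where \<Omega>1: "open \<Omega>1" "X \<subseteq> \<Omega>1" "\<And>w. w \<in> \<Omega>1 \<Longrightarrow> f differentiable (at w)"
    using real_analytic_on_differentiable[OF f] by blast
  have "\<exists>\<Omega>. open \<Omega> \<and> X \<subseteq> \<Omega> \<and> (\<forall>w\<in>\<Omega>. (\<lambda>w. frechet_derivative f (at w) b) differentiable (at w))"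
    if "b \<in> Basis" for b
    using real_analytic_on_differentiable[OF real_analytic_on_frechet_derivative[OF f that]] .
  then obtain \<Omega>b where \<Omega>b: "\<And>b. b \<in> Basis \<Longrightarrow> open (\<Omega>b b) \<and> X \<subseteq> \<Omega>b b \<and>
     (\<forall>w\<in>\<Omega>b b. (\<lambda>w. frechet_derivative f (at w) b) differentiable (at w))"
    by metis
  define \<Omega> where "\<Omega> = \<Omega>1 \<inter> (\<Inter>b\<in>Basis. \<Omega>b b)"
  have cb: "continuous_on \<Omega> (\<lambda>w. frechet_derivative f (at w) b)" if "b \<in> Basis" for b
  proof (rule differentiable_imp_continuous_on)
    show "(\<lambda>w. frechet_derivative f (at w) b) differentiable_on \<Omega>"
      unfolding differentiable_on_def using \<Omega>b[OF that] that
      by (auto simp: \<Omega>_def intro: differentiable_at_withinI)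
  qed
  show ?thesis
  proof (rule that)
    show "open \<Omega>" unfolding \<Omega>_def using \<Omega>1(1) \<Omega>b by (intro open_Int open_INT) auto
    show "X \<subseteq> \<Omega>" unfolding \<Omega>_def using \<Omega>1(2) \<Omega>b by auto
    show d: "f differentiable (at w)" if "w \<in> \<Omega>" for w using that \<Omega>1(3) by (auto simp: \<Omega>_def)
    show "continuous_on \<Omega> (\<lambda>w. frechet_derivative f (at w) h)" for h
    proof -
      have "continuous_on \<Omega> (\<lambda>w. \<Sum>b\<in>Basis. (h \<bullet> b) *\<^sub>R frechet_derivative f (at w) b)"
        by (intro continuous_intros cb)
      then show ?thesis
        by (rule continuous_on_eq) (rule frechet_derivative_Basis_sum[OF d, symmetric])
    qed
  qed
qed

text \<open>Each point is singled out by a set from a countable basis, and different points need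
  different sets.\<close>

lemma discrete_imp_countable:
  fixes T :: "'a::second_countable_topology set"
  assumes "discrete T"
  shows "countable T"
proof -
  obtain B :: "'a set set" where B: "countable B" "topological_basis B" using ex_countable_basis by blast
  have "\<exists>V\<in>B. V \<inter> T = {x}" if x: "x \<in> T" for x
  proof -
    obtain U where U: "open U" "U \<inter> T = {x}" using assms x unfolding discrete_def isolated_in_def by blast
    then obtain V where "V \<in> B" "x \<in> V" "V \<subseteq> U" using topological_basisE[OF B(2) U(1), of x] by blast
    then show ?thesis using U that by blast
  qed
  then obtain v where v: "\<And>x. x \<in> T \<Longrightarrow> v x \<in> B \<and> v x \<inter> T = {x}" by metis
  have "inj_on v T"
  proof (rule inj_onI)
    fix x y assume x: "x \<in> T" and y: "y \<in> T" and eq: "v x = v y"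
    have "{x} = v x \<inter> T" using v[OF x] by (simp only:)
    also have "\<dots> = {y}" unfolding eq using v[OF y] by (simp only:)
    finally show "x = y" by simp
  qed
  moreover have "v ` T \<subseteq> B" using v by blast
  ultimately show ?thesis using countable_subset[OF _ B(1)] by (intro countable_image_inj_on[of v T]) auto
qed

text \<open>Two derivatives within a set agree as soon as every coordinate direction contains points
  of the set arbitrarily close to the base point. A countable \<open>T\<close> cannot swallow a
  whole segment, so this holds although the set may fail to be open.\<close>

lemma complex_linear_derivative:
  fixes g :: "complex \<Rightarrow> complex"
  assumes T: "countable T" and s0: "s0 \<in> half_plane a - T"
    and der: "(g has_derivative g') (at s0)"
    and holo: "g field_differentiable (at s0 within half_plane a - T)"
  shows "g' h = h * g' 1"
proof -
  obtain d where d: "(g has_derivative (*) d) (at s0 within half_plane a - T)"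
    using holo by (auto simp: field_differentiable_def has_field_derivative_def)
  have "g' = (*) d"
  proof (rule frechet_derivative_unique_within[OF has_derivative_at_withinI[OF der] d])
    fix i :: complex and e :: real assume i: "i \<in> Basis" and e: "e > 0"
    \<comment> \<open>Steps shorter than \<open>Re s0 - a\<close> do not leave the half
      plane.\<close>
    define m where "m = min e (Re s0 - a)"
    have m: "m > 0" using e s0 by (simp add: m_def half_plane_def)
    have "countable {t. s0 + t *\<^sub>R i \<in> T}"
    proof (rule countable_image_inj_on)
      show "countable ((\<lambda>t. s0 + t *\<^sub>R i) ` {t. s0 + t *\<^sub>R i \<in> T})"
        by (rule countable_subset[OF _ T]) auto
      show "inj_on (\<lambda>t. s0 + t *\<^sub>R i) {t. s0 + t *\<^sub>R i \<in> T}"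
        using i nonzero_Basis by (intro inj_onI) auto
    qed
    then have "\<not> {0<..<m} \<subseteq> {t. s0 + t *\<^sub>R i \<in> T}"
      using uncountable_open_interval[of 0 m] m countable_subset by blast
    then obtain t where "t \<in> {0<..<m}" and tT: "s0 + t *\<^sub>R i \<notin> T" by blast
    then have t: "0 < t" "t < m" by auto
    have "Re (s0 + t *\<^sub>R i) > a"
      using t i m by (auto simp: Basis_complex_def m_def)
    then show "\<exists>d. 0 < \<bar>d\<bar> \<and> \<bar>d\<bar> < e \<and> s0 + d *\<^sub>R i \<in> half_plane a - T"
      using t tT by (intro exI[of _ t]) (auto simp: m_def half_plane_def)
  qed
  then show ?thesis by simp
qed

section \<open>Fourier coefficients\<close>

lemma Tr_mult_eq_inner: "Tr (\<xi> * x) = \<xi> \<bullet> x"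
  by (simp add: Tr_def inner_vec_def)

definition fourier_char :: "real ^ 'n \<Rightarrow> real ^ 'n \<Rightarrow> complex" where
  "fourier_char \<xi> x = exp (- 2 * of_real pi * \<i> * of_real (\<xi> \<bullet> x))"

definition fourier_integral :: "(real ^ 'n) set \<Rightarrow> (complex ^ 'n \<Rightarrow> complex) \<Rightarrow> real ^ 'n \<Rightarrow> real ^ 'n \<Rightarrow> complex" where
  "fourier_integral L \<psi> \<xi> y = (LINT x:fundamental_domain L|lborel. \<psi> (Complex_vec x y) * fourier_char \<xi> x)"

definition vec_upd :: "real ^ 'n \<Rightarrow> 'n \<Rightarrow> real \<Rightarrow> real ^ 'n" where
  "vec_upd y j t = (\<chi> i. if i = j then t else y $ i)"

lemma vec_upd_nth [simp]: "vec_upd y j t $ i = (if i = j then t else y $ i)"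
  by (simp add: vec_upd_def)

lemma Complex_vec_nth [simp]: "Complex_vec x y $ j = Complex (x $ j) (y $ j)"
  by (simp add: Complex_vec_def)

lemma Complex_vec_mem_upper [simp]: "Complex_vec x y \<in> upper_half_space \<longleftrightarrow> (\<forall>j. y $ j > 0)"
  by (simp add: upper_half_space_def)

lemma Im_vec_Complex_vec [simp]: "Im_vec (Complex_vec x y) = y"
  by (simp add: Im_vec_def vec_eq_iff)

lemma Complex_vec_add_real: "Complex_vec x y + Complex_vec h 0 = Complex_vec (x + h) y"
  by (simp add: vec_eq_iff complex_eq_iff)

lemma Complex_vec_axis: "Complex_vec (axis j 1) 0 = axis j 1"
  by (simp add: vec_eq_iff complex_eq_iff axis_def)

lemma Complex_vec_upd: "Complex_vec x (vec_upd y j t) = Complex_vec x 0 + (Complex_vec 0 (vec_upd y j 0) + t *\<^sub>R axis j \<i>)"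
  by (simp add: vec_eq_iff complex_eq_iff axis_def)

lemma Complex_vec_real_linear: "bounded_linear (\<lambda>h::real ^ 'n. Complex_vec h 0)"
proof -
  have "linear (\<lambda>h::real ^ 'n. Complex_vec h 0)"
    by (rule linearI) (simp_all add: vec_eq_iff complex_eq_iff)
  then show ?thesis by (rule linear_conv_bounded_linear[THEN iffD1])
qed

lemma Complex_vec_has_derivative:
  "((\<lambda>x. Complex_vec x y) has_derivative (\<lambda>h. Complex_vec h 0)) (at x)"
proof -
  have "((\<lambda>x. Complex_vec 0 y + Complex_vec x 0) has_derivative (\<lambda>h. 0 + Complex_vec h 0)) (at x)"
    by (intro has_derivative_add has_derivative_const bounded_linear_imp_has_derivative Complex_vec_real_linear)
  then show ?thesis by (simp add: Complex_vec_add_real)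
qed

lemma Complex_vec_continuous: "continuous_on A (\<lambda>x. Complex_vec x y)"
  by (rule has_derivative_continuous_on[OF has_derivative_at_withinI[OF Complex_vec_has_derivative]])

lemma norm_fourier_char [simp]: "norm (fourier_char \<xi> x) = 1"
proof -
  have "fourier_char \<xi> x = exp (\<i> * of_real (- 2 * pi * (\<xi> \<bullet> x)))" by (simp add: fourier_char_def mult_ac)
  then show ?thesis by (simp only: norm_exp_i_times)
qed

lemma fourier_char_has_derivative:
  "(fourier_char \<xi> has_derivative (\<lambda>h. - 2 * of_real pi * \<i> * of_real (\<xi> \<bullet> h) * fourier_char \<xi> x)) (at x)"
proof -
  have "((\<lambda>x. exp (- 2 * of_real pi * \<i> * of_real (\<xi> \<bullet> x))) has_derivative
      (\<lambda>h. exp (- 2 * of_real pi * \<i> * of_real (\<xi> \<bullet> x)) * (- 2 * of_real pi * \<i> * of_real (\<xi> \<bullet> h)))) (at x)"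
    by (rule has_derivative_compose[of "\<lambda>x. - 2 * of_real pi * \<i> * of_real (\<xi> \<bullet> x)" _ x UNIV exp])
      (auto intro!: derivative_eq_intros DERIV_exp[unfolded has_field_derivative_def])
  then show ?thesis by (simp add: fourier_char_def[abs_def] mult.commute)
qed

lemma fourier_char_continuous: "continuous_on A (fourier_char \<xi>)"
  by (rule has_derivative_continuous_on[OF has_derivative_at_withinI[OF fourier_char_has_derivative]])

lemma fourier_char_periodic:
  assumes "\<xi> \<in> dual_lattice L" "l \<in> L"
  shows "fourier_char \<xi> (x + l) = fourier_char \<xi> x"
proof -
  have "\<xi> \<bullet> l \<in> \<int>" using assms by (simp add: dual_lattice_def Tr_mult_eq_inner)
  then obtain n where n: "\<xi> \<bullet> l = of_int n" by (auto elim: Ints_cases)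
  have "fourier_char \<xi> (x + l) = fourier_char \<xi> x * exp (2 * of_real pi * of_int (- n) * \<i>)"
    unfolding fourier_char_def by (simp add: inner_add_right n algebra_simps flip: exp_add)
  also have "exp (2 * of_real pi * of_int (- n) * \<i>) = 1"
    using exp_integer_2pi[of "of_int (- n)"] by (simp add: mult_ac)
  finally show ?thesis by simp
qed

text \<open>The derivative is an explicit argument, so that a directional derivative of \<psi> can
  again serve as the function whose Fourier integral is differentiated.\<close>

definition C1_upper :: "(complex ^ 'n \<Rightarrow> complex) \<Rightarrow> (complex ^ 'n \<Rightarrow> complex ^ 'n \<Rightarrow> complex) \<Rightarrow> bool" where
  "C1_upper \<psi> \<psi>' \<longleftrightarrow> (\<forall>z\<in>upper_half_space. (\<psi> has_derivative \<psi>' z) (at z)) \<and>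
     (\<forall>h. continuous_on upper_half_space (\<lambda>z. \<psi>' z h))"

lemma C1_upper_continuous: "C1_upper \<psi> \<psi>' \<Longrightarrow> continuous_on upper_half_space \<psi>"
  unfolding C1_upper_def
  by (rule has_derivative_continuous_on[OF has_derivative_at_withinI]) blast

lemma fourier_integrand_continuous:
  assumes "continuous_on upper_half_space \<psi>" "\<And>i. y $ i > 0"
  shows "continuous_on UNIV (\<lambda>x. \<psi> (Complex_vec x y) * fourier_char \<xi> x)"
  using assms(2)
  by (intro continuous_intros fourier_char_continuous continuous_on_compose2[OF assms(1) Complex_vec_continuous]) auto

lemma fourier_integrand_integrable:
  assumes "is_lattice L" "continuous_on upper_half_space \<psi>" "\<And>i. y $ i > 0"
  shows "set_integrable lborel (fundamental_domain L) (\<lambda>x. \<psi> (Complex_vec x y) * fourier_char \<xi> x)"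
  using fourier_integrand_continuous[OF assms(2,3)] fundamental_domain_properties[OF assms(1)]
  by (intro set_integrable_continuous_bounded) (auto intro: continuous_on_subset)

lemma fourier_integral_has_vector_derivative:
  fixes L :: "(real ^ 'n) set"
  assumes L: "is_lattice L" and C1: "C1_upper \<psi> \<psi>'"
    and y: "\<And>i. i \<noteq> j \<Longrightarrow> y $ i > 0" and t: "t > 0"
  shows "((\<lambda>t. fourier_integral L \<psi> \<xi> (vec_upd y j t)) has_vector_derivative
    fourier_integral L (\<lambda>z. \<psi>' z (axis j \<i>)) \<xi> (vec_upd y j t)) (at t)"
proof -
  let ?D = "fundamental_domain L"
  note D = fundamental_domain_properties[OF L]
  define Z where "Z x \<tau> = Complex_vec x (vec_upd y j \<tau>)" for x \<tau>
  define z0 where "z0 = Complex_vec 0 (vec_upd y j 0)"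
  have Zeq: "Z = (\<lambda>x \<tau>. Complex_vec x 0 + (z0 + \<tau> *\<^sub>R axis j \<i>))"
    by (rule ext, rule ext, unfold Z_def z0_def, rule Complex_vec_upd)
  have Zu: "Z x \<tau> \<in> upper_half_space" if "\<tau> > 0" for x \<tau> using that y by (simp add: Z_def)
  have contd: "continuous_on upper_half_space (\<lambda>z. \<psi>' z (axis j \<i>))" using C1 by (simp add: C1_upper_def)
  \<comment> \<open>Radius \<open>t / 2\<close> keeps the j-th height at least \<open>t / 2\<close>,
    so this compact set lies in the upper half space and bounds the derivative uniformly.\<close>
  define K where "K = (\<lambda>(x, \<tau>). Z x \<tau>) ` (closure ?D \<times> cball t (t / 2))"
  have "compact K"
    unfolding K_def Zeq case_prod_unfold
    using D(2) by (intro compact_continuous_image compact_Times)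
      (auto intro!: continuous_intros bounded_linear.continuous_on[OF Complex_vec_real_linear])
  moreover have Kpos: "\<tau> > 0" if "\<tau> \<in> cball t (t / 2)" for \<tau>
    using that t abs_ge_self[of "t - \<tau>"] by (simp add: dist_real_def)
  moreover have "K \<subseteq> upper_half_space" using Zu Kpos by (auto simp: K_def)
  ultimately have "compact ((\<lambda>z. \<psi>' z (axis j \<i>)) ` K)"
    using contd by (intro compact_continuous_image) (auto intro: continuous_on_subset)
  then obtain B where "\<forall>v\<in>(\<lambda>z. \<psi>' z (axis j \<i>)) ` K. norm v \<le> B"
    using compact_imp_bounded bounded_iff by metis
  then have B: "norm (\<psi>' (Z x \<tau>) (axis j \<i>)) \<le> B" if "x \<in> ?D" "\<tau> \<in> cball t (t / 2)" for x \<tau>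
    using that closure_subset[of ?D] by (fastforce simp: K_def)
  have "((\<lambda>\<tau>. \<integral>x. indicator ?D x *\<^sub>R (\<psi> (Z x \<tau>) * fourier_char \<xi> x) \<partial>lborel) has_derivative
      (\<lambda>h. \<integral>x. h *\<^sub>R (indicator ?D x *\<^sub>R (\<psi>' (Z x t) (axis j \<i>) * fourier_char \<xi> x)) \<partial>lborel)) (at t)"
  proof (rule has_derivative_integral_dominated[where r = "t / 2" and g = "\<lambda>x. indicator ?D x * B"])
    fix \<tau> x h assume \<tau>: "\<tau> \<in> ball t (t / 2)"
    then have \<tau>c: "\<tau> \<in> cball t (t / 2)" and pos: "\<tau> > 0" using Kpos by auto
    have "((\<lambda>\<tau>. Z x \<tau>) has_derivative (\<lambda>h. h *\<^sub>R axis j \<i>)) (at \<tau>)"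
      unfolding Zeq by (auto intro!: derivative_eq_intros)
    moreover have d: "(\<psi> has_derivative \<psi>' (Z x \<tau>)) (at (Z x \<tau>))" using C1 Zu[OF pos] by (simp add: C1_upper_def)
    ultimately have "((\<lambda>\<tau>. \<psi> (Z x \<tau>)) has_derivative (\<lambda>h. \<psi>' (Z x \<tau>) (h *\<^sub>R axis j \<i>))) (at \<tau>)"
      by (rule has_derivative_compose)
    then have "((\<lambda>\<tau>. \<psi> (Z x \<tau>)) has_vector_derivative \<psi>' (Z x \<tau>) (axis j \<i>)) (at \<tau>)"
      unfolding has_vector_derivative_def linear_scale[OF has_derivative_linear[OF d]] .
    then have "((\<lambda>\<tau>. indicator ?D x *\<^sub>R (\<psi> (Z x \<tau>) * fourier_char \<xi> x)) has_vector_derivative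
       indicator ?D x *\<^sub>R (\<psi>' (Z x \<tau>) (axis j \<i>) * fourier_char \<xi> x)) (at \<tau>)"
      by (intro bounded_linear.has_vector_derivative[OF bounded_linear_scaleR_right] has_vector_derivative_mult_left)
    then show "((\<lambda>\<tau>. indicator ?D x *\<^sub>R (\<psi> (Z x \<tau>) * fourier_char \<xi> x)) has_derivative
       (\<lambda>h. h *\<^sub>R (indicator ?D x *\<^sub>R (\<psi>' (Z x \<tau>) (axis j \<i>) * fourier_char \<xi> x)))) (at \<tau>)"
      by (simp add: has_vector_derivative_def)
    show "norm (h *\<^sub>R (indicator ?D x *\<^sub>R (\<psi>' (Z x \<tau>) (axis j \<i>) * fourier_char \<xi> x))) \<le> indicator ?D x * B * norm h"
      using mult_right_mono[OF B[OF _ \<tau>c, of x], of "\<bar>h\<bar>"] by (cases "x \<in> ?D") (simp_all add: norm_mult mult.commute)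
    show "integrable lborel (\<lambda>x. indicator ?D x *\<^sub>R (\<psi> (Z x \<tau>) * fourier_char \<xi> x))"
      using fourier_integrand_integrable[OF L C1_upper_continuous[OF C1], of "vec_upd y j \<tau>" \<xi>] pos y
      by (simp add: set_integrable_def Z_def)
  next
    show "integrable lborel (\<lambda>x. indicator ?D x * B)"
      using D(1) emeasure_bounded_finite[OF D(2)] by (intro integrable_mult_left integrable_real_indicator) auto
    show "(\<lambda>x. h *\<^sub>R (indicator ?D x *\<^sub>R (\<psi>' (Z x t) (axis j \<i>) * fourier_char \<xi> x))) \<in> borel_measurable lborel" for h :: real
    proof -
      have "integrable lborel (\<lambda>x. indicator ?D x *\<^sub>R (\<psi>' (Z x t) (axis j \<i>) * fourier_char \<xi> x))"
        using fourier_integrand_integrable[OF L contd, of "vec_upd y j t" \<xi>] t y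
        by (simp add: set_integrable_def Z_def)
      then show ?thesis by (intro borel_measurable_scaleR borel_measurable_const borel_measurable_integrable)
    qed
  qed (use t in simp)
  then show ?thesis
    unfolding integral_scaleR_right has_vector_derivative_def fourier_integral_def set_lebesgue_integral_def Z_def .
qed

text \<open>The product of \<psi> and the character is periodic, so its derivative in direction
  \<open>v\<close> integrates to zero; the product rule moves the derivative to the
  character.\<close>

lemma fourier_integral_real_direction:
  fixes L :: "(real ^ 'n) set"
  assumes L: "is_lattice L" and C1: "C1_upper \<psi> \<psi>'"
    and per: "\<And>z l. z \<in> upper_half_space \<Longrightarrow> l \<in> L \<Longrightarrow> \<psi> (z + Complex_vec l 0) = \<psi> z"
    and \<xi>: "\<xi> \<in> dual_lattice L" and y: "\<And>i. y $ i > 0"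
  shows "fourier_integral L (\<lambda>z. \<psi>' z (Complex_vec v 0)) \<xi> y
    = 2 * of_real pi * \<i> * of_real (\<xi> \<bullet> v) * fourier_integral L \<psi> \<xi> y"
proof -
  let ?D = "fundamental_domain L"
  define G where "G x = \<psi> (Complex_vec x y) * fourier_char \<xi> x" for x
  define G' where "G' x h = \<psi> (Complex_vec x y) * (- 2 * of_real pi * \<i> * of_real (\<xi> \<bullet> h) * fourier_char \<xi> x)
     + \<psi>' (Complex_vec x y) (Complex_vec h 0) * fourier_char \<xi> x" for x h
  note cont = fourier_integrand_continuous[OF _ y]
  have contd: "continuous_on upper_half_space (\<lambda>z. \<psi>' z (Complex_vec h 0))" for h
    using C1 by (simp add: C1_upper_def)
  have "(LINT x:?D|lborel. G' x v) = 0"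
  proof (rule integral_fundamental_domain_derivative_eq_0[OF L])
    show "G (x + l) = G x" if "l \<in> L" for x l
      using per[of "Complex_vec x y" l] that y
      by (simp add: G_def fourier_char_periodic[OF \<xi>] Complex_vec_add_real)
    show "(G has_derivative G' x) (at x)" for x
      unfolding G_def G'_def
    proof (rule has_derivative_mult[OF _ fourier_char_has_derivative])
      show "((\<lambda>x. \<psi> (Complex_vec x y)) has_derivative (\<lambda>h. \<psi>' (Complex_vec x y) (Complex_vec h 0))) (at x)"
        by (rule has_derivative_compose[OF Complex_vec_has_derivative]) (use C1 y in \<open>simp add: C1_upper_def\<close>)
    qed
    show "continuous_on UNIV (\<lambda>x. G' x i)" for i
    proof -
      have "continuous_on UNIV (\<lambda>x. (- 2 * of_real pi * \<i> * of_real (\<xi> \<bullet> i)) * (\<psi> (Complex_vec x y) * fourier_char \<xi> x)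
        + \<psi>' (Complex_vec x y) (Complex_vec i 0) * fourier_char \<xi> x)"
        by (intro continuous_on_add continuous_on_mult continuous_on_const cont contd C1_upper_continuous[OF C1])
      then show ?thesis by (simp add: G'_def mult_ac)
    qed
  qed
  also have "(\<lambda>x. G' x v) = (\<lambda>x. \<psi>' (Complex_vec x y) (Complex_vec v 0) * fourier_char \<xi> x
      - (2 * of_real pi * \<i> * of_real (\<xi> \<bullet> v)) * (\<psi> (Complex_vec x y) * fourier_char \<xi> x))"
    by (simp add: G'_def fun_eq_iff algebra_simps)
  also have "(LINT x:?D|lborel. \<dots> x) = fourier_integral L (\<lambda>z. \<psi>' z (Complex_vec v 0)) \<xi> y
     - 2 * of_real pi * \<i> * of_real (\<xi> \<bullet> v) * fourier_integral L \<psi> \<xi> y"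
    unfolding fourier_integral_def
    using fourier_integrand_integrable[OF L contd y, of v \<xi>] fourier_integrand_integrable[OF L C1_upper_continuous[OF C1] y, of \<xi>]
    by (subst set_integral_diff) auto
  finally show ?thesis by simp
qed

lemma C1_upper_const: "C1_upper (\<lambda>z. c) (\<lambda>z h. 0)"
  by (simp add: C1_upper_def)

text \<open>Differentiating the constant in direction \<xi> gives zero on one side and the nonzero
  factor \<open>\<xi> \<bullet> \<xi>\<close> on the other. This removes the term with
  \<open>phi1\<close> from every coefficient with \<xi> nonzero.\<close>

lemma fourier_integral_const:
  assumes "is_lattice L" "\<xi> \<in> dual_lattice L" "\<xi> \<noteq> 0" "\<And>i. y $ i > 0"
  shows "fourier_integral L (\<lambda>z. c) \<xi> y = 0"
  using fourier_integral_real_direction[OF assms(1) C1_upper_const, where v = \<xi> and \<xi> = \<xi> and y = y] assms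
  by (simp add: fourier_integral_def)

lemma fourier_coeff_eq_fourier_integral:
  "fourier_coeff L F \<xi> y s = fourier_integral L (\<lambda>z. F z s) \<xi> y / of_real (measure lborel (fundamental_domain L))"
  by (simp add: fourier_coeff_def fourier_integral_def fourier_char_def Tr_mult_eq_inner)

lemma open_upper_half_space: "open (upper_half_space :: (complex ^ 'n) set)"
proof -
  have eq: "upper_half_space = (\<Inter>j. {z :: complex ^ 'n. 0 < Im (z $ j)})"
    by (auto simp: upper_half_space_def)
  show ?thesis
    unfolding eq by (intro open_INT finite ballI open_Collect_less) (auto intro!: continuous_intros)
qed

lemma upper_half_space_add_real: "z \<in> upper_half_space \<Longrightarrow> z + Complex_vec l 0 \<in> upper_half_space"
  by (simp add: upper_half_space_def)

lemma C1_upper_real_analytic: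
  fixes f :: "(complex ^ 'n) \<times> complex \<Rightarrow> complex"
  assumes f: "real_analytic_on f (upper_half_space \<times> S)" and s: "s \<in> S"
  shows "C1_upper (\<lambda>z. f (z, s)) (\<lambda>z h. frechet_derivative f (at (z, s)) (h, 0))"
proof -
  obtain \<Omega> where \<Omega>: "upper_half_space \<times> S \<subseteq> \<Omega>" "\<And>h. continuous_on \<Omega> (\<lambda>w. frechet_derivative f (at w) h)"
    by (rule real_analytic_C1[OF f]) blast
  have "continuous_on upper_half_space (\<lambda>z. frechet_derivative f (at (z, s)) (h, 0))" for h
    by (rule continuous_on_compose2[OF \<Omega>(2)]) (use \<Omega>(1) s in \<open>auto intro!: continuous_intros\<close>)
  then show ?thesis using has_derivative_partial_fst[OF f _ s] by (simp add: C1_upper_def)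
qed

text \<open>The function \<open>g\<close> may differ from \<psi> outside the upper half space: for
  an iterated partial derivative \<open>g\<close> is the inner one, whose values are known only
  there.\<close>

lemma C1_upper_line_derivative:
  assumes C1: "C1_upper \<psi> \<psi>'" and z: "z \<in> upper_half_space"
    and g: "\<And>w. w \<in> upper_half_space \<Longrightarrow> g w = \<psi> w"
  shows "vector_derivative (\<lambda>t::real. g (z + t *\<^sub>R v)) (at 0) = \<psi>' z v"
proof -
  have d: "(\<psi> has_derivative \<psi>' z) (at z)" using C1 z by (simp add: C1_upper_def)
  have "(g has_derivative \<psi>' z) (at z)"
    by (rule has_derivative_transform_within_open[OF d open_upper_half_space z]) (rule g[symmetric])
  then have "(g has_derivative \<psi>' z) (at (z + 0 *\<^sub>R v))" by simp
  then have "((\<lambda>t::real. g (z + t *\<^sub>R v)) has_derivative (\<lambda>t. \<psi>' z (t *\<^sub>R v))) (at 0)"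
    by (rule has_derivative_compose[rotated]) (auto intro!: derivative_eq_intros)
  then have "((\<lambda>t::real. g (z + t *\<^sub>R v)) has_vector_derivative \<psi>' z v) (at 0)"
    unfolding has_vector_derivative_def linear_scale[OF has_derivative_linear[OF d]] .
  then show ?thesis by (rule vector_derivative_at)
qed

lemma C1_upper_periodic:
  assumes C1: "C1_upper \<psi> \<psi>'"
    and per: "\<And>z l. z \<in> upper_half_space \<Longrightarrow> l \<in> L \<Longrightarrow> \<psi> (z + Complex_vec l 0) = \<psi> z"
    and z: "z \<in> upper_half_space" and l: "l \<in> L"
  shows "\<psi>' (z + Complex_vec l 0) h = \<psi>' z h"
proof -
  have "(\<psi> has_derivative \<psi>' (z + Complex_vec l 0)) (at (z + Complex_vec l 0))"
    using C1 upper_half_space_add_real[OF z] by (simp add: C1_upper_def)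
  then have "((\<lambda>z. \<psi> (z + Complex_vec l 0)) has_derivative \<psi>' (z + Complex_vec l 0)) (at z)"
    by (rule has_derivative_compose[rotated]) (auto intro!: derivative_eq_intros)
  then have d1: "(\<psi> has_derivative \<psi>' (z + Complex_vec l 0)) (at z)"
    by (rule has_derivative_transform_within_open[OF _ open_upper_half_space z]) (use per l in auto)
  have d2: "(\<psi> has_derivative \<psi>' z) (at z)" using C1 z by (simp add: C1_upper_def)
  show ?thesis unfolding has_derivative_unique[OF d1 d2] ..
qed

text \<open>The identity is required only at the fixed height \<open>y\<close>, because the
  coefficients supplied by the Laplacian depend on the height.\<close>

lemma fourier_integral_linear_combination:
  assumes L: "is_lattice L" and y: "\<And>i. y $ i > 0"
    and c: "continuous_on upper_half_space \<psi>1" "continuous_on upper_half_space \<psi>2" "continuous_on upper_half_space \<psi>3"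
    and eq: "\<And>x. \<psi> (Complex_vec x y) = a * \<psi>1 (Complex_vec x y) + b * \<psi>2 (Complex_vec x y) + d * \<psi>3 (Complex_vec x y)"
  shows "fourier_integral L \<psi> \<xi> y = a * fourier_integral L \<psi>1 \<xi> y + b * fourier_integral L \<psi>2 \<xi> y
    + d * fourier_integral L \<psi>3 \<xi> y"
proof -
  note i = fourier_integrand_integrable[OF L c(1) y, of \<xi>] fourier_integrand_integrable[OF L c(2) y, of \<xi>]
    fourier_integrand_integrable[OF L c(3) y, of \<xi>]
  have "fourier_integral L \<psi> \<xi> y = (LINT x:fundamental_domain L|lborel.
      (a * (\<psi>1 (Complex_vec x y) * fourier_char \<xi> x) + b * (\<psi>2 (Complex_vec x y) * fourier_char \<xi> x))
      + d * (\<psi>3 (Complex_vec x y) * fourier_char \<xi> x))"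
    unfolding fourier_integral_def eq by (simp add: algebra_simps)
  also have "\<dots> = a * fourier_integral L \<psi>1 \<xi> y + b * fourier_integral L \<psi>2 \<xi> y + d * fourier_integral L \<psi>3 \<xi> y"
    unfolding fourier_integral_def using i
    by (subst set_integral_add, simp, simp, subst set_integral_add) auto
  finally show ?thesis .
qed

text \<open>Solving the eigenvalue equation for the second derivative in \<open>y_j\<close> and
  taking Fourier integrals replaces each derivative in \<open>x_j\<close> by the factor
  \<open>2 * pi * \<i> * \<xi>_j\<close>. The term of first order becomes the one with \<kappa>
  because \<open>\<bar>\<xi>_j\<bar> * sgn \<xi>_j = \<xi>_j\<close>. The case
  \<open>\<xi>_j = 0\<close> is included and serves the constant term.\<close>

lemma fourier_integral_ode:
  fixes F :: "complex ^ 'n \<Rightarrow> complex \<Rightarrow> complex" and L :: "(real ^ 'n) set"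
  assumes analytic: "real_analytic_on (\<lambda>(z, s). F z s) (upper_half_space \<times> S)" and s: "s \<in> S"
    and L: "is_lattice L"
    and per: "\<And>z l. z \<in> upper_half_space \<Longrightarrow> l \<in> L \<Longrightarrow> F (z + Complex_vec l 0) s = F z s"
    and eigen: "\<And>z. z \<in> upper_half_space \<Longrightarrow> Laplacian j p (\<lambda>w. F w s) z = s * (1 - s) * F z s"
    and \<xi>: "\<xi> \<in> dual_lattice L" and y: "\<And>i. i \<noteq> j \<Longrightarrow> y $ i > 0"
  shows "\<exists>A1. \<forall>t>0. ((\<lambda>t. fourier_integral L (\<lambda>z. F z s) \<xi> (vec_upd y j t)) has_vector_derivative A1 t) (at t)
     \<and> (A1 has_vector_derivative
         whittaker_coeff (of_real (sgn (\<xi> $ j)) * of_int p / 2) (2 * pi * \<bar>\<xi> $ j\<bar>) s t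
           * fourier_integral L (\<lambda>z. F z s) \<xi> (vec_upd y j t)) (at t)"
proof -
  define f where "f = (\<lambda>(z, s). F z s)"
  have f: "real_analytic_on f (upper_half_space \<times> S)" using analytic by (simp add: f_def)
  have B: "(axis j 1 :: complex ^ 'n, 0 :: complex) \<in> Basis" "(axis j \<i> :: complex ^ 'n, 0 :: complex) \<in> Basis"
    by (auto simp: Basis_prod_def Basis_vec_def Basis_complex_def)
  define \<phi> where "\<phi> = (\<lambda>z. F z s)"
  define \<phi>' where "\<phi>' z h = frechet_derivative f (at (z, s)) (h, 0)" for z h
  define fx where "fx w = frechet_derivative f (at w) (axis j 1, 0)" for w
  define fy where "fy w = frechet_derivative f (at w) (axis j \<i>, 0)" for w
  define \<phi>x' where "\<phi>x' z h = frechet_derivative fx (at (z, s)) (h, 0)" for z h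
  define \<phi>y' where "\<phi>y' z h = frechet_derivative fy (at (z, s)) (h, 0)" for z h
  have C: "C1_upper \<phi> \<phi>'"
    using C1_upper_real_analytic[OF f s] by (simp add: \<phi>_def \<phi>'_def[abs_def] f_def)
  have Cx: "C1_upper (\<lambda>z. \<phi>' z (axis j 1)) \<phi>x'"
    using C1_upper_real_analytic[OF real_analytic_on_frechet_derivative[OF f B(1)] s]
    by (simp add: \<phi>'_def \<phi>x'_def[abs_def] fx_def[abs_def])
  have Cy: "C1_upper (\<lambda>z. \<phi>' z (axis j \<i>)) \<phi>y'"
    using C1_upper_real_analytic[OF real_analytic_on_frechet_derivative[OF f B(2)] s]
    by (simp add: \<phi>'_def \<phi>y'_def[abs_def] fy_def[abs_def])
  have per\<phi>: "\<phi> (z + Complex_vec l 0) = \<phi> z" if "z \<in> upper_half_space" "l \<in> L" for z l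
    using per that by (simp add: \<phi>_def)
  have perx: "\<phi>' (z + Complex_vec l 0) (axis j 1) = \<phi>' z (axis j 1)" if "z \<in> upper_half_space" "l \<in> L" for z l
    using C1_upper_periodic[OF C per\<phi> that] by blast
  have px: "partial_x j \<phi> z = \<phi>' z (axis j 1)" if "z \<in> upper_half_space" for z
    unfolding partial_x_def using C1_upper_line_derivative[OF C that refl] .
  have py: "partial_y j \<phi> z = \<phi>' z (axis j \<i>)" if "z \<in> upper_half_space" for z
    unfolding partial_y_def using C1_upper_line_derivative[OF C that refl] .
  have pxx: "partial_x j (partial_x j \<phi>) z = \<phi>x' z (axis j 1)" if "z \<in> upper_half_space" for z
    unfolding partial_x_def[of j "partial_x j \<phi>"] using C1_upper_line_derivative[OF Cx that px] .
  have pyy: "partial_y j (partial_y j \<phi>) z = \<phi>y' z (axis j \<i>)" if "z \<in> upper_half_space" for z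
    unfolding partial_y_def[of j "partial_y j \<phi>"] using C1_upper_line_derivative[OF Cy that py] .
  define A where "A t = fourier_integral L \<phi> \<xi> (vec_upd y j t)" for t
  define A1 where "A1 t = fourier_integral L (\<lambda>z. \<phi>' z (axis j \<i>)) \<xi> (vec_upd y j t)" for t
  have "(A has_vector_derivative A1 t) (at t) \<and>
    (A1 has_vector_derivative whittaker_coeff (of_real (sgn (\<xi> $ j)) * of_int p / 2) (2 * pi * \<bar>\<xi> $ j\<bar>) s t * A t) (at t)"
    if t: "t > 0" for t
  proof
    show "(A has_vector_derivative A1 t) (at t)"
      unfolding A_def A1_def by (rule fourier_integral_has_vector_derivative[OF L C y t])
    let ?y = "vec_upd y j t"
    have ypos: "?y $ i > 0" for i using y t by simp
    define c where "c = 2 * of_real pi * \<i> * complex_of_real (\<xi> $ j)"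
    have inn: "\<xi> \<bullet> axis j 1 = \<xi> $ j" by (simp add: inner_axis)
    have Ix: "fourier_integral L (\<lambda>z. \<phi>' z (axis j 1)) \<xi> ?y = c * A t"
      using fourier_integral_real_direction[OF L C per\<phi> \<xi> ypos, of "axis j 1"]
      by (simp add: Complex_vec_axis inn c_def A_def)
    have Ixx: "fourier_integral L (\<lambda>z. \<phi>x' z (axis j 1)) \<xi> ?y = c * (c * A t)"
      using fourier_integral_real_direction[OF L Cx perx \<xi> ypos, of "axis j 1"]
      by (simp add: Complex_vec_axis inn c_def[symmetric] Ix)
    have "fourier_integral L (\<lambda>z. \<phi>y' z (axis j \<i>)) \<xi> ?y
      = (- 1) * fourier_integral L (\<lambda>z. \<phi>x' z (axis j 1)) \<xi> ?y
        + (\<i> * of_int p / of_real t) * fourier_integral L (\<lambda>z. \<phi>' z (axis j 1)) \<xi> ?y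
        + (s * (s - 1) / (of_real t)\<^sup>2) * fourier_integral L \<phi> \<xi> ?y"
    proof (rule fourier_integral_linear_combination[OF L ypos])
      show "continuous_on upper_half_space (\<lambda>z. \<phi>x' z (axis j 1))" using Cx by (simp add: C1_upper_def)
      show "continuous_on upper_half_space (\<lambda>z. \<phi>' z (axis j 1))" using C by (simp add: C1_upper_def)
      show "continuous_on upper_half_space \<phi>" using C by (rule C1_upper_continuous)
      fix x
      define z where "z = Complex_vec x ?y"
      have z: "z \<in> upper_half_space" "Im (z $ j) = t" using ypos by (auto simp: z_def)
      define r where "r = complex_of_real t"
      have r: "r \<noteq> 0" using t by (simp add: r_def)
      have "- r\<^sup>2 * (\<phi>x' z (axis j 1) + \<phi>y' z (axis j \<i>)) + \<i> * of_int p * r * \<phi>' z (axis j 1) = s * (1 - s) * \<phi> z"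
        using eigen[OF z(1)] unfolding Laplacian_def \<phi>_def[symmetric] px[OF z(1)] pxx[OF z(1)] pyy[OF z(1)] z(2) r_def[symmetric]
        by (simp add: \<phi>_def)
      then have "r\<^sup>2 * \<phi>y' z (axis j \<i>) = r\<^sup>2 * (- 1 * \<phi>x' z (axis j 1)) + \<i> * of_int p * r * \<phi>' z (axis j 1) + s * (s - 1) * \<phi> z"
        by (simp add: algebra_simps)
      also have "\<dots> = r\<^sup>2 * (- 1 * \<phi>x' z (axis j 1) + \<i> * of_int p / r * \<phi>' z (axis j 1) + s * (s - 1) / r\<^sup>2 * \<phi> z)"
        using r by (simp add: field_simps power2_eq_square)
      finally show "\<phi>y' z (axis j \<i>) = - 1 * \<phi>x' z (axis j 1) + \<i> * of_int p / r * \<phi>' z (axis j 1) + s * (s - 1) / r\<^sup>2 * \<phi> z"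
        using r by simp
    qed
    also have "\<dots> = whittaker_coeff (of_real (sgn (\<xi> $ j)) * of_int p / 2) (2 * pi * \<bar>\<xi> $ j\<bar>) s t * A t"
    proof -
      have "complex_of_real (\<bar>\<xi> $ j\<bar>) * of_real (sgn (\<xi> $ j)) = of_real (\<xi> $ j)"
        by (simp flip: of_real_mult add: abs_mult_sgn)
      then have k: "2 * complex_of_real (2 * pi * \<bar>\<xi> $ j\<bar>) * (of_real (sgn (\<xi> $ j)) * of_int p / 2) = 2 * of_real pi * of_real (\<xi> $ j) * of_int p"
        by (simp add: algebra_simps)
      have q: "(complex_of_real (2 * pi * \<bar>\<xi> $ j\<bar>))\<^sup>2 = - (c * c)"
        by (simp add: c_def power_mult_distrib power2_eq_square[symmetric] flip: of_real_power)
      have ic: "\<i> * of_int p / of_real t * (c * A t) = - (2 * of_real pi * of_real (\<xi> $ j) * of_int p / of_real t) * A t"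
      proof -
        have "\<i> * c = - (2 * of_real pi * of_real (\<xi> $ j))" by (simp add: c_def complex_eq_iff)
        moreover have "\<i> * of_int p / of_real t * (c * A t) = \<i> * c * of_int p / of_real t * A t"
          by (simp add: mult_ac)
        ultimately show ?thesis by simp
      qed
      show ?thesis
        unfolding Ix Ixx A_def[symmetric] whittaker_coeff_def k q ic by (simp add: algebra_simps)
    qed
    finally have eq: "fourier_integral L (\<lambda>z. \<phi>y' z (axis j \<i>)) \<xi> ?y
      = whittaker_coeff (of_real (sgn (\<xi> $ j)) * of_int p / 2) (2 * pi * \<bar>\<xi> $ j\<bar>) s t * A t" .
    show "(A1 has_vector_derivative whittaker_coeff (of_real (sgn (\<xi> $ j)) * of_int p / 2) (2 * pi * \<bar>\<xi> $ j\<bar>) s t * A t) (at t)"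
      unfolding eq[symmetric] A1_def by (rule fourier_integral_has_vector_derivative[OF L Cy y t])
  qed
  then show ?thesis unfolding A_def \<phi>_def by blast
qed

text \<open>Real differentiability of the integral in \<open>s\<close> comes from the open set
  around the domain on which \<open>F\<close> is differentiable. The derivative is then complex
  linear for each \<open>x\<close>, hence after integration. The result is a derivative at
  \<open>s0\<close> in a full neighbourhood.\<close>

lemma fourier_coeff_field_differentiable:
  fixes F :: "complex ^ 'n \<Rightarrow> complex \<Rightarrow> complex" and L :: "(real ^ 'n) set"
  assumes T: "countable T"
    and analytic: "real_analytic_on (\<lambda>(z, s). F z s) (upper_half_space \<times> (half_plane a - T))"
    and holo: "\<And>z. z \<in> upper_half_space \<Longrightarrow> (\<lambda>s. F z s) holomorphic_on (half_plane a - T)"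
    and L: "is_lattice L" and y: "\<And>i. y $ i > 0" and s0: "s0 \<in> half_plane a - T"
  shows "(\<lambda>s. fourier_coeff L F \<xi> y s) field_differentiable (at s0)"
proof -
  define f where "f = (\<lambda>(z, s). F z s)"
  let ?D = "fundamental_domain L"
  note D = fundamental_domain_properties[OF L]
  define Z where "Z x = Complex_vec x y" for x
  have Zc: "continuous_on A Z" for A unfolding Z_def[abs_def] by (rule Complex_vec_continuous)
  obtain \<Omega> where \<Omega>: "open \<Omega>" "upper_half_space \<times> (half_plane a - T) \<subseteq> \<Omega>"
    "\<And>w. w \<in> \<Omega> \<Longrightarrow> f differentiable (at w)"
    "\<And>h. continuous_on \<Omega> (\<lambda>w. frechet_derivative f (at w) h)"
    by (rule real_analytic_C1[OF analytic, folded f_def]) blast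
  have ZU: "Z x \<in> upper_half_space" for x using y by (simp add: Z_def)
  have cD: "compact (closure ?D)" using D(2) by simp
  have "compact ((\<lambda>x. (Z x, s0)) ` closure ?D)"
    by (intro compact_continuous_image continuous_intros Zc cD)
  \<comment> \<open>A tube around the compact slice at \<open>s0\<close>: one radius in
    \<open>s\<close> works for all \<open>x\<close> of the fundamental domain.\<close>
  then obtain \<epsilon> where \<epsilon>: "\<epsilon> > 0" "(\<Union>w\<in>(\<lambda>x. (Z x, s0)) ` closure ?D. ball w \<epsilon>) \<subseteq> \<Omega>"
    by (rule compact_subset_open_imp_ball_epsilon_subset[OF _ \<Omega>(1)]) (use \<Omega>(2) ZU s0 in auto)
  define r where "r = \<epsilon> / 2"
  have r: "r > 0" using \<epsilon> by (simp add: r_def)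
  have mem: "(Z x, s) \<in> \<Omega>" if "x \<in> closure ?D" "s \<in> cball s0 r" for x s
  proof -
    have "(Z x, s) \<in> ball (Z x, s0) \<epsilon>" using that \<epsilon>(1) by (simp add: dist_Pair_Pair r_def)
    then show ?thesis using \<epsilon>(2) that(1) by blast
  qed
  define K where "K = (\<lambda>(x, s). (Z x, s)) ` (closure ?D \<times> cball s0 r)"
  have K: "compact K"
    unfolding K_def case_prod_unfold
    by (intro compact_continuous_image compact_Times cD compact_cball continuous_intros
        continuous_on_compose2[OF Zc[of UNIV]]) auto
  have K\<Omega>: "K \<subseteq> \<Omega>" using mem by (auto simp: K_def)
  have "\<exists>B. \<forall>w\<in>K. norm (frechet_derivative f (at w) h) \<le> B" for h
  proof -
    have "compact ((\<lambda>w. frechet_derivative f (at w) h) ` K)"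
      by (intro compact_continuous_image K continuous_on_subset[OF \<Omega>(4) K\<Omega>])
    then have "bounded ((\<lambda>w. frechet_derivative f (at w) h) ` K)" by (rule compact_imp_bounded)
    then show ?thesis unfolding bounded_iff by blast
  qed
  then obtain B where B: "\<And>h w. w \<in> K \<Longrightarrow> norm (frechet_derivative f (at w) h) \<le> B h" by metis
  define C where "C = B (0, 1) + B (0, \<i>)"
  have bnd: "norm (frechet_derivative f (at w) (0, h)) \<le> C * norm h" if "w \<in> K" for w h
  proof -
    have d: "f differentiable (at w)" using \<Omega>(3) K\<Omega> that by blast
    note lin = linear_frechet_derivative[OF d]
    have "(0 :: complex ^ 'n, h) = Re h *\<^sub>R (0, 1) + Im h *\<^sub>R (0, \<i>)"
      by (simp add: complex_eq_iff)
    then have "norm (frechet_derivative f (at w) (0, h))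
       = norm (Re h *\<^sub>R frechet_derivative f (at w) (0, 1) + Im h *\<^sub>R frechet_derivative f (at w) (0, \<i>))"
      using linear_add[OF lin] linear_scale[OF lin] by metis
    also have "\<dots> \<le> \<bar>Re h\<bar> * norm (frechet_derivative f (at w) (0, 1)) + \<bar>Im h\<bar> * norm (frechet_derivative f (at w) (0, \<i>))"
      by (rule order_trans[OF norm_triangle_ineq]) simp
    also have "\<dots> \<le> norm h * B (0, 1) + norm h * B (0, \<i>)"
      by (intro add_mono mult_mono B that abs_Re_le_cmod abs_Im_le_cmod) auto
    finally show ?thesis by (simp add: C_def algebra_simps)
  qed
  have cont: "set_integrable lborel ?D (\<lambda>x. g (Z x, s) * fourier_char \<xi> x)"
    if "continuous_on \<Omega> g" "s \<in> cball s0 r" for g s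
    using D that mem
    by (intro set_integrable_continuous_bounded continuous_on_mult fourier_char_continuous
        continuous_on_compose2[OF that(1)] continuous_on_Pair Zc continuous_on_const) auto
  have contf: "continuous_on \<Omega> f"
    using \<Omega>(1,3) by (intro continuous_at_imp_continuous_on ballI differentiable_imp_continuous_within) auto
  have der: "((\<lambda>s. f (Z x, s)) has_derivative (\<lambda>h. frechet_derivative f (at (Z x, s)) (0, h))) (at s)"
    if "(Z x, s) \<in> \<Omega>" for x s
  proof -
    have "(f has_derivative frechet_derivative f (at (Z x, s))) (at (Z x, s))"
      using \<Omega>(3)[OF that] by (simp add: frechet_derivative_works)
    then show ?thesis by (rule has_derivative_compose[rotated]) (auto intro!: derivative_eq_intros)
  qed
  have "((\<lambda>s. \<integral>x. indicator ?D x *\<^sub>R (f (Z x, s) * fourier_char \<xi> x) \<partial>lborel) has_derivative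
      (\<lambda>h. \<integral>x. indicator ?D x *\<^sub>R (frechet_derivative f (at (Z x, s0)) (0, h) * fourier_char \<xi> x) \<partial>lborel)) (at s0)"
  proof (rule has_derivative_integral_dominated[OF r, where g = "\<lambda>x. indicator ?D x * C"])
    fix s h :: complex and x assume "s \<in> ball s0 r"
    then have s: "s \<in> cball s0 r" by auto
    show "((\<lambda>s. indicator ?D x *\<^sub>R (f (Z x, s) * fourier_char \<xi> x)) has_derivative
        (\<lambda>h. indicator ?D x *\<^sub>R (frechet_derivative f (at (Z x, s)) (0, h) * fourier_char \<xi> x))) (at s)"
    proof (cases "x \<in> ?D")
      case True
      then have "(Z x, s) \<in> \<Omega>" using mem s closure_subset by blast
      then show ?thesis by (intro has_derivative_scaleR_right has_derivative_mult_left der)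
    qed simp
    show "norm (indicator ?D x *\<^sub>R (frechet_derivative f (at (Z x, s)) (0, h) * fourier_char \<xi> x)) \<le> indicator ?D x * C * norm h"
    proof (cases "x \<in> ?D")
      case True
      then have "(Z x, s) \<in> K" using s closure_subset[of ?D] by (auto simp: K_def)
      then show ?thesis using bnd True by (simp add: norm_mult)
    qed simp
    show "integrable lborel (\<lambda>x. indicator ?D x *\<^sub>R (f (Z x, s) * fourier_char \<xi> x))"
      using cont[OF contf s] by (simp add: set_integrable_def)
  next
    show "integrable lborel (\<lambda>x. indicator ?D x * C)"
      using D(1) emeasure_bounded_finite[OF D(2)] by (intro integrable_mult_left integrable_real_indicator) auto
    show "(\<lambda>x. indicator ?D x *\<^sub>R (frechet_derivative f (at (Z x, s0)) (0, h) * fourier_char \<xi> x)) \<in> borel_measurable lborel" for h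
      using cont[OF \<Omega>(4)[of "(0, h)"], of s0] r by (intro borel_measurable_integrable) (simp add: set_integrable_def)
  qed
  also have "(\<lambda>h. \<integral>x. indicator ?D x *\<^sub>R (frechet_derivative f (at (Z x, s0)) (0, h) * fourier_char \<xi> x) \<partial>lborel)
    = (\<lambda>h. h * (\<integral>x. indicator ?D x *\<^sub>R (frechet_derivative f (at (Z x, s0)) (0, 1) * fourier_char \<xi> x) \<partial>lborel))"
  proof
    fix h :: complex
    have lin: "frechet_derivative f (at (Z x, s0)) (0, h) = h * frechet_derivative f (at (Z x, s0)) (0, 1)" for x
    proof (rule complex_linear_derivative[OF T s0])
      show "((\<lambda>s. f (Z x, s)) has_derivative (\<lambda>h. frechet_derivative f (at (Z x, s0)) (0, h))) (at s0)"
        using der \<Omega>(2) ZU s0 by blast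
      show "(\<lambda>s. f (Z x, s)) field_differentiable at s0 within half_plane a - T"
        using holo[OF ZU, of x] s0 by (simp add: f_def holomorphic_on_def)
    qed
    show "(\<integral>x. indicator ?D x *\<^sub>R (frechet_derivative f (at (Z x, s0)) (0, h) * fourier_char \<xi> x) \<partial>lborel)
      = h * (\<integral>x. indicator ?D x *\<^sub>R (frechet_derivative f (at (Z x, s0)) (0, 1) * fourier_char \<xi> x) \<partial>lborel)"
      unfolding lin[of _] integral_mult_right_zero[symmetric] by (simp add: mult_ac)
  qed
  finally have "(\<lambda>s. \<integral>x. indicator ?D x *\<^sub>R (f (Z x, s) * fourier_char \<xi> x) \<partial>lborel) field_differentiable (at s0)"
    unfolding field_differentiable_def has_field_derivative_def mult_commute_abs by (rule exI)
  then have "(\<lambda>s. fourier_integral L (\<lambda>z. F z s) \<xi> y) field_differentiable (at s0)"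
    by (simp add: fourier_integral_def set_lebesgue_integral_def f_def Z_def)
  then show ?thesis
    unfolding fourier_coeff_eq_fourier_integral divide_inverse
    by (intro field_differentiable_mult field_differentiable_const)
qed

section \<open>Separation of variables and powers of the norm\<close>

lemma separated_function_product:
  fixes A :: "real ^ 'n \<Rightarrow> complex" and W :: "'n \<Rightarrow> real \<Rightarrow> complex" and t :: "'n \<Rightarrow> real"
  assumes sep: "\<And>y j. (\<And>i. y $ i > 0) \<Longrightarrow> \<exists>c. \<forall>t>0. A (vec_upd y j t) = c * W j t"
    and t: "\<And>j. t j > 0" and W: "\<And>j. W j (t j) \<noteq> 0"
    and y: "\<And>i. y $ i > 0"
  shows "A y = A (\<chi> i. t i) / (\<Prod>j\<in>UNIV. W j (t j)) * (\<Prod>j\<in>UNIV. W j (y $ j))"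
proof -
  \<comment> \<open>The unknown constant on each coordinate line cancels when the values at
    \<open>y $ k\<close> and \<open>t k\<close> are compared. The cross-multiplied form allows
    \<open>W j (y $ j)\<close> to vanish.\<close>
  have "A y * (\<Prod>j\<in>J. W j (t j)) = A (\<chi> i. if i \<in> J then t i else y $ i) * (\<Prod>j\<in>J. W j (y $ j))" for J :: "'n set"
    using finite[of J]
  proof (induction J)
    case empty
    then show ?case by simp
  next
    case (insert k J)
    define z where "z = (\<chi> i. if i \<in> J then t i else y $ i)"
    have zpos: "z $ i > 0" for i using y t by (simp add: z_def)
    obtain c where c: "\<And>\<tau>. \<tau> > 0 \<Longrightarrow> A (vec_upd z k \<tau>) = c * W k \<tau>" using sep[OF zpos] by blast
    have "vec_upd z k (y $ k) = z" "vec_upd z k (t k) = (\<chi> i. if i \<in> insert k J then t i else y $ i)"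
      using insert.hyps by (auto simp: z_def vec_eq_iff)
    then have "A z * W k (t k) = A (\<chi> i. if i \<in> insert k J then t i else y $ i) * W k (y $ k)"
      using c[OF y[of k]] c[OF t[of k]] by simp
    then have "A y * (\<Prod>j\<in>J. W j (t j)) * W k (t k)
      = (\<Prod>j\<in>J. W j (y $ j)) * (A (\<chi> i. if i \<in> insert k J then t i else y $ i) * W k (y $ k))"
      unfolding insert.IH z_def[symmetric] by (simp add: mult_ac)
    then show ?case using insert.hyps by (simp add: mult_ac)
  qed
  from this[of UNIV] show ?thesis using W by (simp add: field_simps prod_zero_iff)
qed

lemma powr_prod_of_real:
  fixes y :: "'i \<Rightarrow> real"
  assumes "finite I" "\<And>i. i \<in> I \<Longrightarrow> y i > 0"
  shows "of_real (\<Prod>i\<in>I. y i) powr (s::complex) = (\<Prod>i\<in>I. of_real (y i) powr s)"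
  using assms
proof (induction I)
  case (insert i I)
  then have "(\<Prod>i\<in>I. y i) > 0" "y i > 0" by (auto intro: prod_pos)
  then have "complex_of_real (y i * prod y I) powr s = of_real (y i) powr s * of_real (prod y I) powr s"
    unfolding of_real_mult by (intro powr_times_real) (auto simp del: of_real_prod)
  then show ?case using insert by (simp del: of_real_prod of_real_mult)
qed simp

lemma Norm_pos: "(\<And>i. y $ i > 0) \<Longrightarrow> Norm y > 0"
  unfolding Norm_def by (intro prod_pos) auto

lemma Norm_powr:
  assumes "\<And>i. y $ i > 0"
  shows "of_real \<bar>Norm y\<bar> powr (s::complex) = (\<Prod>j\<in>UNIV. of_real (y $ j) powr s)"
  using Norm_pos[OF assms] powr_prod_of_real[of UNIV "\<lambda>j. y $ j" s] assms by (simp add: Norm_def del: of_real_prod)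

lemma Norm_vec_upd: "Norm (vec_upd y j t) = t * (\<Prod>i\<in>UNIV - {j}. y $ i)"
  unfolding Norm_def by (subst prod.remove[of UNIV j]) auto

lemma whittaker_coeff_0: "whittaker_coeff \<kappa> 0 s t = s * (s - 1) / (of_real t)\<^sup>2"
  by (simp add: whittaker_coeff_def)

lemma m_p_ge: "\<bar>of_int (p $ j) / 2\<bar> \<le> m_p p"
proof -
  have "of_int (p $ j) / 2 \<le> m_p p" "- (of_int (p $ j) / 2) \<le> m_p p"
    unfolding m_p_def by (rule Max_ge, simp, blast)+
  then show ?thesis by linarith
qed

section \<open>Fourier coefficients for a fixed spectral parameter\<close>

context
  fixes F :: "complex ^ 'n \<Rightarrow> complex \<Rightarrow> complex" and L :: "(real ^ 'n) set" and p :: "int ^ 'n"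
    and S :: "complex set" and s b :: complex
  assumes analytic: "real_analytic_on (\<lambda>(z, s). F z s) (upper_half_space \<times> S)" and s: "s \<in> S" "Re s > 1"
    and L: "is_lattice L"
    and per: "\<And>z l. z \<in> upper_half_space \<Longrightarrow> l \<in> L \<Longrightarrow> F (z + Complex_vec l 0) s = F z s"
    and growth: "\<exists>C>0. \<forall>z\<in>upper_half_space.
            norm (F z s - b * of_real \<bar>Norm (Im_vec z)\<bar> powr s)
              \<le> C * norm (of_real \<bar>Norm (Im_vec z)\<bar> powr (1 - s))"
    and eigen: "\<And>j z. z \<in> upper_half_space \<Longrightarrow> Laplacian j (p $ j) (\<lambda>w. F w s) z = s * (1 - s) * F z s"
begin

lemma continuous_F: "continuous_on upper_half_space (\<lambda>z. F z s)"
  using C1_upper_continuous[OF C1_upper_real_analytic[OF analytic s(1)]] by simp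

text \<open>Characters have modulus 1, so one constant serves all \<xi>. The main term is kept as a
  Fourier integral of a constant, which is the volume times that constant for
  \<open>\<xi> = 0\<close> and vanishes for the other dual lattice points.\<close>

lemma fourier_integral_growth:
  "\<exists>C. \<forall>\<xi> y. (\<forall>i. y $ i > 0) \<longrightarrow> norm (fourier_integral L (\<lambda>z. F z s) \<xi> y
     - fourier_integral L (\<lambda>z. b * of_real \<bar>Norm y\<bar> powr s) \<xi> y) \<le> C * Norm y powr (1 - Re s)"
proof -
  let ?D = "fundamental_domain L"
  note D = fundamental_domain_properties[OF L]
  obtain C where C: "C > 0" "\<And>z. z \<in> upper_half_space \<Longrightarrow>
      norm (F z s - b * of_real \<bar>Norm (Im_vec z)\<bar> powr s) \<le> C * norm (of_real \<bar>Norm (Im_vec z)\<bar> powr (1 - s))"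
    using growth by blast
  have "norm (fourier_integral L (\<lambda>z. F z s) \<xi> y - fourier_integral L (\<lambda>z. b * of_real \<bar>Norm y\<bar> powr s) \<xi> y)
     \<le> measure lborel ?D * C * Norm y powr (1 - Re s)" if y': "\<forall>i. y $ i > 0" for \<xi> y
  proof -
    have y: "y $ i > 0" for i using y' by simp
    define c where "c = b * of_real \<bar>Norm y\<bar> powr s"
    define g where "g x = (F (Complex_vec x y) s - c) * fourier_char \<xi> x" for x
    note i = fourier_integrand_integrable[OF L continuous_F y, of \<xi>]
      fourier_integrand_integrable[OF L continuous_on_const[of _ c] y, of \<xi>]
    have gi: "set_integrable lborel ?D g"
      unfolding g_def left_diff_distrib by (intro set_integral_diff i)
    have "fourier_integral L (\<lambda>z. F z s) \<xi> y - fourier_integral L (\<lambda>z. c) \<xi> y = (LINT x:?D|lborel. g x)"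
      unfolding fourier_integral_def g_def left_diff_distrib by (intro set_integral_diff(2)[symmetric] i)
    also have "norm \<dots> \<le> (\<integral>x. norm (indicator ?D x *\<^sub>R g x) \<partial>lborel)"
      unfolding set_lebesgue_integral_def by (rule integral_norm_bound)
    also have "\<dots> \<le> (\<integral>x. indicator ?D x * (C * Norm y powr (1 - Re s)) \<partial>lborel)"
    proof (rule integral_mono)
      show "integrable lborel (\<lambda>x. norm (indicator ?D x *\<^sub>R g x))"
        using gi unfolding set_integrable_def by (rule integrable_norm)
      show "integrable lborel (\<lambda>x. indicator ?D x * (C * Norm y powr (1 - Re s)))"
        using D(1) emeasure_bounded_finite[OF D(2)] by (intro integrable_mult_left integrable_real_indicator) auto
      fix x
      have "norm (F (Complex_vec x y) s - c) \<le> C * norm (of_real \<bar>Norm y\<bar> powr (1 - s))"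
        using C(2)[of "Complex_vec x y"] y by (simp add: c_def)
      also have "\<dots> = C * Norm y powr (1 - Re s)"
        using Norm_pos[OF y] by (simp add: norm_powr_real_powr)
      finally show "norm (indicator ?D x *\<^sub>R g x) \<le> indicator ?D x * (C * Norm y powr (1 - Re s))"
        by (cases "x \<in> ?D") (simp_all add: g_def norm_mult)
    qed
    also have "\<dots> = measure lborel ?D * C * Norm y powr (1 - Re s)" using D(1) by simp
    finally show ?thesis by (simp add: c_def)
  qed
  then show ?thesis by blast
qed

text \<open>The power \<open>t powr s\<close> that is subtracted also solves Euler's equation, so
  the remainder is a solution to which the growth bound applies. At the base point
  \<open>y = 1\<close> the norm is 1, which identifies the second coefficient.\<close>

lemma constant_term:
  assumes y: "\<And>i. y $ i > 0"
  shows "fourier_coeff L F 0 y s = b * of_real \<bar>Norm y\<bar> powr s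
    + (fourier_coeff L F 0 1 s - b) * of_real \<bar>Norm y\<bar> powr (1 - s)"
proof -
  let ?V = "measure lborel (fundamental_domain L)"
  note D = fundamental_domain_properties[OF L]
  have z0: "0 \<in> dual_lattice L" by (simp add: dual_lattice_def Tr_def)
  have const: "fourier_integral L (\<lambda>z. c) 0 y = of_real ?V * c" for c y
    using D(1) emeasure_bounded_finite[OF D(2)]
    by (simp add: fourier_integral_def fourier_char_def set_lebesgue_integral_def scaleR_conv_of_real)
  obtain C where C: "\<And>\<xi> y. (\<forall>i. y $ i > 0) \<Longrightarrow> norm (fourier_integral L (\<lambda>z. F z s) \<xi> y
     - fourier_integral L (\<lambda>z. b * of_real \<bar>Norm y\<bar> powr s) \<xi> y) \<le> C * Norm y powr (1 - Re s)"
    using fourier_integral_growth by blast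
  define G where "G y = fourier_coeff L F 0 y s - b * of_real \<bar>Norm y\<bar> powr s" for y
  have Gb: "norm (G y) \<le> C / ?V * Norm y powr (1 - Re s)" if "\<And>i. y $ i > 0" for y
  proof -
    have "of_real ?V * G y = fourier_integral L (\<lambda>z. F z s) 0 y - fourier_integral L (\<lambda>z. b * of_real \<bar>Norm y\<bar> powr s) 0 y"
      unfolding const using D(3) by (simp add: G_def fourier_coeff_eq_fourier_integral algebra_simps)
    then have "?V * norm (G y) \<le> C * Norm y powr (1 - Re s)"
      using C[of y 0] that D(3) by (metis norm_mult norm_of_real abs_of_pos)
    then show ?thesis using D(3) by (simp add: field_simps)
  qed
  have sep: "\<exists>c. \<forall>t>0. G (vec_upd y j t) = c * of_real t powr (1 - s)" if y: "\<And>i. y $ i > 0" for y j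
  proof -
    define P where "P = (\<Prod>i\<in>UNIV - {j}. y $ i)"
    have P: "P > 0" unfolding P_def using y by (intro prod_pos) auto
    obtain A1 where A1: "\<And>t. t > 0 \<Longrightarrow> ((\<lambda>t. fourier_integral L (\<lambda>z. F z s) 0 (vec_upd y j t)) has_vector_derivative A1 t) (at t)"
      "\<And>t. t > 0 \<Longrightarrow> (A1 has_vector_derivative s * (s - 1) / (of_real t)\<^sup>2 * fourier_integral L (\<lambda>z. F z s) 0 (vec_upd y j t)) (at t)"
      using fourier_integral_ode[OF analytic s(1) L per eigen[of _ j] z0, of y] y by (auto simp: whittaker_coeff_0)
    define B where "B = b * of_real P powr s"
    define f where "f t = fourier_integral L (\<lambda>z. F z s) 0 (vec_upd y j t) / of_real ?V - B * of_real t powr s" for t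
    define f1 where "f1 t = A1 t / of_real ?V - B * (s * of_real t powr (s - 1))" for t
    have fG: "f t = G (vec_upd y j t)" if t: "t > 0" for t
    proof -
      have "of_real \<bar>Norm (vec_upd y j t)\<bar> powr s = of_real P powr s * of_real t powr s"
        using t P by (simp add: Norm_vec_upd P_def[symmetric] powr_times_real mult.commute)
      then show ?thesis by (simp add: f_def G_def fourier_coeff_eq_fourier_integral B_def)
    qed
    have "f t = f 1 * of_real t powr (1 - s)" if t: "t > 0" for t
    proof (rule euler_ode_decaying[OF s(2), where ?f1.0 = f1 and C = "C / ?V * P powr (1 - Re s)"])
      fix t :: real assume t: "t > 0"
      show "(f has_vector_derivative f1 t) (at t)"
        unfolding f_def f1_def
        by (intro has_vector_derivative_diff has_vector_derivative_divide has_vector_derivative_mult_right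
            A1(1) has_vector_derivative_powr_of_real t)
      have "of_real t powr s = (of_real t)\<^sup>2 * complex_of_real t powr (s - 1 - 1)"
        using t by (simp add: powr_diff power2_eq_square)
      then have e: "s * ((s - 1) * of_real t powr (s - 1 - 1)) = s * (s - 1) / (of_real t)\<^sup>2 * complex_of_real t powr s"
        using t by simp
      show "(f1 has_vector_derivative s * (s - 1) / (of_real t)\<^sup>2 * f t) (at t)"
        unfolding f1_def
        by (rule has_vector_derivative_eq_rhs[OF has_vector_derivative_diff[OF has_vector_derivative_divide[OF A1(2)[OF t]]
             has_vector_derivative_mult_right[OF has_vector_derivative_mult_right[OF has_vector_derivative_powr_of_real[OF t]]]]])
          (unfold e f_def, simp add: algebra_simps)
      have "norm (f t) \<le> C / ?V * Norm (vec_upd y j t) powr (1 - Re s)"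
        unfolding fG[OF t] using y t by (intro Gb) auto
      also have "\<dots> = C / ?V * P powr (1 - Re s) * t powr (1 - Re s)"
        unfolding Norm_vec_upd P_def[symmetric] using t P by (simp add: powr_mult mult_ac)
      finally show "norm (f t) \<le> C / ?V * P powr (1 - Re s) * t powr (1 - Re s)" .
    qed (rule t)
    then show ?thesis using fG by (intro exI[of _ "f 1"]) metis
  qed
  have "G y = G (\<chi> i. 1) / (\<Prod>j\<in>(UNIV :: 'n set). of_real 1 powr (1 - s)) * (\<Prod>j\<in>UNIV. of_real (y $ j) powr (1 - s))"
    by (rule separated_function_product[OF sep]) (use y in auto)
  also have "(\<chi> i. 1) = (1 :: real ^ 'n)" by (simp add: vec_eq_iff)
  also have "(\<Prod>j\<in>UNIV. of_real (y $ j) powr (1 - s)) = of_real \<bar>Norm y\<bar> powr (1 - s)" using Norm_powr[OF y] by simp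
  finally have "G y = G 1 * of_real \<bar>Norm y\<bar> powr (1 - s)" by simp
  then show ?thesis by (simp add: G_def Norm_def algebra_simps)
qed

text \<open>The growth bound is a multiple of \<open>t powr (1 - Re s)\<close> along each coordinate
  line and so forces decay at infinity. The factor \<open>c\<close> is common to all
  \<open>y\<close>, which later allows \<open>y\<close> to be chosen freely.\<close>

lemma nonconstant_term:
  assumes \<xi>: "\<xi> \<in> dual_lattice L" "\<And>j. \<xi> $ j \<noteq> 0" and sM: "Re s > M_p p"
  defines "\<kappa> \<equiv> \<lambda>j. of_real (sgn (\<xi> $ j)) * of_int (p $ j) / 2" and "\<theta> \<equiv> \<lambda>j. 2 * pi * \<bar>\<xi> $ j\<bar>"
  shows "\<exists>c. \<forall>y. (\<forall>i. y $ i > 0) \<longrightarrow>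
    fourier_coeff L F \<xi> y s = c * (\<Prod>j\<in>UNIV. whittaker_fun (\<kappa> j) (\<theta> j) s (y $ j))"
proof -
  have \<theta>: "\<theta> j > 0" for j using \<xi>(2) by (simp add: \<theta>_def)
  \<comment> \<open>Here \<open>Re s > m_p + 1\<close> is used: the real part of
    \<open>\<kappa> j\<close> has modulus at most \<open>m_p\<close>.\<close>
  have a: "Re (s - \<kappa> j) \<ge> 1" for j
  proof -
    have "\<bar>Re (\<kappa> j)\<bar> = \<bar>of_int (p $ j) / 2\<bar>" using \<xi>(2)[of j] by (simp add: \<kappa>_def abs_mult)
    then show ?thesis using m_p_ge[of p j] sM by (simp add: M_p_def)
  qed
  have "\<xi> \<noteq> 0" using \<xi>(2) by (metis zero_index)
  obtain C where C0: "\<And>\<xi> y. (\<forall>i. y $ i > 0) \<Longrightarrow> norm (fourier_integral L (\<lambda>z. F z s) \<xi> y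
     - fourier_integral L (\<lambda>z. b * of_real \<bar>Norm y\<bar> powr s) \<xi> y) \<le> C * Norm y powr (1 - Re s)"
    using fourier_integral_growth by blast
  have C: "norm (fourier_integral L (\<lambda>z. F z s) \<xi> y) \<le> C * Norm y powr (1 - Re s)" if "\<And>i. y $ i > 0" for y
    using C0[of y \<xi>] fourier_integral_const[OF L \<xi>(1) \<open>\<xi> \<noteq> 0\<close> that] that by simp
  define A where "A = fourier_integral L (\<lambda>z. F z s) \<xi>"
  have sep: "\<exists>c. \<forall>t>0. A (vec_upd y j t) = c * whittaker_fun (\<kappa> j) (\<theta> j) s t" if y: "\<And>i. y $ i > 0" for y j
  proof -
    define P where "P = (\<Prod>i\<in>UNIV - {j}. y $ i)"
    have P: "P > 0" unfolding P_def using y by (intro prod_pos) auto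
    obtain A1 where A1: "\<And>t. t > 0 \<Longrightarrow> ((\<lambda>t. A (vec_upd y j t)) has_vector_derivative A1 t) (at t)"
      "\<And>t. t > 0 \<Longrightarrow> (A1 has_vector_derivative whittaker_coeff (\<kappa> j) (\<theta> j) s t * A (vec_upd y j t)) (at t)"
      using fourier_integral_ode[OF analytic s(1) L per eigen[of _ j] \<xi>(1), of y] y
      unfolding A_def \<kappa>_def \<theta>_def by blast
    have "((\<lambda>t. A (vec_upd y j t)) \<longlongrightarrow> 0) at_top"
    proof (rule Lim_null_comparison)
      show "\<forall>\<^sub>F t in at_top. norm (A (vec_upd y j t)) \<le> C * P powr (1 - Re s) * t powr (1 - Re s)"
        using eventually_gt_at_top[of 0]
      proof eventually_elim
        case (elim t)
        have "norm (A (vec_upd y j t)) \<le> C * Norm (vec_upd y j t) powr (1 - Re s)"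
          unfolding A_def using y elim by (intro C) auto
        also have "\<dots> = C * P powr (1 - Re s) * t powr (1 - Re s)"
          unfolding Norm_vec_upd P_def[symmetric] using elim P by (simp add: powr_mult mult_ac)
        finally show ?case .
      qed
      have "((\<lambda>t::real. t powr (1 - Re s)) \<longlongrightarrow> 0) at_top"
        using s(2) by (intro tendsto_neg_powr filterlim_ident) auto
      then show "((\<lambda>t. C * P powr (1 - Re s) * t powr (1 - Re s)) \<longlongrightarrow> 0) at_top"
        by (rule tendsto_mult_right_zero)
    qed
    then show ?thesis using whittaker_fun_unique[OF a \<theta> A1] by blast
  qed
  have "\<exists>t>0. whittaker_fun (\<kappa> j) (\<theta> j) s t \<noteq> 0" for j using whittaker_fun_nonzero[OF a \<theta>] .
  then obtain t where t: "\<And>j. t j > 0" "\<And>j. whittaker_fun (\<kappa> j) (\<theta> j) s (t j) \<noteq> 0" by metis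
  define c where "c = A (\<chi> i. t i) / (\<Prod>j\<in>UNIV. whittaker_fun (\<kappa> j) (\<theta> j) s (t j))"
  have "A y = c * (\<Prod>j\<in>UNIV. whittaker_fun (\<kappa> j) (\<theta> j) s (y $ j))" if "\<And>i. y $ i > 0" for y
    unfolding c_def by (rule separated_function_product[OF sep t that])
  then show ?thesis
    by (intro exI[of _ "c / of_real (measure lborel (fundamental_domain L))"])
      (simp add: fourier_coeff_eq_fourier_integral A_def)
qed

end

section \<open>Holomorphic dependence on the spectral parameter\<close>

lemma field_differentiable_prod:
  fixes f :: "'i \<Rightarrow> 'a::real_normed_field \<Rightarrow> 'a"
  assumes "\<And>i. i \<in> I \<Longrightarrow> f i field_differentiable (at x within S)"
  shows "(\<lambda>z. \<Prod>i\<in>I. f i z) field_differentiable (at x within S)"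
  using assms by (induction I rule: infinite_finite_induct) (auto intro: field_differentiable_mult)

theorem mainTheorem6:
  fixes T :: "complex set"
    and F :: "complex ^ 'n \<Rightarrow> complex \<Rightarrow> complex"
    and L :: "(real ^ 'n) set"
    and phi1 :: "complex \<Rightarrow> complex"
    and p :: "int ^ 'n"
  assumes T: "discrete T"
    and analytic: "real_analytic_on (\<lambda>(z, s). F z s) (upper_half_space \<times> (half_plane 1 - T))"
    and holo: "\<And>z. z \<in> upper_half_space \<Longrightarrow> (\<lambda>s. F z s) holomorphic_on (half_plane 1 - T)"
    and lattice: "is_lattice L"
    and periodic: "\<And>z s l. z \<in> upper_half_space \<Longrightarrow> s \<in> half_plane 1 - T \<Longrightarrow> l \<in> L \<Longrightarrow>
          F (z + Complex_vec l 0) s = F z s"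
    and growth: "\<And>s. s \<in> half_plane 1 - T \<Longrightarrow>
          \<exists>C>0. \<forall>z\<in>upper_half_space.
            norm (F z s - phi1 s * of_real \<bar>Norm (Im_vec z)\<bar> powr s)
              \<le> C * norm (of_real \<bar>Norm (Im_vec z)\<bar> powr (1 - s))"
    and eigen: "\<And>j z s. z \<in> upper_half_space \<Longrightarrow> s \<in> half_plane 1 - T \<Longrightarrow>
          Laplacian j (p $ j) (\<lambda>w. F w s) z = s * (1 - s) * F z s"
  shows "phi1 holomorphic_on (half_plane 1 - T) \<and>
         (\<exists>phi2. phi2 holomorphic_on (half_plane 1 - T) \<and>
            (\<forall>y s. (\<forall>j. y $ j > 0) \<longrightarrow> s \<in> half_plane 1 - T \<longrightarrow>
               fourier_coeff L F 0 y s =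
                 phi1 s * of_real \<bar>Norm y\<bar> powr s + phi2 s * of_real \<bar>Norm y\<bar> powr (1 - s))) \<and>
         (\<forall>\<xi> \<in> dual_lattice L - {0}. (\<forall>j. \<xi> $ j \<noteq> 0) \<longrightarrow>
            (\<exists>c. c holomorphic_on (half_plane (M_p p) - T) \<and>
               (\<forall>y s. (\<forall>j. y $ j > 0) \<longrightarrow> s \<in> half_plane (M_p p) - T \<longrightarrow>
                  fourier_coeff L F \<xi> y s =
                    c s * of_real \<bar>Norm y\<bar> powr s * B_coeff \<xi> y p s)))"
proof -
  let ?S = "half_plane 1 - T"
  have Re: "Re s > 1" if "s \<in> ?S" for s using that by (simp add: half_plane_def)
  have diff: "(\<lambda>s. fourier_coeff L F \<xi> y s) field_differentiable (at s0)"
    if "\<And>i. y $ i > 0" "s0 \<in> ?S" for \<xi> y s0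
    by (rule fourier_coeff_field_differentiable[OF discrete_imp_countable[OF T] analytic holo lattice that])
  have a0: "fourier_coeff L F 0 y s = phi1 s * of_real \<bar>Norm y\<bar> powr s
      + (fourier_coeff L F 0 1 s - phi1 s) * of_real \<bar>Norm y\<bar> powr (1 - s)"
    if "\<And>i. y $ i > 0" "s \<in> ?S" for y s
    by (rule constant_term[OF analytic that(2) Re[OF that(2)] lattice periodic[OF _ that(2)]
        growth[OF that(2)] eigen[OF _ that(2)] that(1)])
  \<comment> \<open>A second point besides \<open>y = 1\<close>, with a different norm. Eliminating
    \<open>phi2\<close> between the two equations expresses \<open>phi1\<close> through values of
    the constant term.\<close>
  define y2 :: "real ^ 'n" where "y2 = (\<chi> i. 2)"
  define N where "N = (2::real) ^ CARD('n)"
  have N: "N > 1" by (simp add: N_def)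
  have y2: "y2 $ i > 0" "\<bar>Norm y2\<bar> = N" for i by (simp_all add: y2_def Norm_def N_def)
  have one: "(1 :: real ^ 'n) $ i > 0" for i by simp
  define num where "num s = fourier_coeff L F 0 y2 s - of_real N powr (1 - s) * fourier_coeff L F 0 1 s" for s
  define den where "den s = complex_of_real N powr s - of_real N powr (1 - s)" for s
  \<comment> \<open>The two powers have different moduli because \<open>Re s = 1 - Re s\<close> is
    impossible for \<open>Re s > 1\<close>.\<close>
  have den: "den s \<noteq> 0" if "s \<in> ?S" for s
  proof
    assume "den s = 0"
    then have "norm (complex_of_real N powr s) = norm (complex_of_real N powr (1 - s))" by (simp add: den_def)
    then have "N powr Re s = N powr (1 - Re s)" using N by (simp add: norm_powr_real_powr)
    then show False using N Re[OF that] by (simp add: powr_inj)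
  qed
  have phi1: "phi1 s = num s / den s" if "s \<in> ?S" for s
    using a0[OF y2(1) that] den[OF that] unfolding y2(2) num_def den_def by (simp add: field_simps)
  have powr_diff: "(\<lambda>s. complex_of_real N powr g s) field_differentiable (at s0)"
    if "g holomorphic_on UNIV" for g s0
    using that by (auto intro!: holomorphic_on_imp_differentiable_at[of _ UNIV] holomorphic_intros)
  have phi1_diff: "phi1 field_differentiable (at s0 within ?S)" if s0: "s0 \<in> ?S" for s0
  proof -
    have "(\<lambda>s. num s / den s) field_differentiable (at s0)"
      unfolding num_def den_def
      by (intro field_differentiable_divide field_differentiable_diff field_differentiable_mult diff
          powr_diff y2 one s0 holomorphic_intros) (use den[OF s0] in \<open>simp add: den_def\<close>)
    then have "(\<lambda>s. num s / den s) field_differentiable (at s0 within ?S)"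
      by (rule field_differentiable_at_within)
    then show ?thesis
      by (rule field_differentiable_transform_within[OF zero_less_one s0, rotated]) (use phi1 in auto)
  qed
  then have holo1: "phi1 holomorphic_on ?S" by (simp add: holomorphic_on_def)
  have holo2: "(\<lambda>s. fourier_coeff L F 0 1 s - phi1 s) holomorphic_on ?S"
    unfolding holomorphic_on_def
    by (intro ballI field_differentiable_diff phi1_diff field_differentiable_at_within[OF diff] one)
  have coeff: "\<exists>c. c holomorphic_on (half_plane (M_p p) - T) \<and>
       (\<forall>y s. (\<forall>j. y $ j > 0) \<longrightarrow> s \<in> half_plane (M_p p) - T \<longrightarrow>
          fourier_coeff L F \<xi> y s = c s * of_real \<bar>Norm y\<bar> powr s * B_coeff \<xi> y p s)"
    if \<xi>: "\<xi> \<in> dual_lattice L" "\<And>j. \<xi> $ j \<noteq> 0" for \<xi>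
  proof -
    let ?M = "half_plane (M_p p) - T"
    define \<kappa> :: "'n \<Rightarrow> complex" where "\<kappa> j = of_real (sgn (\<xi> $ j)) * of_int (p $ j) / 2" for j
    define \<theta> where "\<theta> j = 2 * pi * \<bar>\<xi> $ j\<bar>" for j
    define Q where "Q y s = (\<Prod>j\<in>UNIV. tau_factor (\<kappa> j) s * whittaker_fun (\<kappa> j) (\<theta> j) s (y $ j))" for y s
    have \<theta>: "\<theta> j > 0" for j using \<xi>(2) by (simp add: \<theta>_def)
    \<comment> \<open>Any index shows that \<open>m_p\<close> is nonnegative, being a maximum over
      both signs.\<close>
    have M: "M_p p \<ge> 1" using m_p_ge[of p undefined] by (simp add: M_p_def)
    have MS: "s \<in> ?S" "Re s > M_p p" if "s \<in> ?M" for s using that M by (auto simp: half_plane_def)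
    have \<kappa>: "Re (s - \<kappa> j) > 1" "Re (s + \<kappa> j) > 1" "Re s > \<bar>of_int (p $ j) / 2\<bar>" if "s \<in> ?M" for s j
    proof -
      have "\<bar>Re (\<kappa> j)\<bar> = \<bar>of_int (p $ j) / 2\<bar>" using \<xi>(2)[of j] by (simp add: \<kappa>_def abs_mult)
      then show "Re (s - \<kappa> j) > 1" "Re (s + \<kappa> j) > 1" "Re s > \<bar>of_int (p $ j) / 2\<bar>"
        using m_p_ge[of p j] MS(2)[OF that] by (auto simp: M_p_def)
    qed
    have NB: "of_real \<bar>Norm y\<bar> powr s * B_coeff \<xi> y p s = Q y s" if "\<And>i. y $ i > 0" "s \<in> ?M" for y s
      unfolding B_coeff_def Norm_powr[OF that(1)] prod.distrib[symmetric] Q_def \<kappa>_def \<theta>_def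
      by (intro prod.cong refl tau_eq_whittaker_fun \<xi> that \<kappa>)
    have tf: "tau_factor (\<kappa> j) s \<noteq> 0" if "s \<in> ?M" for s j
      using \<kappa>[OF that, of j] by (intro tau_factor_nonzero) auto
    have "\<exists>c. \<forall>y. (\<forall>i. y $ i > 0) \<longrightarrow> fourier_coeff L F \<xi> y s = c * Q y s" if s: "s \<in> ?M" for s
    proof -
      note sS = MS(1)[OF s]
      obtain d where d: "\<And>y. (\<forall>i. y $ i > 0) \<Longrightarrow>
          fourier_coeff L F \<xi> y s = d * (\<Prod>j\<in>UNIV. whittaker_fun (\<kappa> j) (\<theta> j) s (y $ j))"
        using nonconstant_term[OF analytic sS Re[OF sS] lattice periodic[OF _ sS] growth[OF sS] eigen[OF _ sS]
            \<xi> MS(2)[OF s]]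
        unfolding \<kappa>_def \<theta>_def by blast
      have "(\<Prod>j\<in>UNIV. tau_factor (\<kappa> j) s) \<noteq> 0" using tf[OF s] by simp
      then have "fourier_coeff L F \<xi> y s = d / (\<Prod>j\<in>UNIV. tau_factor (\<kappa> j) s) * Q y s" if "\<forall>i. y $ i > 0" for y
        using d[OF that] by (simp add: Q_def prod.distrib)
      then show ?thesis by blast
    qed
    then obtain c where c: "\<And>s y. s \<in> ?M \<Longrightarrow> (\<forall>i. y $ i > 0) \<Longrightarrow> fourier_coeff L F \<xi> y s = c s * Q y s"
      by metis
    have "c field_differentiable (at s0 within ?M)" if s0: "s0 \<in> ?M" for s0
    proof -
      have "\<exists>t>0. whittaker_fun (\<kappa> j) (\<theta> j) s0 t \<noteq> 0" for j
        using whittaker_fun_nonzero[OF _ \<theta>[of j], of s0 "\<kappa> j"] \<kappa>(1)[OF s0, of j] by simp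
      then obtain t where t: "\<And>j. t j > 0" "\<And>j. whittaker_fun (\<kappa> j) (\<theta> j) s0 (t j) \<noteq> 0" by metis
      define y where "y = (\<chi> i. t i)"
      have y: "y $ i > 0" for i using t by (simp add: y_def)
      have Q0: "Q y s0 \<noteq> 0" using tf[OF s0] t by (simp add: Q_def y_def)
      have Qd: "(\<lambda>s. Q y s) field_differentiable (at s0)"
        unfolding Q_def
        by (intro field_differentiable_prod field_differentiable_mult tau_factor_field_differentiable
            whittaker_fun_field_differentiable \<kappa>(1)[OF s0] \<theta> y)
      then have "isCont (\<lambda>s. Q y s) s0" by (rule field_differentiable_imp_continuous_at)
      \<comment> \<open>With \<open>y\<close> fixed, \<open>c\<close> must equal the quotient at all
        nearby points of the domain, not just at \<open>s0\<close>, to inherit its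
        derivative.\<close>
      then have "\<forall>\<^sub>F s in nhds s0. Q y s \<noteq> 0"
        using Q0 unfolding isCont_def tendsto_at_iff_tendsto_nhds by (intro tendsto_imp_eventually_ne)
      then obtain e where e: "e > 0" "\<And>s. dist s s0 < e \<Longrightarrow> Q y s \<noteq> 0" by (auto simp: eventually_nhds_metric)
      have "(\<lambda>s. fourier_coeff L F \<xi> y s / Q y s) field_differentiable (at s0)"
        by (intro field_differentiable_divide diff Qd Q0 y MS(1)[OF s0])
      then have "(\<lambda>s. fourier_coeff L F \<xi> y s / Q y s) field_differentiable (at s0 within ?M)"
        by (rule field_differentiable_at_within)
      then show ?thesis
        by (rule field_differentiable_transform_within[OF e(1) s0, rotated]) (use e c y in auto)
    qed
    then have "c holomorphic_on ?M" by (simp add: holomorphic_on_def)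
    then show ?thesis using c NB by (intro exI[of _ c]) (auto simp: mult.assoc)
  qed
  show ?thesis using holo1 holo2 a0 coeff by blast
qed

end
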